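(* Assume $\mathrm{W}[1]\neq \mathrm{FPT}$. Then for every computable function $f:\mathbb{N}\to\mathbb{N}$ and every unbounded computable function $\epsilon:\mathbb{N}\to\mathbb{N}$, there is no algorithm running in time $f(k)\cdot N^{O(1)}$ that, given an integer $k$ and an $N$-vertex set cover instance $I$, distinguishes between (1) $opt(I)\le k$, and (2) $opt(I)>(\log N)^{1/\epsilon(k)}$.
   Context: A set cover instance is a bipartite graph $I=(S,U,E)$; a subset $C\subseteq S$ covers $U$ if every vertex of $U$ is adjacent to some vertex of $C$, and $opt(I)$ is the minimum size of such a $C$. The number of vertices of $I$ is $|S|+|U|$. Logarithms are base 2. The hypothesis $\mathrm{W}[1]\neq\mathrm{FPT}$: for every computable function $g:\mathbb{N}\to\mathbb{N}$, no algorithm can, given an $n$-vertex graph $G$ and an integer $k$, decide whether $G$ contains a $k$-clique in time $g(k)\cdot n^{O(1)}$. *)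

theory Defs
  imports Complex_Main "HOL-Library.Extended_Real"
begin

section \<open>Machine model: structured uniform-cost RAM programs\<close>

text \<open>
  A random access machine has registers (first component of the state) and an
  unbounded memory (second component), both holding natural numbers. Register names in a
  program are static; \<open>Load\<close> and \<open>Store\<close> address the memory indirectly. Every elementary
  instruction and every test takes one time unit. Arithmetic is restricted to addition and
  truncated subtraction: numbers then have at most linearly many bits in the running time, so
  running times agree up to a polynomial with those of Turing machines. This would fail with
  unit-cost multiplication.
\<close>

type_synonym state = "(nat \<Rightarrow> nat) \<times> (nat \<Rightarrow> nat)"

datatype prog =
    Const nat nat
  | Add nat nat nat
  | Sub nat nat nat
  | Load nat nat
  | Store nat nat
  | Seq prog prog
  | IfNZ nat prog prog
  | WhileNZ nat prog

inductive exec :: "prog \<Rightarrow> state \<Rightarrow> nat \<Rightarrow> state \<Rightarrow> bool" where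
  Const: "exec (Const x a) (r, m) 1 (r(x := a), m)"
| Add: "exec (Add x y z) (r, m) 1 (r(x := r y + r z), m)"
| Sub: "exec (Sub x y z) (r, m) 1 (r(x := r y - r z), m)"
| Load: "exec (Load x y) (r, m) 1 (r(x := m (r y)), m)"
| Store: "exec (Store x y) (r, m) 1 (r, m(r x := r y))"
| Seq: "exec P \<sigma> t \<sigma>' \<Longrightarrow> exec Q \<sigma>' t' \<sigma>'' \<Longrightarrow> exec (Seq P Q) \<sigma> (t + t') \<sigma>''"
| If_nonzero: "fst \<sigma> x \<noteq> 0 \<Longrightarrow> exec P \<sigma> t \<sigma>' \<Longrightarrow> exec (IfNZ x P Q) \<sigma> (1 + t) \<sigma>'"
| If_zero: "fst \<sigma> x = 0 \<Longrightarrow> exec Q \<sigma> t \<sigma>' \<Longrightarrow> exec (IfNZ x P Q) \<sigma> (1 + t) \<sigma>'"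
| While_stop: "fst \<sigma> x = 0 \<Longrightarrow> exec (WhileNZ x P) \<sigma> 1 \<sigma>"
| While_step: "fst \<sigma> x \<noteq> 0 \<Longrightarrow> exec P \<sigma> t \<sigma>' \<Longrightarrow> exec (WhileNZ x P) \<sigma>' t' \<sigma>''
    \<Longrightarrow> exec (WhileNZ x P) \<sigma> (1 + t + t') \<sigma>''"

text \<open>The input is placed in memory cells 0, 1, 2, ...; the output is read from register 0.\<close>

definition init :: "nat list \<Rightarrow> state" where
  "init xs = ((\<lambda>_. 0), (\<lambda>i. if i < length xs then xs ! i else 0))"

definition outputs :: "prog \<Rightarrow> nat list \<Rightarrow> nat \<Rightarrow> nat \<Rightarrow> bool" where
  "outputs P xs t v \<longleftrightarrow> (\<exists>\<sigma>. exec P (init xs) t \<sigma> \<and> fst \<sigma> 0 = v)"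

inductive_cases exec_elims:
  "exec (Const x a) \<sigma> t \<sigma>'"
  "exec (Add x y z) \<sigma> t \<sigma>'"
  "exec (Sub x y z) \<sigma> t \<sigma>'"
  "exec (Load x y) \<sigma> t \<sigma>'"
  "exec (Store x y) \<sigma> t \<sigma>'"
  "exec (Seq P Q) \<sigma> t \<sigma>'"
  "exec (IfNZ x P Q) \<sigma> t \<sigma>'"
  "exec (WhileNZ x P) \<sigma> t \<sigma>'"

lemma exec_deterministic:
  "exec P \<sigma> t \<sigma>' \<Longrightarrow> exec P \<sigma> t2 \<sigma>2 \<Longrightarrow> t2 = t \<and> \<sigma>2 = \<sigma>'"
proof (induction arbitrary: t2 \<sigma>2 rule: exec.induct)
  case (Const x a r m)
  then show ?case by (rule exec_elims(1)) simp
next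
  case (Add x y z r m)
  then show ?case by (rule exec_elims(2)) simp
next
  case (Sub x y z r m)
  then show ?case by (rule exec_elims(3)) simp
next
  case (Load x y r m)
  then show ?case by (rule exec_elims(4)) simp
next
  case (Store x y r m)
  then show ?case by (rule exec_elims(5)) simp
next
  case (Seq P \<sigma> t \<sigma>' Q t' \<sigma>'')
  from Seq.prems obtain a \<rho> b where "exec P \<sigma> a \<rho>" "exec Q \<rho> b \<sigma>2" "t2 = a + b"
    by (rule exec_elims(6))
  with Seq.IH(1)[of a \<rho>] Seq.IH(2)[of b \<sigma>2] show ?case by simp
next
  case (If_nonzero \<sigma> x P t \<sigma>' Q)
  from If_nonzero.prems If_nonzero.hyps obtain a where "exec P \<sigma> a \<sigma>2" "t2 = 1 + a"
    by (auto elim: exec_elims(7))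
  with If_nonzero.IH[of a \<sigma>2] show ?case by simp
next
  case (If_zero \<sigma> x Q t \<sigma>' P)
  from If_zero.prems If_zero.hyps obtain a where "exec Q \<sigma> a \<sigma>2" "t2 = 1 + a"
    by (auto elim: exec_elims(7))
  with If_zero.IH[of a \<sigma>2] show ?case by simp
next
  case (While_stop \<sigma> x P)
  from While_stop.prems show ?case
    by (rule exec_elims(8)) (use While_stop.hyps in simp_all)
next
  case (While_step \<sigma> x P t \<sigma>' t' \<sigma>'')
  from While_step.prems obtain a \<rho> b
    where "exec P \<sigma> a \<rho>" "exec (WhileNZ x P) \<rho> b \<sigma>2" "t2 = 1 + a + b"
    by (rule exec_elims(8)) (use While_step.hyps in simp_all)
  with While_step.IH(1)[of a \<rho>] While_step.IH(2)[of b \<sigma>2] show ?case by simp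
qed

lemma outputs_deterministic:
  "outputs P xs t v \<Longrightarrow> outputs P xs t' v' \<Longrightarrow> t' = t \<and> v' = v"
  unfolding outputs_def using exec_deterministic by blast

definition computable :: "(nat \<Rightarrow> nat) \<Rightarrow> bool" where
  "computable f \<longleftrightarrow> (\<exists>P. \<forall>n. \<exists>t. outputs P [n] t (f n))"


section \<open>The clique problem and the hypothesis W[1] \<open>\<noteq>\<close> FPT\<close>

definition simple_graph :: "nat \<Rightarrow> (nat \<times> nat) set \<Rightarrow> bool" where
  "simple_graph n E \<longleftrightarrow> E \<subseteq> {..<n} \<times> {..<n} \<and> sym E \<and> irrefl E"

definition has_clique :: "nat \<Rightarrow> (nat \<times> nat) set \<Rightarrow> nat \<Rightarrow> bool" where
  "has_clique n E k \<longleftrightarrow>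
     (\<exists>K \<subseteq> {..<n}. card K = k \<and> (\<forall>x\<in>K. \<forall>y\<in>K. x \<noteq> y \<longrightarrow> (x, y) \<in> E))"

definition encode_clique :: "nat \<Rightarrow> nat \<Rightarrow> (nat \<times> nat) set \<Rightarrow> nat list" where
  "encode_clique k n E = k # n # [of_bool ((i, j) \<in> E). i \<leftarrow> [0..<n], j \<leftarrow> [0..<n]]"

text \<open>
  The factor \<open>n^O(1)\<close> is rendered as \<open>c * (n + 1) ^ c\<close> for some constant \<open>c\<close>. A bare \<open>n ^ c\<close> would
  allow no steps at all on the graph with no vertices, and hence would make all the lower bounds
  trivially true. A nonzero output means yes.
\<close>

definition decides_clique :: "(nat \<Rightarrow> nat) \<Rightarrow> prog \<Rightarrow> bool" where
  "decides_clique g P \<longleftrightarrow>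
     (\<exists>c. \<forall>k n E. simple_graph n E \<longrightarrow>
        (\<exists>t v. outputs P (encode_clique k n E) t v \<and>
               t \<le> g k * (c * (n + 1) ^ c) \<and>
               (v \<noteq> 0 \<longleftrightarrow> has_clique n E k)))"

definition W1_neq_FPT :: bool where
  "W1_neq_FPT \<longleftrightarrow> (\<forall>g. computable g \<longrightarrow> \<not> (\<exists>P. decides_clique g P))"


section \<open>Set cover\<close>

definition covers :: "'a set \<Rightarrow> 'a set \<Rightarrow> ('a \<times> 'a) set \<Rightarrow> 'a set \<Rightarrow> bool" where
  "covers S U E C \<longleftrightarrow> finite C \<and> C \<subseteq> S \<and> (\<forall>u\<in>U. \<exists>s\<in>C. (s, u) \<in> E)"

text \<open>The value is \<open>\<infinity>\<close> if there is no cover.\<close>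

definition opt :: "'a set \<Rightarrow> 'a set \<Rightarrow> ('a \<times> 'a) set \<Rightarrow> enat" where
  "opt S U E = (INF C \<in> {C. covers S U E C}. enat (card C))"

text \<open>
  For input to a machine the vertices are numbered so that \<open>S = {..<p}\<close> and
  \<open>U = {p..<p + q}\<close>; the number of vertices is then \<open>N = p + q\<close>.
\<close>

definition set_cover_instance :: "nat \<Rightarrow> nat \<Rightarrow> (nat \<times> nat) set \<Rightarrow> bool" where
  "set_cover_instance p q E \<longleftrightarrow> E \<subseteq> {..<p} \<times> {p..<p + q}"

definition opt_instance :: "nat \<Rightarrow> nat \<Rightarrow> (nat \<times> nat) set \<Rightarrow> enat" where
  "opt_instance p q E = opt {..<p} {p..<p + q} E"

definition encode_set_cover :: "nat \<Rightarrow> nat \<Rightarrow> nat \<Rightarrow> (nat \<times> nat) set \<Rightarrow> nat list" where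
  "encode_set_cover k p q E =
     k # p # q # [of_bool ((i, j) \<in> E). i \<leftarrow> [0..<p], j \<leftarrow> [p..<p + q]]"

definition small_opt :: "nat \<Rightarrow> nat \<Rightarrow> nat \<Rightarrow> (nat \<times> nat) set \<Rightarrow> bool" where
  "small_opt k p q E \<longleftrightarrow> opt_instance p q E \<le> enat k"

text \<open>
  If \<open>\<epsilon> k = 0\<close>, the threshold is read as \<open>\<infinity>\<close>, so that no instance is in the second case
  (whereas \<open>1 / 0 = 0\<close> in HOL).
\<close>

definition large_opt :: "(nat \<Rightarrow> nat) \<Rightarrow> nat \<Rightarrow> nat \<Rightarrow> nat \<Rightarrow> (nat \<times> nat) set \<Rightarrow> bool" where
  "large_opt \<epsilon> k p q E \<longleftrightarrow> \<epsilon> k > 0 \<and>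
     ereal_of_enat (opt_instance p q E) > ereal (log 2 (real (p + q)) powr (1 / real (\<epsilon> k)))"

text \<open>
  The program must halt within the time bound on every instance. A nonzero output claims the
  first case, output 0 the second; the claim has to be true whenever one of the two cases holds,
  and is unconstrained otherwise. For \<open>N\<close> small compared with \<open>k\<close> both cases can
  hold at once, and then either answer is correct: demanding both answers would be contradictory
  and would make the nonexistence of an algorithm trivial.
\<close>

definition distinguishes_set_cover :: "(nat \<Rightarrow> nat) \<Rightarrow> (nat \<Rightarrow> nat) \<Rightarrow> prog \<Rightarrow> bool" where
  "distinguishes_set_cover f \<epsilon> P \<longleftrightarrow>
     (\<exists>c. \<forall>k p q E. set_cover_instance p q E \<longrightarrow>
        (\<exists>t v. outputs P (encode_set_cover k p q E) t v \<and>
               t \<le> f k * (c * (p + q + 1) ^ c) \<and>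
               (small_opt k p q E \<or> large_opt \<epsilon> k p q E \<longrightarrow>
                  (if v \<noteq> 0 then small_opt k p q E else large_opt \<epsilon> k p q E))))"

end

theory Submission imports Defs begin

text \<open>
  The gap comes from Lin's reduction. Whether a graph has a \<open>k\<close>-clique is first expressed as a cover
  problem with \<open>k\<^sup>2\<close> slots, to be filled with pairs of vertices, over a universe of size polylogarithmic in
  the number of vertices: equality of vertices is tested by their residues modulo all small numbers.
  The universe is then replaced by all functions from \<open>k\<^sup>2\<close>-tuples of hash values to it, once for every
  hash function of a family that is injective on every set of at most \<open>h\<close> rows for some member. A cover with
  at most \<open>h\<close> rows would yield, for the hash function that is injective on it, a tuple for which the rows
  consistent with it contain at most one pair per slot, hence define a clique. Double reduction modulo small
  numbers gives a family of hash functions small enough for \<open>h\<close> to be \<open>(log N)^(1/D)\<close>, where \<open>D\<close> depends on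
  \<open>k\<close> only. As \<open>\<epsilon>\<close> is unbounded, a parameter \<open>\<kappa> \<ge> k\<^sup>2\<close> with \<open>\<epsilon> \<kappa> > D\<close> can be found by search, and then the gap
  exceeds the one of the theorem.

  On the machine side, the hypothetical algorithm and the programs computing \<open>\<kappa>\<close> and similar parameters are
  relocated to unused registers and memory. They are instrumented to report their time and the
  addresses they use, so that the memory can be cleaned up and the running times are themselves
  computable functions of \<open>k\<close>.
\<close>

text \<open>What shapes the parameters is a circularity of sizes. The columns number a multiple of
  \<open>W = w ^ (r ^ (k * k))\<close>, so the instance is polynomial in
  \<open>M = 2 ^ h ^ D\<close> only if \<open>r ^ (k * k)\<close> times the logarithm of
  \<open>w\<close> is at most \<open>h ^ D\<close>. One reduction modulo small numbers that
  separates \<open>h\<close> numbers below \<open>M * M\<close> needs moduli up to about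
  \<open>h ^ (D + 2)\<close>: the least common multiple of \<open>1..Q\<close> is exponential in
  \<open>Q\<close> and has to beat \<open>(M * M) ^ (h * h)\<close>. With that as the range of the
  hash function, the exponent exceeds \<open>h ^ D\<close> whatever \<open>D\<close> is. The second
  reduction only has to separate numbers below \<open>Q\<close>, whose logarithm is small, and
  brings the range down to \<open>h ^ 6\<close>, independently of \<open>D\<close> as long as
  \<open>D \<le> h\<close>. Hence \<open>D = 6 * (k * k) + 8\<close>. The case of a clique has a
  difficulty of its own: for small \<open>N\<close> the cover by \<open>k * k\<close> rows could
  also exceed the threshold, and then either answer would be allowed. Requiring
  \<open>h \<ge> (k * k) ^ \<epsilon> \<kappa>\<close> excludes this.\<close>

section \<open>Separating residues\<close>

text \<open>The entries \<open>1 / (m * (n choose m))\<close> of Leibniz' harmonic triangle are differences of entries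
  of the previous column.\<close>

lemma Lcm_div_binomial_in_Ints:
  assumes "1 \<le> m" "m \<le> n" "n \<le> N"
  shows "real (Lcm {1..N}) / (real m * real (n choose m)) \<in> \<int>"
  using assms(1,2,3)
proof (induction m arbitrary: n rule: nat_induct_at_least)
  case base
  then have "n dvd Lcm {1..N}" by (intro dvd_Lcm) auto
  then obtain c where "Lcm {1..N} = n * c" by (rule dvdE)
  with base show ?case by simp
next
  case (Suc m)
  then obtain n' where n: "n = Suc n'" "m \<le> n'" by (cases n) auto
  let ?L = "real (Lcm {1..N})"
  have pos: "real (n' choose m) > 0" "real (Suc n' choose m) > 0" "real (Suc n' choose Suc m) > 0"
    using n by (simp_all add: zero_less_binomial del: binomial_Suc_Suc)
  have 1: "real (Suc m) * real (Suc n' choose Suc m) = real (Suc n') * real (n' choose m)"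
    using binomial_absorption[of m "Suc n'"] by (simp only: of_nat_mult[symmetric] diff_Suc_1)
  have 2: "(real (Suc n') - real m) * real (Suc n' choose m) = real (Suc n') * real (n' choose m)"
  proof -
    have "real (Suc n') - real m = real (Suc n' - m)" using n by (simp add: of_nat_diff)
    with binomial_absorb_comp[of "Suc n'" m] show ?thesis by (simp only: of_nat_mult[symmetric] diff_Suc_1)
  qed
  have "?L / (real (Suc m) * real (Suc n' choose Suc m)) =
      ?L / (real m * real (n' choose m)) - ?L / (real m * real (Suc n' choose m))"
  proof -
    have m: "real m > 0" using Suc.hyps by simp
    \<comment> \<open>Here \<open>N\<close> shadows the outer bound and stands for
      \<open>Suc n'\<close>; its first hypothesis is the absorption identity
      \<open>2\<close>.\<close>
    have "1 / (m * a) - 1 / (m * b) = 1 / (N * a)"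
      if "(N - m) * b = N * a" "m > 0" "a > 0" "b > 0" "N > 0" for N m a b :: real
    proof -
      have "1 / (m * a) - 1 / (m * b) = (b - a) / (m * a * b)"
        using that by (simp add: field_simps)
      also have "b - a = m * b / N"
        using that by (simp add: field_simps)
      finally show ?thesis using that by simp
    qed
    from this[OF 2 m pos(1,2)]
    have "1 / (real m * real (n' choose m)) - 1 / (real m * real (Suc n' choose m)) =
        1 / (real (Suc n') * real (n' choose m))" by simp
    then have "?L * (1 / (real m * real (n' choose m)) - 1 / (real m * real (Suc n' choose m))) =
        ?L * (1 / (real (Suc n') * real (n' choose m)))" by simp
    with 1 show ?thesis by (simp add: algebra_simps)
  qed
  moreover have "?L / (real m * real (n' choose m)) \<in> \<int>" "?L / (real m * real (Suc n' choose m)) \<in> \<int>"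
    using Suc.IH[of n'] Suc.IH[of "Suc n'"] Suc.prems n by auto
  ultimately show ?case unfolding n by (simp only: Ints_diff)
qed

lemma Lcm_atLeast1_pos: "Lcm {1..N :: nat} > 0"
  by (rule Nat.gr0I) (simp add: Lcm_0_iff)

text \<open>In the middle of row \<open>2 * m\<close> the quotient is a positive integer, hence at
  least 1, and the central binomial coefficient is at least \<open>4 ^ m / (2 * m)\<close>. This
  exponential growth is what makes moduli of polylogarithmic size suffice.\<close>

lemma Lcm_atLeast1_lower_bound:
  assumes "m > 0" "2 * m \<le> N"
  shows "4 ^ m \<le> 2 * Lcm {1..N :: nat}"
proof -
  have "real (Lcm {1..N}) / (real m * real ((2 * m) choose m)) \<in> \<int>"
    using assms by (intro Lcm_div_binomial_in_Ints) auto
  then obtain c :: int where c: "real (Lcm {1..N}) / (real m * real ((2 * m) choose m)) = of_int c"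
    by (rule Ints_cases)
  have "c > 0"
    using c assms Lcm_atLeast1_pos[of N] by (metis divide_pos_pos mult_pos_pos of_int_0_less_iff of_nat_0_less_iff zero_less_binomial mult_le_mono1 le_add1 mult_2)
  then have "1 \<le> real (Lcm {1..N}) / (real m * real ((2 * m) choose m))"
    unfolding c by simp
  then have "real m * real ((2 * m) choose m) \<le> real (Lcm {1..N})"
    using assms by (simp add: field_simps)
  moreover have "4 ^ m / (2 * real m) \<le> real ((2 * m) choose m)"
    using assms(1) by (rule central_binomial_lower_bound)
  then have "4 ^ m \<le> 2 * (real m * real ((2 * m) choose m))"
    using assms by (simp add: field_simps)
  ultimately have "real (4 ^ m) \<le> real (2 * Lcm {1..N})" by simp
  then show ?thesis by (simp only: of_nat_le_iff)
qed

text \<open>If every modulus had a collision, each of \<open>1..Q\<close> would divide the product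
  of all differences of elements of \<open>V\<close>, and so would their least common multiple; but
  that product has at most \<open>h * h\<close> factors, each at most \<open>Z\<close>. Moduli are
  written \<open>Suc q\<close> to exclude 0.\<close>

lemma inj_on_mod_exists:
  fixes V :: "nat set"
  assumes "V \<subseteq> {..<Z}" "card V \<le> h" "Z ^ (h * h) < Lcm {1..Q}" "Z \<ge> 1"
  shows "\<exists>q<Q. inj_on (\<lambda>x. x mod Suc q) V"
proof (rule ccontr)
  assume "\<not> ?thesis"
  then have noinj: "\<not> inj_on (\<lambda>x. x mod Suc q) V" if "q < Q" for q using that by blast
  have fin: "finite V" using assms(1) finite_subset by blast
  define D where "D = {z \<in> V \<times> V. fst z < snd z}"
  have finD: "finite D" using fin by (simp add: D_def)
  have "\<exists>z\<in>D. q dvd snd z - fst z" if q: "q \<in> {1..Q}" for q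
  proof -
    from q noinj[of "q - 1"] obtain x y where xy: "x \<in> V" "y \<in> V" "x mod q = y mod q" "x < y"
      unfolding inj_on_def by (metis One_nat_def Suc_pred atLeastAtMost_iff diff_less le_less_trans
          less_le_trans linorder_neqE_nat neq0_conv zero_less_one not_less_eq_eq le_zero_eq)
    then have "q dvd y - x" by (metis less_imp_le mod_eq_dvd_iff_nat)
    with xy show ?thesis by (intro bexI[of _ "(x, y)"]) (auto simp: D_def)
  qed
  then have "q dvd (\<Prod>z\<in>D. snd z - fst z)" if "q \<in> {1..Q}" for q
    using that finD by (meson dvd_prodI dvd_trans)
  then have "Lcm {1..Q} dvd (\<Prod>z\<in>D. snd z - fst z)" by (rule Lcm_least)
  moreover have "(\<Prod>z\<in>D. snd z - fst z) > 0" by (rule prod_pos) (auto simp: D_def)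
  ultimately have "Lcm {1..Q} \<le> (\<Prod>z\<in>D. snd z - fst z)" by (rule dvd_imp_le)
  also have "\<dots> \<le> (\<Prod>z\<in>D. Z)"
    using assms(1) by (intro prod_mono) (auto simp: D_def)
  also have "\<dots> = Z ^ card D" by simp
  also have "\<dots> \<le> Z ^ (h * h)"
  proof (rule power_increasing)
    have "card D \<le> card (V \<times> V)" by (rule card_mono) (auto simp: D_def fin)
    then show "card D \<le> h * h"
      using assms(2) by (simp add: card_cartesian_product) (meson le_trans mult_le_mono)
  qed (use assms(4) in simp)
  finally show False using assms(3) by simp
qed

section \<open>Digits\<close>

definition digit :: "nat \<Rightarrow> nat \<Rightarrow> nat \<Rightarrow> nat" where
  "digit b i x = x div b ^ i mod b"

text \<open>Lets a number below \<open>b ^ l\<close> stand for an arbitrary function from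
  \<open>{..<l}\<close> to \<open>{..<b}\<close>. Tuples of hash values and functions into the
  universe are both coded in this way.\<close>

lemma digits_exist:
  assumes "\<And>i. i < l \<Longrightarrow> d i < b"
  shows "\<exists>x<b ^ l. \<forall>i<l. digit b i x = d i"
  using assms
proof (induction l)
  case (Suc l)
  then obtain x where x: "x < b ^ l" "\<And>i. i < l \<Longrightarrow> digit b i x = d i" by auto
  have dl: "d l < b" using Suc.prems by simp
  have b: "b ^ i > 0" for i using dl by simp
  show ?case
  proof (intro exI[of _ "d l * b ^ l + x"] conjI allI impI)
    have "d l * b ^ l + x < d l * b ^ l + b ^ l" using x by simp
    also have "\<dots> = Suc (d l) * b ^ l" by simp
    also have "\<dots> \<le> b * b ^ l" using dl by (intro mult_right_mono) auto
    finally show "d l * b ^ l + x < b ^ Suc l" by simp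
    fix i assume "i < Suc l"
    show "digit b i (d l * b ^ l + x) = d i"
    proof (cases "i = l")
      case True
      with x dl b show ?thesis by (simp add: digit_def div_add1_eq[of "d l * b ^ l"])
    next
      case False
      with \<open>i < Suc l\<close> obtain j where j: "l = i + Suc j" using less_imp_Suc_add[of i l] by auto
      \<comment> \<open>The new leading digit contributes a multiple of \<open>b ^ Suc i\<close>,
        which digit \<open>i\<close> does not see.\<close>
      have "(d l * b ^ l + x) div b ^ i = d l * b ^ Suc j + x div b ^ i"
      proof -
        have "d l * b ^ l + x = x + (d l * b ^ Suc j) * b ^ i" by (simp add: j power_add ac_simps)
        then show ?thesis using b[of i] by (simp only: div_mult_self1)
      qed
      then have "digit b i (d l * b ^ l + x) = digit b i x"
        unfolding digit_def by (simp add: mod_add_left_eq[symmetric] mult.left_commute)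
      with x False \<open>i < Suc l\<close> show ?thesis by simp
    qed
  qed
qed simp

section \<open>The gap-producing reduction\<close>

text \<open>
  A row \<open>s = \<tau> * M\<^sup>2 + v\<close> assigns the pair \<open>(v div M, v mod M)\<close> of vertices to slot \<open>\<tau> = i * k + j\<close>.
  A universe element \<open>u = ((\<sigma> * 2 + z) * Q + (q - 1)) * Q + c\<close> of the underlying instance asks that the
  first (\<open>z = 0\<close>) or second (\<open>z = 1\<close>) vertex in slot \<open>\<sigma>\<close> be congruent to \<open>c\<close> modulo \<open>q\<close>, or that the vertex
  in the diagonal slot of the same index be not.
\<close>

definition base_cover :: "nat \<Rightarrow> nat \<Rightarrow> (nat \<Rightarrow> nat \<Rightarrow> bool) \<Rightarrow> nat \<Rightarrow> nat \<Rightarrow> nat \<Rightarrow> nat \<Rightarrow> nat \<Rightarrow> bool" where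
  "base_cover k n A M Q \<tau> v u \<longleftrightarrow>
     v div M < n \<and> v mod M < n \<and>
     (if \<tau> div k = \<tau> mod k then v div M = v mod M else A (v div M) (v mod M)) \<and>
     (\<tau> = u div (2 * Q * Q) \<and>
        (if u div (Q * Q) mod 2 = 0 then v div M else v mod M) mod Suc (u div Q mod Q) = u mod Q \<or>
      \<tau> = (if u div (Q * Q) mod 2 = 0 then u div (2 * Q * Q) div k else u div (2 * Q * Q) mod k) * Suc k \<and>
        v div M mod Suc (u div Q mod Q) \<noteq> u mod Q)"

text \<open>
  A column \<open>e = (q1 * r + q2) * W + F\<close> encodes a hash function \<open>v \<mapsto> v mod (q1 + 1) mod (q2 + 1)\<close> and,
  by its digits, a function \<open>F\<close> from the \<open>k\<^sup>2\<close>-tuples \<open>\<alpha>\<close> of hash values to the underlying universe.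
\<close>

definition cell :: "nat \<Rightarrow> nat \<Rightarrow> (nat \<Rightarrow> nat \<Rightarrow> bool) \<Rightarrow> nat \<Rightarrow> nat \<Rightarrow> nat \<Rightarrow> nat \<Rightarrow> nat \<Rightarrow> nat \<Rightarrow> nat \<Rightarrow> nat \<Rightarrow> bool" where
  "cell k n A M Q r l w W s e \<longleftrightarrow>
     (\<exists>\<alpha><l. digit r (s div (M * M)) \<alpha> = s mod (M * M) mod Suc (e div W div r) mod Suc (e div W mod r) \<and>
        base_cover k n A M Q (s div (M * M)) (s mod (M * M)) (digit w \<alpha> (e mod W)))"

lemma base_element_decode:
  fixes \<sigma> z q c Q K :: nat
  assumes "z < 2" "q < Q" "c < Q"
  defines "u \<equiv> ((\<sigma> * 2 + z) * Q + q) * Q + c"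
  shows "u mod Q = c" "u div Q mod Q = q" "u div (Q * Q) mod 2 = z" "u div (2 * Q * Q) = \<sigma>"
    "\<sigma> < K \<Longrightarrow> u < 2 * K * Q * Q"
proof -
  show "u mod Q = c" using assms by simp
  have 1: "u div Q = (\<sigma> * 2 + z) * Q + q" using assms by simp
  then show "u div Q mod Q = q" using assms by simp
  have 2: "u div (Q * Q) = \<sigma> * 2 + z" using assms 1 by (simp add: div_mult2_eq)
  then show "u div (Q * Q) mod 2 = z" using assms by simp
  have "u div (Q * Q * 2) = u div (Q * Q) div 2" by (rule div_mult2_eq)
  also have "\<dots> = (\<sigma> * 2 + z) div 2" by (simp only: 2)
  also have "\<dots> = \<sigma>" using assms(1) by simp
  finally have 3: "u div (Q * Q * 2) = \<sigma>" .
  then show 4: "u div (2 * Q * Q) = \<sigma>" by (simp add: ac_simps)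
  show "u < 2 * K * Q * Q" if "\<sigma> < K"
  proof -
    have "u < K * (2 * Q * Q)"
      using that 4 assms by (subst div_less_iff_less_mult[symmetric]) auto
    then show ?thesis by (simp add: ac_simps)
  qed
qed

text \<open>An element about a vertex \<open>x w\<close> is covered by its own slot if
  \<open>x w\<close> has the residue asked for, and by the diagonal slot of \<open>w\<close> if it
  does not. One of the two always applies.\<close>

lemma base_cover_complete:
  assumes k: "\<And>i. i < k \<Longrightarrow> x i < n" "n \<le> M" and A: "\<And>i j. i < k \<Longrightarrow> j < k \<Longrightarrow> i \<noteq> j \<Longrightarrow> A (x i) (x j)"
    and u: "u < 2 * (k * k) * Q * Q"
  shows "\<exists>\<tau><k * k. base_cover k n A M Q \<tau> (x (\<tau> div k) * M + x (\<tau> mod k)) u"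
proof -
  define \<sigma> where "\<sigma> = u div (2 * Q * Q)"
  define q where "q = Suc (u div Q mod Q)"
  have kpos: "k > 0" using u by (cases k) auto
  have "\<sigma> < k * k"
    unfolding \<sigma>_def using u by (intro less_mult_imp_div_less) (simp add: ac_simps)
  then have ij: "\<sigma> div k < k" "\<sigma> mod k < k" using kpos by (auto simp: less_mult_imp_div_less)
  define w where "w = (if u div (Q * Q) mod 2 = 0 then \<sigma> div k else \<sigma> mod k)"
  have w: "w < k" using ij by (simp add: w_def)
  \<comment> \<open>\<open>w * Suc k = w * k + w\<close> is the number of the diagonal slot
    \<open>(w, w)\<close>.\<close>
  have wk: "w * Suc k div k = w" "w * Suc k mod k = w" using w by simp_all
  have "w * Suc k < k * k"
  proof -
    have "w * Suc k < w * k + k" using w by simp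
    also have "\<dots> = Suc w * k" by simp
    also have "\<dots> \<le> k * k" using w by (intro mult_right_mono) auto
    finally show ?thesis .
  qed
  have M: "(x i * M + x j) div M = x i" "(x i * M + x j) mod M = x j" if "i < k" "j < k" for i j
    using k(1)[OF that(2)] k(2) by simp_all
  have xM: "x i mod M = x i" if "i < k" for i
    using k(1)[OF that] k(2) by simp
  have valid: "x i < n \<and> x j < n \<and> (if i = j then x i = x j else A (x i) (x j))" if "i < k" "j < k" for i j
    using that k A by auto
  show ?thesis
  proof (cases "x w mod q = u mod Q")
    case True
    then have "base_cover k n A M Q \<sigma> (x (\<sigma> div k) * M + x (\<sigma> mod k)) u"
      unfolding base_cover_def using valid[OF ij] True
      by (simp add: M[OF ij] M[OF ij(2) ij(2)] xM ij \<sigma>_def[symmetric] q_def w_def split: if_splits)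
    with \<open>\<sigma> < k * k\<close> show ?thesis by blast
  next
    case False
    then have "base_cover k n A M Q (w * Suc k) (x (w * Suc k div k) * M + x (w * Suc k mod k)) u"
      unfolding base_cover_def using valid[OF w w] unfolding wk M[OF w w]
      by (simp add: xM w \<sigma>_def[symmetric] q_def w_def split: if_splits)
    with \<open>w * Suc k < k * k\<close> show ?thesis by blast
  qed
qed

text \<open>At most one pair per slot is assumed; that no slot is empty follows, as its congruences for all
  residues \<open>c\<close> cannot be covered by a single diagonal pair.\<close>

lemma base_cover_sound:
  assumes "n \<le> M" and lcm: "M < Lcm {1..Q}" and Q: "Q \<ge> 2"
    and single: "\<And>\<tau> v v'. (\<tau>, v) \<in> Y \<Longrightarrow> (\<tau>, v') \<in> Y \<Longrightarrow> v = v'"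
    and cov: "\<And>u. u < 2 * (k * k) * Q * Q \<Longrightarrow> \<exists>(\<tau>, v)\<in>Y. base_cover k n A M Q \<tau> v u"
    and irr: "\<And>a. \<not> A a a"
  shows "\<exists>C\<subseteq>{..<n}. card C = k \<and> (\<forall>a\<in>C. \<forall>b\<in>C. a \<noteq> b \<longrightarrow> A a b)"
proof -
  define val where "val \<tau> v \<longleftrightarrow> (\<tau>, v) \<in> Y \<and> v div M < n \<and> v mod M < n \<and>
     (if \<tau> div k = \<tau> mod k then v div M = v mod M else A (v div M) (v mod M))" for \<tau> v
  define ix where "ix z \<sigma> = (if z = 0 then \<sigma> div k else \<sigma> mod k)" for z \<sigma> :: nat
  have cov': "(\<exists>v. val \<sigma> v \<and> (if z = 0 then v div M else v mod M) mod Suc q = c) \<or>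
      (\<exists>v. val (ix z \<sigma> * Suc k) v \<and> v div M mod Suc q \<noteq> c)"
    if "\<sigma> < k * k" "z < 2" "q < Q" "c < Q" for \<sigma> z q c
  proof -
    note dec = base_element_decode[OF that(2-4), of \<sigma>]
    from cov[OF dec(5)[OF that(1)]] obtain \<tau> v where v: "(\<tau>, v) \<in> Y"
      "base_cover k n A M Q \<tau> v (((\<sigma> * 2 + z) * Q + q) * Q + c)" by blast
    then have "val \<tau> v" unfolding val_def base_cover_def by blast
    moreover have "\<tau> = \<sigma> \<and> (if z = 0 then v div M else v mod M) mod Suc q = c \<or>
        \<tau> = ix z \<sigma> * Suc k \<and> v div M mod Suc q \<noteq> c"
      using v(2) unfolding base_cover_def dec(1-4) ix_def by blast
    ultimately show ?thesis by blast
  qed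
  have val_unique: "v = v'" if "val \<tau> v" "val \<tau> v'" for \<tau> v v'
    using that single unfolding val_def by blast
  \<comment> \<open>A nonzero difference would be divisible by all of \<open>1..Q\<close>, hence at
    least their least common multiple, which exceeds \<open>M\<close>.\<close>
  have eqI: "a = b" if "a < n" "b < n" "\<And>q. q < Q \<Longrightarrow> a mod Suc q = b mod Suc q" for a b
  proof (rule ccontr)
    assume "a \<noteq> b"
    define d where "d = (if a < b then b - a else a - b)"
    have d: "0 < d" "d < n" using that \<open>a \<noteq> b\<close> by (auto simp: d_def)
    have "q dvd d" if "q \<in> {1..Q}" for q
    proof -
      from that have "a mod q = b mod q" using \<open>\<And>q. q < Q \<Longrightarrow> a mod Suc q = b mod Suc q\<close>[of "q - 1"] by auto
      then show ?thesis unfolding d_def by (metis less_imp_le mod_eq_dvd_iff_nat not_less)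
    qed
    then have "Lcm {1..Q} dvd d" by (rule Lcm_least)
    with d have "Lcm {1..Q} \<le> d" by (intro dvd_imp_le)
    with d lcm assms(1) show False by simp
  qed
  \<comment> \<open>Modulus 1 and residue 1: no number has this residue, so only a diagonal pair can
    cover the element. The residue is admissible because \<open>Q \<ge> 2\<close>.\<close>
  have diag: "\<exists>v. val (ix z \<sigma> * Suc k) v" if "\<sigma> < k * k" "z < 2" for \<sigma> z
  proof (rule ccontr)
    assume no: "\<not> ?thesis"
    with cov'[OF that, of 0 1] Q show False by auto
  qed
  \<comment> \<open>With \<open>c\<close> the residue of the only diagonal pair, the diagonal slot
    fails on the element, so slot \<open>\<sigma>\<close> has to cover it.\<close>
  have all: "\<exists>v. val \<sigma> v" if s: "\<sigma> < k * k" for \<sigma>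
  proof (rule ccontr)
    assume no: "\<not> ?thesis"
    obtain v where v: "val (ix 0 \<sigma> * Suc k) v" using diag[OF s, of 0] by auto
    have "v div M mod Suc (Q - 1) < Suc (Q - 1)" by simp
    then have "v div M mod Suc (Q - 1) < Q" using Q by simp
    with cov'[OF s, of 0 "Q - 1" "v div M mod Suc (Q - 1)"] no Q v val_unique show False by auto
  qed
  \<comment> \<open>The same choice of \<open>c\<close>, now for every modulus: the diagonal vertex
    imposes all its residues on the vertex in slot \<open>\<sigma>\<close>.\<close>
  have agree: "(if z = 0 then v div M else v mod M) = v' div M"
    if "\<sigma> < k * k" "z < 2" "val \<sigma> v" "val (ix z \<sigma> * Suc k) v'" for \<sigma> z v v'
  proof (rule eqI)
    show "(if z = 0 then v div M else v mod M) < n" "v' div M < n" using that by (auto simp: val_def)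
    fix q assume q: "q < Q"
    have "v' div M mod Suc q < Suc q" by simp
    then have "v' div M mod Suc q < Q" using q by linarith
    from cov'[OF that(1,2) q this] that val_unique
    show "(if z = 0 then v div M else v mod M) mod Suc q = v' div M mod Suc q" by metis
  qed
  have sq: "i * k + j < k * k" if "i < k" "j < k" for i j
  proof -
    have "i * k + j < Suc i * k" using that by simp
    also have "\<dots> \<le> k * k" using that by (intro mult_right_mono) auto
    finally show ?thesis .
  qed
  have "\<forall>i. \<exists>v. i < k \<longrightarrow> val (i * Suc k) v" using all sq by (metis add.commute mult_Suc_right)
  then obtain y where y: "\<And>i. i < k \<Longrightarrow> val (i * Suc k) (y i)" by metis
  define x where "x i = y i div M" for i
  have xn: "x i < n" if "i < k" for i using y[OF that] by (simp add: val_def x_def)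
  have adj: "A (x i) (x j)" if "i < k" "j < k" "i \<noteq> j" for i j
  proof -
    let ?\<sigma> = "i * k + j"
    have s: "?\<sigma> < k * k" using sq that by blast
    obtain v where v: "val ?\<sigma> v" using all[OF s] by blast
    have ij: "?\<sigma> div k = i" "?\<sigma> mod k = j" using that by auto
    have "v div M = x i" using agree[OF s _ v, of 0 "y i"] y[OF that(1)] by (simp add: ix_def ij x_def)
    moreover have "ix 1 ?\<sigma> = j" using ij by (simp add: ix_def)
    then have "v mod M = x j"
      using agree[OF s _ v, of 1 "y j"] y[OF that(2)] by (simp add: x_def del: mult_Suc_right)
    ultimately show ?thesis using v that ij unfolding val_def by simp
  qed
  have "inj_on x {..<k}" using adj irr by (metis inj_onI lessThan_iff)
  then have "card (x ` {..<k}) = k" by (simp add: card_image)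
  moreover have "x ` {..<k} \<subseteq> {..<n}" using xn by auto
  ultimately show ?thesis using adj by (intro exI[of _ "x ` {..<k}"]) auto
qed

definition gap_edges :: "nat \<Rightarrow> nat \<Rightarrow> (nat \<Rightarrow> nat \<Rightarrow> bool) \<Rightarrow> (nat \<times> nat) set" where
  "gap_edges p q B = {(s, p + e) | s e. s < p \<and> e < q \<and> B s e}"

lemma set_cover_instance_gap_edges: "set_cover_instance p q (gap_edges p q B)"
  by (auto simp: set_cover_instance_def gap_edges_def)

context
  fixes k n M Q r w W p q :: nat and A :: "nat \<Rightarrow> nat \<Rightarrow> bool" and E :: "(nat \<times> nat) set"
  assumes nM: "n \<le> M" and r: "r > 0"
  defines "w \<equiv> 2 * (k * k) * Q * Q" and "W \<equiv> w ^ (r ^ (k * k))"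
    and "p \<equiv> k * k * (M * M)" and "q \<equiv> Q * r * W"
    and "E \<equiv> gap_edges p q (cell k n A M Q r (r ^ (k * k)) w W)"
begin

text \<open>The cover puts into slot \<open>\<tau>\<close> the pair of clique vertices with indices
  \<open>\<tau> div k\<close> and \<open>\<tau> mod k\<close>. For a column with hash function and
  \<open>F\<close>, let \<open>\<alpha>\<close> be the tuple of hash values of these pairs: every
  row is consistent with \<open>\<alpha>\<close>, and one of them covers the base element that
  \<open>F\<close> assigns to \<open>\<alpha>\<close>.\<close>

lemma gap_complete:
  assumes C: "C \<subseteq> {..<n}" "card C = k" "\<And>a b. a \<in> C \<Longrightarrow> b \<in> C \<Longrightarrow> a \<noteq> b \<Longrightarrow> A a b"
  shows "\<exists>X. covers {..<p} {p..<p + q} E X \<and> card X \<le> k * k"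
proof -
  have "finite C" using C(1) finite_subset by blast
  from ex_bij_betw_nat_finite[OF this] C(2) obtain x where x: "bij_betw x {0..<k} C" by auto
  have xn: "x i < n" if "i < k" for i
    using that bij_betwE[OF x] C(1) by auto
  have xA: "A (x i) (x j)" if "i < k" "j < k" "i \<noteq> j" for i j
  proof -
    have "x i \<noteq> x j" using that bij_betw_imp_inj_on[OF x] by (auto simp: inj_on_def)
    then show ?thesis using that bij_betwE[OF x] by (intro C(3)) auto
  qed
  define v where "v \<tau> = x (\<tau> div k) * M + x (\<tau> mod k)" for \<tau>
  have v: "v \<tau> < M * M" if "\<tau> < k * k" for \<tau>
  proof -
    have "\<tau> div k < k" "\<tau> mod k < k"
      using that by (auto simp: less_mult_imp_div_less intro!: mod_less_divisor Nat.gr0I)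
    from this[THEN xn] nM have "x (\<tau> div k) < M" "x (\<tau> mod k) < M" by auto
    then have "v \<tau> < Suc (x (\<tau> div k)) * M" by (simp add: v_def)
    also have "\<dots> \<le> M * M" using \<open>x (\<tau> div k) < M\<close> by (intro mult_right_mono) auto
    finally show ?thesis .
  qed
  define row where "row \<tau> = \<tau> * (M * M) + v \<tau>" for \<tau>
  have row: "row \<tau> div (M * M) = \<tau>" "row \<tau> mod (M * M) = v \<tau>" "row \<tau> < p" if "\<tau> < k * k" for \<tau>
  proof -
    show "row \<tau> div (M * M) = \<tau>" "row \<tau> mod (M * M) = v \<tau>"
      using v[OF that] by (cases "M = 0", simp_all add: row_def)
    have "row \<tau> < Suc \<tau> * (M * M)" using v[OF that] by (simp add: row_def)
    also have "\<dots> \<le> p" unfolding p_def using that by (intro mult_right_mono) auto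
    finally show "row \<tau> < p" .
  qed
  have "\<exists>s\<in>row ` {..<k * k}. (s, p + e) \<in> E" if e: "e < q" for e
  proof -
    define q1 where "q1 = e div W div r"
    define q2 where "q2 = e div W mod r"
    have "q2 < r" using r by (simp add: q2_def)
    \<comment> \<open>Since \<open>q2 < r\<close>, hash values are legitimate digits to base
      \<open>r\<close>.\<close>
    have "v \<tau> mod Suc q1 mod Suc q2 < r" for \<tau>
      by (rule less_le_trans[of _ "Suc q2"]) (use \<open>q2 < r\<close> in auto)
    with digits_exist[of "k * k" "\<lambda>\<tau>. v \<tau> mod Suc q1 mod Suc q2" r]
    obtain \<alpha> where \<alpha>: "\<alpha> < r ^ (k * k)" "\<And>\<tau>. \<tau> < k * k \<Longrightarrow> digit r \<tau> \<alpha> = v \<tau> mod Suc q1 mod Suc q2"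
      by blast
    have "W > 0" using e by (auto simp: q_def intro: Nat.gr0I)
    then have "w > 0" using r by (auto simp: W_def)
    then have "digit w \<alpha> (e mod W) < 2 * (k * k) * Q * Q" unfolding digit_def by (simp flip: w_def)
    from base_cover_complete[where x = x and A = A, OF xn nM xA this] obtain \<tau>
      where \<tau>: "\<tau> < k * k" "base_cover k n A M Q \<tau> (v \<tau>) (digit w \<alpha> (e mod W))"
      unfolding v_def by auto
    then have "cell k n A M Q r (r ^ (k * k)) w W (row \<tau>) e"
      unfolding cell_def using \<alpha> row[OF \<tau>(1)] by (auto simp: q1_def q2_def)
    with \<tau>(1) row[OF \<tau>(1)] e show ?thesis
      unfolding E_def gap_edges_def by (intro bexI[of _ "row \<tau>"]) auto
  qed
  then have "\<exists>s\<in>row ` {..<k * k}. (s, u) \<in> E" if "u \<in> {p..<p + q}" for u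
    using that by (metis add_diff_inverse_nat atLeastLessThan_iff nat_add_left_cancel_less not_less)
  then have "covers {..<p} {p..<p + q} E (row ` {..<k * k})"
    unfolding covers_def using row(3) by auto
  moreover have "card (row ` {..<k * k}) \<le> k * k"
    using card_image_le[of "{..<k * k}" row] by simp
  ultimately show ?thesis by blast
qed

text \<open>A diagonal argument. For each tuple \<open>\<alpha>\<close> the rows consistent with it
  carry at most one pair per slot, so without a clique they miss some base element
  \<open>U \<alpha>\<close>. The column whose function is \<open>U\<close> itself is then missed by
  all rows, whichever \<open>\<alpha>\<close> they are tried with.\<close>

lemma gap_sound:
  assumes M: "M \<ge> 1" and Q: "Q \<ge> 2" "(M * M) ^ (h * h) < Lcm {1..Q}" "M < Lcm {1..Q}" "Q ^ (h * h) < Lcm {1..r}"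
    and irr: "\<And>a. \<not> A a a"
    and no: "\<not> (\<exists>C\<subseteq>{..<n}. card C = k \<and> (\<forall>a\<in>C. \<forall>b\<in>C. a \<noteq> b \<longrightarrow> A a b))"
    and X: "covers {..<p} {p..<p + q} E X"
  shows "h < card X"
proof (rule ccontr)
  assume "\<not> h < card X"
  then have cX: "card X \<le> h" by simp
  have fX: "finite X" using X by (simp add: covers_def)
  define V where "V = (\<lambda>s. s mod (M * M)) ` X"
  have "card V \<le> h" unfolding V_def using card_image_le[OF fX] cX by (rule le_trans)
  moreover have "V \<subseteq> {..<M * M}" using M by (auto simp: V_def)
  ultimately obtain q1 where q1: "q1 < Q" "inj_on (\<lambda>x. x mod Suc q1) V"
    using inj_on_mod_exists[of V "M * M" h Q] Q M by auto
  define V' where "V' = (\<lambda>x. x mod Suc q1) ` V"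
  have "card V' \<le> h"
    unfolding V'_def using card_image_le[of V] fX \<open>card V \<le> h\<close> by (auto simp: V_def intro: le_trans)
  moreover have "V' \<subseteq> {..<Q}"
  proof
    fix y assume "y \<in> V'"
    then obtain x where "y = x mod Suc q1" by (auto simp: V'_def)
    then have "y < Suc q1" by simp
    with q1(1) show "y \<in> {..<Q}" by simp
  qed
  ultimately obtain q2 where q2: "q2 < r" "inj_on (\<lambda>x. x mod Suc q2) V'"
    using inj_on_mod_exists[of V' Q h r] Q by auto
  define hash where "hash x = x mod Suc q1 mod Suc q2" for x
  have inj: "x = y" if "x \<in> V" "y \<in> V" "hash x = hash y" for x y
    using that q1(2) q2(2) unfolding hash_def V'_def inj_on_def by blast
  define Y where "Y \<alpha> = {(s div (M * M), s mod (M * M)) | s. s \<in> X \<and> digit r (s div (M * M)) \<alpha> = hash (s mod (M * M))}" for \<alpha>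
  have "\<exists>u<w. \<forall>(\<tau>, v)\<in>Y \<alpha>. \<not> base_cover k n A M Q \<tau> v u" for \<alpha>
  proof (rule ccontr)
    assume "\<not> ?thesis"
    then have cov: "\<exists>(\<tau>, v)\<in>Y \<alpha>. base_cover k n A M Q \<tau> v u" if "u < 2 * (k * k) * Q * Q" for u
      using that unfolding w_def by blast
    have single: "v = v'" if "(\<tau>, v) \<in> Y \<alpha>" "(\<tau>, v') \<in> Y \<alpha>" for \<tau> v v'
    proof (rule inj)
      from that(1) obtain s where s: "s \<in> X" "v = s mod (M * M)" "digit r \<tau> \<alpha> = hash v" unfolding Y_def by blast
      from that(2) obtain s' where s': "s' \<in> X" "v' = s' mod (M * M)" "digit r \<tau> \<alpha> = hash v'" unfolding Y_def by blast
      show "v \<in> V" "v' \<in> V" using s(1,2) s'(1,2) unfolding V_def by blast+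
      show "hash v = hash v'" using s(3) s'(3) by simp
    qed
    have "\<exists>C\<subseteq>{..<n}. card C = k \<and> (\<forall>a\<in>C. \<forall>b\<in>C. a \<noteq> b \<longrightarrow> A a b)"
    proof (rule base_cover_sound[OF nM Q(3,1), where Y = "Y \<alpha>"])
      show "v = v'" if "(\<tau>, v) \<in> Y \<alpha>" "(\<tau>, v') \<in> Y \<alpha>" for \<tau> v v'
        using that by (rule single)
      show "\<exists>(\<tau>, v)\<in>Y \<alpha>. base_cover k n A M Q \<tau> v u" if "u < 2 * (k * k) * Q * Q" for u
        using that by (rule cov)
    qed (rule irr)
    with no show False by blast
  qed
  then obtain U where U: "\<And>\<alpha>. U \<alpha> < w" "\<And>\<alpha> \<tau> v. (\<tau>, v) \<in> Y \<alpha> \<Longrightarrow> \<not> base_cover k n A M Q \<tau> v (U \<alpha>)"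
    by (metis (no_types, lifting) case_prodD)
  from digits_exist[of "r ^ (k * k)" U w] U(1)
  obtain F where F: "F < W" "\<And>\<alpha>. \<alpha> < r ^ (k * k) \<Longrightarrow> digit w \<alpha> F = U \<alpha>" unfolding W_def by blast
  define e where "e = (q1 * r + q2) * W + F"
  have e: "e div W = q1 * r + q2" "e mod W = F" using F(1) by (simp_all add: e_def)
  then have e': "e div W div r = q1" "e div W mod r = q2" using q2(1) by simp_all
  have "e < q"
  proof -
    have "q1 * r + q2 < Suc q1 * r" using q2(1) by simp
    also have "\<dots> \<le> Q * r" using q1(1) by (intro mult_right_mono) auto
    finally have "Suc (q1 * r + q2) * W \<le> Q * r * W" by (intro mult_right_mono) auto
    moreover have "e < Suc (q1 * r + q2) * W" using F(1) by (simp add: e_def)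
    ultimately show ?thesis by (simp add: q_def)
  qed
  then have "p + e \<in> {p..<p + q}" by simp
  with X obtain s where s: "s \<in> X" "(s, p + e) \<in> E" unfolding covers_def by blast
  then have "cell k n A M Q r (r ^ (k * k)) w W s e" by (auto simp: E_def gap_edges_def)
  then obtain \<alpha> where \<alpha>: "\<alpha> < r ^ (k * k)"
    "digit r (s div (M * M)) \<alpha> = s mod (M * M) mod Suc (e div W div r) mod Suc (e div W mod r)"
    "base_cover k n A M Q (s div (M * M)) (s mod (M * M)) (digit w \<alpha> (e mod W))"
    unfolding cell_def by (elim exE conjE)
  have "digit r (s div (M * M)) \<alpha> = hash (s mod (M * M))"
    unfolding \<alpha>(2) e' hash_def by (rule refl)
  with s(1) have "(s div (M * M), s mod (M * M)) \<in> Y \<alpha>" unfolding Y_def by blast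
  from U(2)[OF this] \<alpha>(3) show False unfolding e(2) F(2)[OF \<alpha>(1)] by (rule notE)
qed

end

section \<open>The parameters\<close>

lemma power_le_two_power: "h ^ i \<le> 2 ^ (h * i)" for h i :: nat
  by (simp add: power_mult less_imp_le power_mono)

text \<open>In logarithms to base 2: \<open>w\<close> contributes at most
  \<open>h * (4 * D + 1) \<le> h ^ 3\<close>, so that \<open>W \<le> M\<close> costs
  \<open>6 * (k * k) + 3 \<le> D\<close>. The first reduction has to beat
  \<open>2 ^ (2 * h ^ (D + 2))\<close>, for which \<open>Q = h ^ (2 * D)\<close> is ample. The
  second has to beat \<open>Q ^ (h * h) \<le> 2 ^ (2 * h ^ 4)\<close>, for which
  \<open>r = h ^ 6\<close> is. The assumption \<open>D \<le> h\<close> absorbs factors of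
  \<open>D\<close> into powers of \<open>h\<close>.\<close>

lemma gap_parameters:
  fixes k D h :: nat
  defines "D \<equiv> 6 * (k * k) + 8"
  assumes h: "h \<ge> D"
  shows "(2 * (k * k) * h ^ (2 * D) * h ^ (2 * D)) ^ ((h ^ 6) ^ (k * k)) \<le> 2 ^ h ^ D"
    and "(2 ^ h ^ D * 2 ^ h ^ D) ^ (h * h) < Lcm {1..h ^ (2 * D)}"
    and "(h ^ (2 * D)) ^ (h * h) < Lcm {1..h ^ 6}"
    and "h ^ (2 * D) * h ^ 6 \<le> 2 ^ h ^ D"
    and "2 ^ h ^ D < Lcm {1..h ^ (2 * D)}"
proof -
  have D: "D \<ge> 8" by (simp add: D_def)
  with h have h8: "h \<ge> 8" by simp
  have mono: "h ^ i \<le> h ^ j" if "i \<le> j" for i j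
    using that h8 by (intro power_increasing) auto
  \<comment> \<open>Using the lower bound at \<open>m + 1\<close> gains a factor 4: half of it pays
    for the 2 in that bound, the other half makes the comparisons strict.\<close>
  have lcm: "2 * 2 ^ (2 * m) \<le> Lcm {1..h ^ j}" if "2 * (m + 1) \<le> h ^ j" for m j
    using Lcm_atLeast1_lower_bound[OF _ that] by (simp add: power_mult)
  have two: "(2 :: nat) ^ i < 2 * 2 ^ j" if "i \<le> j" for i j :: nat
    by (rule le_less_trans[of _ "2 ^ j"]) (use that in auto)
  have bound: "2 * (h ^ i + 1) \<le> h ^ j" if "i < j" for i j
  proof -
    have "2 * (h ^ i + 1) \<le> 4 * h ^ i" using h8 by simp
    also have "\<dots> \<le> h ^ Suc i" using h8 by simp
    also have "\<dots> \<le> h ^ j" using that by (intro mono) simp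
    finally show ?thesis .
  qed
  show "(2 * (k * k) * h ^ (2 * D) * h ^ (2 * D)) ^ ((h ^ 6) ^ (k * k)) \<le> 2 ^ h ^ D"
  proof -
    have "2 * (k * k) * h ^ (2 * D) * h ^ (2 * D) \<le> h * h ^ (2 * D) * h ^ (2 * D)"
      using h by (intro mult_right_mono) (auto simp: D_def)
    also have "\<dots> = h ^ (4 * D + 1)" by (simp flip: power_add)
    also have "\<dots> \<le> 2 ^ (h * (4 * D + 1))" by (rule power_le_two_power)
    finally have "(2 * (k * k) * h ^ (2 * D) * h ^ (2 * D)) ^ ((h ^ 6) ^ (k * k)) \<le>
        (2 ^ (h * (4 * D + 1))) ^ ((h ^ 6) ^ (k * k))" by (rule power_mono) simp
    also have "\<dots> = 2 ^ (h * (4 * D + 1) * h ^ (6 * (k * k)))" by (simp only: power_mult)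
    also have "\<dots> \<le> 2 ^ h ^ D"
    proof (rule power_increasing)
      have "4 * D + 1 \<le> h * h" using h D mult_right_mono[of 5 h h] h8 by linarith
      then have "h * (4 * D + 1) \<le> h * (h * h)" by (rule mult_left_mono) simp
      then have "h * (4 * D + 1) * h ^ (6 * (k * k)) \<le> h ^ 3 * h ^ (6 * (k * k))"
        by (intro mult_right_mono) (simp_all add: power3_eq_cube mult.assoc)
      also have "\<dots> = h ^ (6 * (k * k) + 3)" by (simp flip: power_add add: add.commute)
      also have "\<dots> \<le> h ^ D" by (rule mono) (simp add: D_def)
      finally show "h * (4 * D + 1) * h ^ (6 * (k * k)) \<le> h ^ D" .
    qed simp
    finally show ?thesis .
  qed
  have 2: "(2 ^ h ^ D * 2 ^ h ^ D) ^ (h * h) = (2 :: nat) ^ (2 * h ^ (D + 2))"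
    by (simp flip: power_mult power_add mult_2 add: mult.assoc power2_eq_square[symmetric])
  show 3: "(2 ^ h ^ D * 2 ^ h ^ D) ^ (h * h) < Lcm {1..h ^ (2 * D)}"
    unfolding 2 by (rule less_le_trans[OF two lcm[OF bound[of "D + 2" "2 * D"]]]) (use D in simp_all)
  show "(h ^ (2 * D)) ^ (h * h) < Lcm {1..h ^ 6}"
  proof -
    have "(h ^ (2 * D)) ^ (h * h) \<le> (2 ^ (h * (2 * D))) ^ (h * h)"
      by (rule power_mono[OF power_le_two_power]) simp
    also have "\<dots> = 2 ^ (h * (2 * D) * (h * h))" by (simp only: power_mult)
    also have "\<dots> < 2 * 2 ^ (2 * h ^ 4)"
    proof (rule two)
      have "h * (2 * D) * (h * h) \<le> h * (2 * h) * (h * h)" using h by (intro mult_right_mono mult_left_mono) auto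
      also have "\<dots> = 2 * h ^ 4" by (simp add: eval_nat_numeral algebra_simps)
      finally show "h * (2 * D) * (h * h) \<le> 2 * h ^ 4" .
    qed
    also have "\<dots> \<le> Lcm {1..h ^ 6}" by (rule lcm[OF bound]) simp
    finally show ?thesis .
  qed
  show "h ^ (2 * D) * h ^ 6 \<le> 2 ^ h ^ D"
  proof -
    have "h ^ (2 * D) * h ^ 6 = h ^ (2 * D + 6)" by (simp add: power_add)
    also have "\<dots> \<le> 2 ^ (h * (2 * D + 6))" by (rule power_le_two_power)
    also have "\<dots> \<le> 2 ^ h ^ D"
    proof (rule power_increasing)
      have "2 * D + 6 \<le> h * h" using h D mult_right_mono[of 3 h h] h8 by linarith
      then have "h * (2 * D + 6) \<le> h * (h * h)" by (rule mult_left_mono) simp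
      also have "\<dots> = h ^ 3" by (simp add: power3_eq_cube)
      also have "\<dots> \<le> h ^ D" using D by (intro mono) simp
      finally show "h * (2 * D + 6) \<le> h ^ D" .
    qed simp
    finally show ?thesis .
  qed
  have "(2 :: nat) ^ h ^ D \<le> (2 ^ h ^ D * 2 ^ h ^ D) ^ (h * h)"
    unfolding 2 using mono[of D "D + 2"] by (intro power_increasing) linarith+
  from this 3 show "2 ^ h ^ D < Lcm {1..h ^ (2 * D)}" by (rule le_less_trans)
qed

section \<open>The optimum with and without a clique\<close>

lemma opt_le_card: "covers S U E X \<Longrightarrow> opt S U E \<le> enat (card X)"
  unfolding opt_def by (rule INF_lower) simp

lemma opt_greater: "(\<And>X. covers S U E X \<Longrightarrow> h < card X) \<Longrightarrow> opt S U E > enat h"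
proof -
  assume "\<And>X. covers S U E X \<Longrightarrow> h < card X"
  then have "enat (Suc h) \<le> opt S U E"
    unfolding opt_def by (intro INF_greatest) (auto simp: Suc_le_eq)
  then show ?thesis by (rule less_le_trans[rotated]) simp
qed

text \<open>Since \<open>N \<le> M ^ 3\<close>, its logarithm is at most
  \<open>3 * h ^ D \<le> h ^ \<epsilon> kk\<close>, so the threshold is at most \<open>h\<close>,
  which every cover exceeds if there is no clique. With a clique, the optimum is at most
  \<open>k * k\<close>, and the threshold is at least that. In each situation exactly one of the two
  cases holds, so a correct algorithm has no choice.\<close>

lemma gap_reduction:
  fixes k n h kk D M Q r l w W p q :: nat and A :: "nat \<Rightarrow> nat \<Rightarrow> bool" and \<epsilon> :: "nat \<Rightarrow> nat"
  assumes D_def: "D = 6 * (k * k) + 8" and M_def: "M = 2 ^ h ^ D" and Q_def: "Q = h ^ (2 * D)" and r_def: "r = h ^ 6"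
    and l_def: "l = r ^ (k * k)" and w_def: "w = 2 * (k * k) * Q * Q" and W_def: "W = w ^ l"
    and p_def: "p = k * k * (M * M)" and q_def: "q = Q * r * W"
  defines "E \<equiv> gap_edges p q (cell k n A M Q r l w W)"
  assumes h: "h \<ge> D" "h > kk" "h \<ge> (k * k) ^ \<epsilon> kk" and kk: "kk \<ge> k * k" and \<epsilon>: "\<epsilon> kk > D" and nM: "n \<le> M"
    and irr: "\<And>a. \<not> A a a"
  shows "\<exists>C\<subseteq>{..<n}. card C = k \<and> (\<forall>a\<in>C. \<forall>b\<in>C. a \<noteq> b \<longrightarrow> A a b) \<Longrightarrow>
      small_opt kk p q E \<and> \<not> large_opt \<epsilon> kk p q E"
    and "\<not> (\<exists>C\<subseteq>{..<n}. card C = k \<and> (\<forall>a\<in>C. \<forall>b\<in>C. a \<noteq> b \<longrightarrow> A a b)) \<Longrightarrow>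
      \<not> small_opt kk p q E \<and> large_opt \<epsilon> kk p q E"
proof -
  note par = gap_parameters[OF h(1)[unfolded D_def], folded D_def]
  have D8: "D \<ge> 8" by (simp add: D_def)
  then have h8: "h \<ge> 8" using h by simp
  have r0: "r > 0" using h8 by (simp add: r_def)
  have M1: "M \<ge> 1" by (simp add: M_def)
  have e0: "\<epsilon> kk > 0" using \<epsilon> by simp
  have WM: "W \<le> M" using par(1) by (simp add: W_def w_def l_def M_def Q_def r_def)
  have "h * 2 ^ 0 \<le> M"
  proof -
    have "h < 2 ^ h" by simp
    also have "(2 :: nat) ^ h \<le> M" unfolding M_def
      using self_le_power[of h D] h8 D8 by (intro power_increasing) auto
    finally show ?thesis by simp
  qed
  then have hM: "h \<le> M" by simp
  have N: "p + q \<le> M ^ 3"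
  proof -
    have "q \<le> M * M" unfolding q_def using par(4) WM by (intro mult_mono) (auto simp: Q_def r_def M_def)
    then have "p + q \<le> (k * k + 1) * (M * M)" by (simp add: p_def)
    also have "\<dots> \<le> M * (M * M)"
      using h(1) hM by (intro mult_right_mono) (auto simp: D_def)
    finally show ?thesis by (simp add: power3_eq_cube)
  qed
  \<comment> \<open>The empty instance does occur: for \<open>k = 0\<close>, \<open>w = 0\<close>
    and \<open>l = 1\<close>, so \<open>W\<close>, \<open>p\<close> and \<open>q\<close> vanish. The
    logarithm of 0 is then 0.\<close>
  have logN: "log 2 (real (p + q)) \<le> real (h ^ \<epsilon> kk)"
  proof (cases "p + q = 0")
    case False
    have "real (p + q) \<le> real (M ^ 3)" using N by (simp only: of_nat_le_iff)
    also have "\<dots> = 2 ^ (3 * h ^ D)" by (simp add: M_def power_mult[symmetric] mult.commute)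
    finally have "log 2 (real (p + q)) \<le> log 2 (2 ^ (3 * h ^ D))"
      using False by (subst log_le_cancel_iff) auto
    also have "\<dots> = real (3 * h ^ D)" by (simp only: log_pow_cancel)
    also have "3 * h ^ D \<le> h * h ^ D" using h8 by (intro mult_right_mono) auto
    also have "h * h ^ D = h ^ Suc D" by simp
    also have "\<dots> \<le> h ^ \<epsilon> kk" using \<epsilon> h8 by (intro power_increasing) auto
    finally show ?thesis by simp
  qed (simp add: log_def)
  have logN0: "log 2 (real (p + q)) \<ge> 0"
  proof (cases "p + q = 0")
    case False
    then have "real (p + q) \<ge> 1" by linarith
    then show ?thesis by (simp add: zero_le_log_cancel_iff)
  qed (simp add: log_def)
  have root: "real (b ^ \<epsilon> kk) powr (1 / real (\<epsilon> kk)) = real b" for b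
  proof (cases "b = 0")
    case False
    then show ?thesis using e0 by (simp add: powr_realpow[symmetric] powr_powr)
  qed (use e0 in simp)
  {
    assume "\<exists>C\<subseteq>{..<n}. card C = k \<and> (\<forall>a\<in>C. \<forall>b\<in>C. a \<noteq> b \<longrightarrow> A a b)"
    then obtain C where C: "C \<subseteq> {..<n}" "card C = k" "\<And>a b. a \<in> C \<Longrightarrow> b \<in> C \<Longrightarrow> a \<noteq> b \<Longrightarrow> A a b"
      by blast
    from gap_complete[where A = A, OF nM r0 C(1,2), where Q = Q, OF C(3), folded l_def w_def, folded W_def p_def, folded q_def, folded E_def]
    obtain X where X: "covers {..<p} {p..<p + q} E X" "card X \<le> k * k" by blast
    then have le: "opt_instance p q E \<le> enat (k * k)"
      unfolding opt_instance_def by (meson enat_ord_simps(1) opt_le_card order_trans)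
    have "opt_instance p q E \<le> enat kk" using kk by (intro order_trans[OF le]) simp
    moreover have "ereal_of_enat (opt_instance p q E) \<le> ereal (log 2 (real (p + q)) powr (1 / real (\<epsilon> kk)))"
    proof -
      have "ereal_of_enat (opt_instance p q E) \<le> ereal_of_enat (enat (k * k))"
        using le by (simp only: ereal_of_enat_le_iff)
      also have "\<dots> = ereal (real (k * k))" by simp
      also have "real (k * k) \<le> log 2 (real (p + q)) powr (1 / real (\<epsilon> kk))"
      proof (cases "k = 0")
        case False
        \<comment> \<open>Here \<open>N\<close> is bounded from below: its logarithm is at least
          \<open>h ^ D \<ge> h \<ge> (k * k) ^ \<epsilon> kk\<close>, which lifts the threshold to
          \<open>k * k\<close>.\<close>
        have "M \<le> p" unfolding p_def using False M1 by (cases "k * k"; cases M) auto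
        have "real ((k * k) ^ \<epsilon> kk) \<le> real (h ^ 1)" using h(3) by (simp only: of_nat_le_iff power_one_right)
        also have "h ^ 1 \<le> h ^ D" using h8 D8 by (intro power_increasing) auto
        also have "\<dots> = log 2 (2 ^ h ^ D)" by (simp only: log_pow_cancel)
        also have "\<dots> \<le> log 2 (real (p + q))"
        proof (subst log_le_cancel_iff)
          have "real M \<le> real (p + q)" using \<open>M \<le> p\<close> by simp
          then show "2 ^ h ^ D \<le> real (p + q)" by (simp add: M_def)
          then show "0 < real (p + q)" by (rule less_le_trans[rotated]) simp
        qed simp_all
        finally have "real ((k * k) ^ \<epsilon> kk) powr (1 / real (\<epsilon> kk)) \<le> log 2 (real (p + q)) powr (1 / real (\<epsilon> kk))"
          by (intro powr_mono2) auto
        then show ?thesis unfolding root .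
      qed simp
      finally show ?thesis by simp
    qed
    ultimately show "small_opt kk p q E \<and> \<not> large_opt \<epsilon> kk p q E"
      unfolding small_opt_def large_opt_def by (simp add: not_less)
  next
    assume no: "\<not> (\<exists>C\<subseteq>{..<n}. card C = k \<and> (\<forall>a\<in>C. \<forall>b\<in>C. a \<noteq> b \<longrightarrow> A a b))"
    have Q2: "Q \<ge> 2"
      unfolding Q_def using self_le_power[of h "2 * D"] h8 D8 by simp
    have "h < card X" if "covers {..<p} {p..<p + q} E X" for X
      by (rule gap_sound[OF nM r0 M1 Q2 _ _ _ irr no that[unfolded E_def q_def W_def p_def w_def l_def]])
         (use par in \<open>simp_all add: M_def Q_def r_def\<close>)
    then have gt: "opt_instance p q E > enat h"
      unfolding opt_instance_def by (rule opt_greater)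
    then have "enat kk < opt_instance p q E" using h(2) by (meson enat_ord_simps(2) less_trans)
    moreover have "ereal (log 2 (real (p + q)) powr (1 / real (\<epsilon> kk))) < ereal_of_enat (opt_instance p q E)"
    proof -
      have "log 2 (real (p + q)) powr (1 / real (\<epsilon> kk)) \<le> real (h ^ \<epsilon> kk) powr (1 / real (\<epsilon> kk))"
        using logN logN0 by (intro powr_mono2) auto
      also have "\<dots> = real h" by (rule root)
      finally have "ereal (log 2 (real (p + q)) powr (1 / real (\<epsilon> kk))) \<le> ereal_of_enat (enat h)" by simp
      also have "\<dots> < ereal_of_enat (opt_instance p q E)"
        using gt by (simp only: ereal_of_enat_less_iff)
      finally show ?thesis .
    qed
    ultimately show "\<not> small_opt kk p q E \<and> large_opt \<epsilon> kk p q E"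
      unfolding small_opt_def large_opt_def using e0 by (simp add: not_le)
  }
qed

section \<open>Running programs on a list of registers\<close>

type_synonym mem = "nat \<Rightarrow> nat"

definition holds :: "nat list \<Rightarrow> (nat \<Rightarrow> nat) \<Rightarrow> bool" where
  "holds xs r \<longleftrightarrow> (\<forall>i<length xs. r i = xs ! i)"

text \<open>Registers beyond the end of the lists are arbitrary.\<close>

definition run :: "prog \<Rightarrow> nat list \<times> mem \<Rightarrow> nat \<Rightarrow> nat list \<times> mem \<Rightarrow> bool" where
  "run P s T s' \<longleftrightarrow> (\<forall>r. holds (fst s) r \<longrightarrow>
     (\<exists>t r'. exec P (r, snd s) t (r', snd s') \<and> t \<le> T \<and> holds (fst s') r'))"

lemma holds_append: "holds (xs @ ys) r \<Longrightarrow> holds xs r"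
  unfolding holds_def by (auto simp: nth_append)

lemma holds_snoc: "holds xs r \<Longrightarrow> holds (xs @ [v]) (r(length xs := v))"
  unfolding holds_def by (auto simp: nth_append)

lemma holds_update: "holds xs r \<Longrightarrow> holds (xs[x := v]) (r(x := v))"
  unfolding holds_def by (auto simp: nth_list_update)

lemma run_Seq: "run P s T s' \<Longrightarrow> run Q s' T' s'' \<Longrightarrow> run (Seq P Q) s (T + T') s''"
  unfolding run_def by (meson add_mono exec.Seq)

lemma run_mono: "run P s T s' \<Longrightarrow> T \<le> T' \<Longrightarrow> run P s T' s'"
  unfolding run_def by (meson le_trans)

text \<open>Registers are freed by forgetting them, at no cost: their contents may stay as they
  are.\<close>

lemma run_drop: "run P s T (ys @ zs, m) \<Longrightarrow> run P s T (ys, m)"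
  unfolding run_def by (fastforce dest: holds_append)

lemma run_extra: "run P (xs, m) T s' \<Longrightarrow> run P (xs @ ys, m) T s'"
  unfolding run_def by (auto dest: holds_append)

lemma run_assign:
  assumes "\<And>r. exec P (r, m) 1 (r(x := v r), m)" "\<And>r. holds xs r \<Longrightarrow> v r = u"
  shows "run P (xs, m) 1 (xs[x := u], m)" and "x = length xs \<Longrightarrow> run P (xs, m) 1 (xs @ [u], m)"
  unfolding run_def fst_conv snd_conv by (metis assms holds_update le_refl, metis assms holds_snoc le_refl)

lemma run_Const: "x = length xs \<Longrightarrow> run (Const x c) (xs, m) 1 (xs @ [c], m)"
  by (rule run_assign(2)[OF exec.Const refl])

lemma run_Const_update: "run (Const x c) (xs, m) 1 (xs[x := c], m)"
  by (rule run_assign(1)[OF exec.Const refl])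

lemma run_Add:
  "x = length xs \<Longrightarrow> i < length xs \<Longrightarrow> j < length xs \<Longrightarrow>
     run (Add x i j) (xs, m) 1 (xs @ [xs ! i + xs ! j], m)"
  by (rule run_assign(2)[OF exec.Add]) (simp_all add: holds_def)

lemma run_Add_update:
  "i < length xs \<Longrightarrow> j < length xs \<Longrightarrow> run (Add x i j) (xs, m) 1 (xs[x := xs ! i + xs ! j], m)"
  by (rule run_assign(1)[OF exec.Add]) (simp add: holds_def)

lemma run_Sub:
  "x = length xs \<Longrightarrow> i < length xs \<Longrightarrow> j < length xs \<Longrightarrow>
     run (Sub x i j) (xs, m) 1 (xs @ [xs ! i - xs ! j], m)"
  by (rule run_assign(2)[OF exec.Sub]) (simp_all add: holds_def)

lemma run_Sub_update:
  "i < length xs \<Longrightarrow> j < length xs \<Longrightarrow> run (Sub x i j) (xs, m) 1 (xs[x := xs ! i - xs ! j], m)"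
  by (rule run_assign(1)[OF exec.Sub]) (simp add: holds_def)

lemma run_Load_update:
  "i < length xs \<Longrightarrow> run (Load x i) (xs, m) 1 (xs[x := m (xs ! i)], m)"
  by (rule run_assign(1)[OF exec.Load]) (simp add: holds_def)

lemma run_Store:
  "i < length xs \<Longrightarrow> j < length xs \<Longrightarrow> run (Store i j) (xs, m) 1 (xs, m(xs ! i := xs ! j))"
  unfolding run_def fst_conv snd_conv by (metis exec.Store holds_def le_refl)

lemma run_IfNZ:
  assumes "x < length xs"
    and "xs ! x \<noteq> 0 \<Longrightarrow> run P (xs, m) T s'"
    and "xs ! x = 0 \<Longrightarrow> run Q (xs, m) T s'"
  shows "run (IfNZ x P Q) (xs, m) (1 + T) s'"
  unfolding run_def
proof (intro allI impI)
  fix r assume r: "holds (fst (xs, m)) r"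
  with assms(1) have rx: "r x = xs ! x" by (simp add: holds_def)
  show "\<exists>t r'. exec (IfNZ x P Q) (r, snd (xs, m)) t (r', snd s') \<and> t \<le> 1 + T \<and> holds (fst s') r'"
  proof (cases "xs ! x = 0")
    case True
    with assms(3) r obtain t r' where "exec Q (r, m) t (r', snd s')" "t \<le> T" "holds (fst s') r'"
      unfolding run_def by auto
    with True rx show ?thesis by (intro exI[of _ "1 + t"] exI[of _ r']) (auto intro: exec.If_zero simp del: One_nat_def plus_1_eq_Suc)
  next
    case False
    with assms(2) r obtain t r' where "exec P (r, m) t (r', snd s')" "t \<le> T" "holds (fst s') r'"
      unfolding run_def by auto
    with False rx show ?thesis by (intro exI[of _ "1 + t"] exI[of _ r']) (auto intro: exec.If_nonzero simp del: One_nat_def plus_1_eq_Suc)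
  qed
qed

lemma run_WhileNZ_stop:
  assumes "x < length xs" "xs ! x = 0"
  shows "run (WhileNZ x P) (xs, m) 1 (xs, m)"
  using assms unfolding run_def holds_def
  by (auto intro!: exI exec.While_stop)

lemma run_WhileNZ_step:
  assumes "x < length xs" "xs ! x \<noteq> 0" "run P (xs, m) T s'" "run (WhileNZ x P) s' T' s''"
  shows "run (WhileNZ x P) (xs, m) (1 + T + T') s''"
  unfolding run_def
proof (intro allI impI)
  fix r assume r: "holds (fst (xs, m)) r"
  with assms(1) have rx: "r x = xs ! x" by (simp add: holds_def)
  from r assms(3) obtain t r' where 1: "exec P (r, m) t (r', snd s')" "t \<le> T" "holds (fst s') r'"
    unfolding run_def by auto
  from 1 assms(4) obtain t' r'' where 2: "exec (WhileNZ x P) (r', snd s') t' (r'', snd s'')"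
    "t' \<le> T'" "holds (fst s'') r''"
    unfolding run_def by blast
  from exec.While_step[OF _ 1(1) 2(1)] rx assms(2) 
  have "exec (WhileNZ x P) (r, m) (1 + t + t') (r'', snd s'')" by simp
  then show "\<exists>t r'. exec (WhileNZ x P) (r, snd (xs, m)) t (r', snd s'') \<and> t \<le> 1 + T + T' \<and> holds (fst s'') r'"
    using 1(2) 2(2,3) by (intro exI[of _ "1 + t + t'"] exI[of _ r'']) auto
qed

lemma run_WhileNZ:
  assumes len: "\<And>i. i \<le> N \<Longrightarrow> x < length (xs i)"
    and nz: "\<And>i. i < N \<Longrightarrow> xs i ! x \<noteq> 0"
    and z: "xs N ! x = 0"
    and body: "\<And>i. i < N \<Longrightarrow> run P (xs i, m i) (T i) (xs (Suc i), m (Suc i))"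
  shows "run (WhileNZ x P) (xs 0, m 0) ((\<Sum>i<N. 1 + T i) + 1) (xs N, m N)"
  using assms
proof (induction N arbitrary: xs m T)
  case 0
  then show ?case using run_WhileNZ_stop[of x "xs 0" P "m 0"] by simp
next
  case (Suc N)
  have "run (WhileNZ x P) (xs (Suc 0), m (Suc 0)) ((\<Sum>i<N. 1 + T (Suc i)) + 1) (xs (Suc N), m (Suc N))"
    by (rule Suc.IH[where xs = "\<lambda>i. xs (Suc i)" and T = "\<lambda>i. T (Suc i)" and m = "\<lambda>i. m (Suc i)"]) (use Suc.prems in auto)
  then have "run (WhileNZ x P) (xs 0, m 0) (1 + T 0 + ((\<Sum>i<N. 1 + T (Suc i)) + 1)) (xs (Suc N), m (Suc N))"
    using Suc.prems by (intro run_WhileNZ_step[of _ _ _ _ "T 0"]) auto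
  moreover have "1 + T 0 + ((\<Sum>i<N. 1 + T (Suc i)) + 1) = (\<Sum>i<Suc N. 1 + T i) + 1"
    by (subst sum.lessThan_Suc_shift) simp
  ultimately show ?case by simp
qed

text \<open>The machine has no move instruction, so a fresh register is set to 0 and the source
  added to it. For the empty list, a \<open>Const\<close> to a free register stands in for a no-op;
  this is the \<open>+ 1\<close>.\<close>

lemma run_copy:
  assumes "\<forall>i\<in>set is. i < l"
  shows "\<exists>P. \<forall>ws m. length ws = l \<longrightarrow> run P (ws, m) (2 * length is + 1) (ws @ map (\<lambda>i. ws ! i) is, m)"
  using assms
proof (induction "is" rule: rev_induct)
  case Nil
  show ?case
    by (intro exI[of _ "Const l 0"] allI impI) (auto intro: run_drop[OF run_Const, simplified])
next
  case (snoc i "is")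
  then obtain P where P [rule_format]: "\<forall>ws m. length ws = l \<longrightarrow>
      run P (ws, m) (2 * length is + 1) (ws @ map (\<lambda>i. ws ! i) is, m)"
    by auto
  let ?t = "l + length is"
  show ?case
  proof (intro exI[of _ "Seq P (Seq (Const ?t 0) (Add ?t i ?t))"] allI impI)
    fix ws :: "nat list" and m :: mem assume l: "length ws = l"
    let ?us = "ws @ map (\<lambda>i. ws ! i) is"
    have "run (Add ?t i ?t) (?us @ [0], m) 1 ((?us @ [0])[?t := (?us @ [0]) ! i + (?us @ [0]) ! ?t], m)"
      using snoc.prems l by (intro run_Add_update) auto
    also have "(?us @ [0])[?t := (?us @ [0]) ! i + (?us @ [0]) ! ?t] = ws @ map (\<lambda>i. ws ! i) (is @ [i])"
      using snoc.prems l by (auto simp: nth_append list_update_append)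
    finally have 1: "run (Add ?t i ?t) (?us @ [0], m) 1 (ws @ map (\<lambda>i. ws ! i) (is @ [i]), m)" .
    have 2: "run (Const ?t 0) (?us, m) 1 (?us @ [0], m)"
      using l by (intro run_Const) simp
    show "run (Seq P (Seq (Const ?t 0) (Add ?t i ?t))) (ws, m) (2 * length (is @ [i]) + 1)
            (ws @ map (\<lambda>i. ws ! i) (is @ [i]), m)"
      using run_Seq[OF P[OF l] run_Seq[OF 2 1]] by simp
  qed
qed

text \<open>The return from a computation: the local registers \<open>us\<close> disappear from
  beneath the result.\<close>

lemma run_move:
  "\<exists>P. \<forall>ws us v m. length ws = t \<longrightarrow> length us = d \<longrightarrow>
     run P (ws @ us @ [v], m) 2 (ws @ [v], m)"
proof (intro exI[of _ "Seq (Const (t + d + 1) 0) (Add t (t + d) (t + d + 1))"] allI impI)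
  fix ws us :: "nat list" and v :: nat and m :: mem
  assume l: "length ws = t" "length us = d"
  let ?us = "ws @ us @ [v]"
  have 2: "run (Const (t + d + 1) 0) (?us, m) 1 (?us @ [0], m)"
    using l by (intro run_Const) simp
  have "run (Add t (t + d) (t + d + 1)) (?us @ [0], m) 1
      ((?us @ [0])[t := (?us @ [0]) ! (t + d) + (?us @ [0]) ! (t + d + 1)], m)"
    using l by (intro run_Add_update) auto
  also have "(?us @ [0])[t := (?us @ [0]) ! (t + d) + (?us @ [0]) ! (t + d + 1)] =
      (ws @ [v]) @ tl (us @ [v]) @ [0]"
    using l by (cases us) (auto simp: nth_append list_update_append)
  finally have "run (Add t (t + d) (t + d + 1)) (?us @ [0], m) 1 (ws @ [v], m)"
    by (rule run_drop)
  from run_Seq[OF 2 this]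
  show "run (Seq (Const (t + d + 1) 0) (Add t (t + d) (t + d + 1))) (ws @ us @ [v], m) 2 (ws @ [v], m)"
    by (simp add: numeral_2_eq_2)
qed

section \<open>Functions computed on the register stack\<close>

text \<open>The arguments are the topmost \<open>a\<close> registers of a stack, onto which the value is pushed.\<close>

definition pushes :: "nat \<Rightarrow> nat \<Rightarrow> prog \<Rightarrow> (mem \<Rightarrow> nat list \<Rightarrow> nat) \<Rightarrow> (mem \<Rightarrow> nat list \<Rightarrow> nat) \<Rightarrow> bool" where
  "pushes b a P F C \<longleftrightarrow> (\<forall>zs xs m. length zs = b \<longrightarrow> length xs = a \<longrightarrow>
     run P (zs @ xs, m) (C m xs) (zs @ xs @ [F m xs], m))"

lemma pushesI:
  "(\<And>zs xs m. length zs = b \<Longrightarrow> length xs = a \<Longrightarrow> run P (zs @ xs, m) (C m xs) (zs @ xs @ [F m xs], m)) \<Longrightarrow>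
     pushes b a P F C"
  unfolding pushes_def by blast

text \<open>Register names are static, so each stack depth \<open>b\<close> requires its own
  program; the cost does not depend on \<open>b\<close>.\<close>

definition computes :: "nat \<Rightarrow> (mem \<Rightarrow> nat list \<Rightarrow> nat) \<Rightarrow> (mem \<Rightarrow> nat list \<Rightarrow> nat) \<Rightarrow> bool" where
  "computes a F C \<longleftrightarrow> (\<forall>b. \<exists>P. pushes b a P F C)"

lemma computesD: "computes a F C \<Longrightarrow> \<exists>P. pushes b a P F C"
  unfolding computes_def by blast

lemma computes_cong:
  assumes "computes a F C"
    and "\<And>m xs. length xs = a \<Longrightarrow> F m xs = F' m xs" "\<And>m xs. length xs = a \<Longrightarrow> C m xs \<le> C' m xs"
  shows "computes a F' C'"
  unfolding computes_def
proof
  fix b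
  from assms(1) obtain P where P [unfolded pushes_def, rule_format]: "pushes b a P F C"
    by (rule computesD[where b = b, THEN exE])
  show "\<exists>P. pushes b a P (\<lambda>m xs. F' m xs) (\<lambda>m xs. C' m xs)"
  proof (intro exI[of _ P] pushesI)
    fix zs xs :: "nat list" and m assume "length zs = b" "length xs = a"
    with P[of zs xs m] assms(2,3)[of xs m]
    show "run P (zs @ xs, m) (C' m xs) (zs @ xs @ [F' m xs], m)"
      by (auto intro: run_mono)
  qed
qed

lemma computes_const: "computes a (\<lambda>m xs. c) (\<lambda>m xs. 1)"
  unfolding computes_def
  by (intro allI exI[of _ "Const (_ + a) c"] pushesI) (auto intro!: run_Const[where xs = "_ @ _", simplified])

lemma computes_nth:
  assumes "i < a"
  shows "computes a (\<lambda>m xs. xs ! i) (\<lambda>m xs. 3)"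
  unfolding computes_def
proof
  fix b
  from run_copy[of "[b + i]" "b + a"] assms obtain P where P [rule_format]: "\<forall>ws m. length ws = b + a \<longrightarrow> run P (ws, m) 3 (ws @ [ws ! (b + i)], m)" by auto
  show "\<exists>P. pushes b a P (\<lambda>m xs. xs ! i) (\<lambda>m xs. 3)"
  proof (intro exI[of _ P] pushesI)
    fix zs xs :: "nat list" and m assume "length zs = b" "length xs = a"
    then show "run P (zs @ xs, m) 3 (zs @ xs @ [xs ! i], m)"
      using P[of "zs @ xs" m] by (simp add: nth_append)
  qed
qed

text \<open>For arguments buried under \<open>g\<close> other registers: they are copied to the top,
  and the copies are removed from beneath the result.\<close>

lemma run_gap:
  assumes "computes a F C"
  shows "\<exists>P. \<forall>zs xs ys m. length zs = b \<longrightarrow> length xs = a \<longrightarrow> length ys = g \<longrightarrow>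
     run P (zs @ xs @ ys, m) (C m xs + 2 * a + 3) (zs @ xs @ ys @ [F m xs], m)"
proof -
  from run_copy[of "[b..<b + a]" "b + a + g"] obtain P1 where P1 [rule_format]: "\<forall>ws m. length ws = b + a + g \<longrightarrow> run P1 (ws, m) (2 * a + 1) (ws @ map (\<lambda>i. ws ! i) [b..<b + a], m)" by auto
  from assms obtain P2 where P2 [unfolded pushes_def, rule_format]: "pushes (b + a + g) a P2 F C"
    by (rule computesD[where b = "b + a + g", THEN exE])
  from run_move[of "b + a + g" a] obtain P3 where P3 [rule_format]: "\<forall>ws us v m. length ws = b + a + g \<longrightarrow> length us = a \<longrightarrow> run P3 (ws @ us @ [v], m) 2 (ws @ [v], m)"
    by auto
  show ?thesis
  proof (intro exI[of _ "Seq P1 (Seq P2 P3)"] allI impI)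
    fix zs xs ys :: "nat list" and m assume l: "length zs = b" "length xs = a" "length ys = g"
    let ?w = "zs @ xs @ ys"
    have "map (\<lambda>i. ?w ! i) [b..<b + a] = xs"
      using l by (intro nth_equalityI) (auto simp: nth_append)
    with P1[of ?w m] l have 1: "run P1 (?w, m) (2 * a + 1) (?w @ xs, m)" by simp
    have 2: "run P2 (?w @ xs, m) (C m xs) (?w @ xs @ [F m xs], m)"
      using l by (intro P2) auto
    have 3: "run P3 (?w @ xs @ [F m xs], m) 2 (?w @ [F m xs], m)"
      using l by (intro P3) auto
    show "run (Seq P1 (Seq P2 P3)) (zs @ xs @ ys, m) (C m xs + 2 * a + 3) (zs @ xs @ ys @ [F m xs], m)"
      using run_mono[OF run_Seq[OF 1 run_Seq[OF 2 3]]] by simp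
  qed
qed

lemma computes_take:
  assumes "computes a F C"
  shows "computes (a + g) (\<lambda>m ys. F m (take a ys)) (\<lambda>m ys. C m (take a ys) + 2 * a + 3)"
  unfolding computes_def
proof
  fix b
  from run_gap[OF assms, of b g] obtain P where P [rule_format]: "\<forall>zs xs ys m. length zs = b \<longrightarrow> length xs = a \<longrightarrow> length ys = g \<longrightarrow>
     run P (zs @ xs @ ys, m) (C m xs + 2 * a + 3) (zs @ xs @ ys @ [F m xs], m)" by auto
  show "\<exists>P. pushes b (a + g) P (\<lambda>m xs. F m (take a xs)) (\<lambda>m xs. C m (take a xs) + 2 * a + 3)"
  proof (intro exI[of _ P] pushesI)
    fix zs xs :: "nat list" and m assume "length zs = b" "length xs = a + g"
    then show "run P (zs @ xs, m) (C m (take a xs) + 2 * a + 3) (zs @ xs @ [F m (take a xs)], m)"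
      using P[of zs "take a xs" "drop a xs" m] by (simp flip: append_assoc)
  qed
qed

lemma computes_drop:
  assumes "computes g F C"
  shows "computes (a + g) (\<lambda>m ys. F m (drop a ys)) (\<lambda>m ys. C m (drop a ys))"
  unfolding computes_def
proof
  fix b
  from assms obtain P where P [unfolded pushes_def, rule_format]: "pushes (b + a) g P F C"
    by (rule computesD[where b = "b + a", THEN exE])
  show "\<exists>P. pushes b (a + g) P (\<lambda>m xs. F m (drop a xs)) (\<lambda>m xs. C m (drop a xs))"
  proof (intro exI[of _ P] pushesI)
    fix zs xs :: "nat list" and m assume "length zs = b" "length xs = a + g"
    then show "run P (zs @ xs, m) (C m (drop a xs)) (zs @ xs @ [F m (drop a xs)], m)"
      using P[of "zs @ take a xs" "drop a xs" m] by (simp flip: append_assoc) (simp)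
  qed
qed

lemma computes_let:
  assumes "computes a G CG" "computes (Suc a) F CF"
  shows "computes a (\<lambda>m xs. F m (xs @ [G m xs])) (\<lambda>m xs. CG m xs + CF m (xs @ [G m xs]) + 2)"
  unfolding computes_def
proof
  fix b
  from assms(1) obtain P where P [unfolded pushes_def, rule_format]: "pushes b a P G CG"
    by (rule computesD[where b = "b", THEN exE])
  from assms(2) obtain P2 where P2 [unfolded pushes_def, rule_format]: "pushes b (Suc a) P2 F CF"
    by (rule computesD[where b = "b", THEN exE])
  from run_move[of "b + a" 1] obtain P3 where P3 [rule_format]: "\<forall>ws us v m. length ws = b + a \<longrightarrow> length us = 1 \<longrightarrow> run P3 (ws @ us @ [v], m) 2 (ws @ [v], m)"
    by auto
  show "\<exists>P. pushes b a P (\<lambda>m xs. F m (xs @ [G m xs])) (\<lambda>m xs. CG m xs + CF m (xs @ [G m xs]) + 2)"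
  proof (intro exI[of _ "Seq P (Seq P2 P3)"] pushesI)
    fix zs xs :: "nat list" and m assume l: "length zs = b" "length xs = a"
    have "run P3 ((zs @ xs) @ [G m xs] @ [F m (xs @ [G m xs])], m) 2 ((zs @ xs) @ [F m (xs @ [G m xs])], m)"
      using l by (intro P3) auto
    then have 3: "run P3 (zs @ (xs @ [G m xs]) @ [F m (xs @ [G m xs])], m) 2 (zs @ xs @ [F m (xs @ [G m xs])], m)"
      by simp
    have 2: "run P2 (zs @ xs @ [G m xs], m) (CF m (xs @ [G m xs])) (zs @ (xs @ [G m xs]) @ [F m (xs @ [G m xs])], m)"
      using P2[of zs "xs @ [G m xs]" m] l by simp
    show "run (Seq P (Seq P2 P3)) (zs @ xs, m) (CG m xs + CF m (xs @ [G m xs]) + 2)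
        (zs @ xs @ [F m (xs @ [G m xs])], m)"
      by (rule run_mono[OF run_Seq[OF P[OF l] run_Seq[OF 2 3]]]) simp
  qed
qed

lemma computes_Add2: "computes 2 (\<lambda>m xs. xs ! 0 + xs ! 1) (\<lambda>m xs. 1)"
  unfolding computes_def
proof (rule allI, intro exI[of _ "Add (b + 2) b (b + 1)" for b] pushesI)
  fix b and zs xs :: "nat list" and m :: mem assume "length zs = b" "length xs = 2"
  then show "run (Add (b + 2) b (b + 1)) (zs @ xs, m) 1 (zs @ xs @ [xs ! 0 + xs ! 1], m)"
    using run_Add[of "b + 2" "zs @ xs" b "b + 1" m] by (simp add: nth_append)
qed

lemma computes_Sub2: "computes 2 (\<lambda>m xs. xs ! 0 - xs ! 1) (\<lambda>m xs. 1)"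
  unfolding computes_def
proof (rule allI, intro exI[of _ "Sub (b + 2) b (b + 1)" for b] pushesI)
  fix b and zs xs :: "nat list" and m :: mem assume "length zs = b" "length xs = 2"
  then show "run (Sub (b + 2) b (b + 1)) (zs @ xs, m) 1 (zs @ xs @ [xs ! 0 - xs ! 1], m)"
    using run_Sub[of "b + 2" "zs @ xs" b "b + 1" m] by (simp add: nth_append)
qed

lemma computes_mem1: "computes 1 (\<lambda>m xs. m (xs ! 0)) (\<lambda>m xs. 2)"
  unfolding computes_def
proof (rule allI, intro exI[of _ "Seq (Const (b + 1) 0) (Load (b + 1) b)" for b] pushesI)
  fix b and zs xs :: "nat list" and m :: mem assume l: "length zs = b" "length xs = 1"
  have "run (Load (b + 1) b) ((zs @ xs) @ [0], m) 1 (((zs @ xs) @ [0])[b + 1 := m (((zs @ xs) @ [0]) ! b)], m)"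
    using l by (intro run_Load_update) simp
  also have "((zs @ xs) @ [0])[b + 1 := m (((zs @ xs) @ [0]) ! b)] = zs @ xs @ [m (xs ! 0)]"
    using l by (simp add: nth_append list_update_append)
  finally have 2: "run (Load (b + 1) b) ((zs @ xs) @ [0], m) 1 (zs @ xs @ [m (xs ! 0)], m)" .
  have 1: "run (Const (b + 1) 0) (zs @ xs, m) 1 ((zs @ xs) @ [0], m)"
    using l by (intro run_Const) simp
  show "run (Seq (Const (b + 1) 0) (Load (b + 1) b)) (zs @ xs, m) 2 (zs @ xs @ [m (xs ! 0)], m)"
    by (rule run_mono[OF run_Seq[OF 1 2]]) simp
qed

lemma computes_if:
  assumes "computes a B CB" "computes a F CF" "computes a G CG"
  shows "computes a (\<lambda>m xs. if B m xs \<noteq> 0 then F m xs else G m xs) (\<lambda>m xs. CB m xs + CF m xs + CG m xs + 1)"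
  unfolding computes_def
proof
  fix b
  from assms(1) obtain P where P [unfolded pushes_def, rule_format]: "pushes b a P B CB"
    by (rule computesD[where b = "b", THEN exE])
  from assms(2) obtain P2 where P2 [unfolded pushes_def, rule_format]: "pushes b a P2 F CF"
    by (rule computesD[where b = "b", THEN exE])
  from assms(3) obtain P3 where P3 [unfolded pushes_def, rule_format]: "pushes b a P3 G CG"
    by (rule computesD[where b = "b", THEN exE])
  show "\<exists>P. pushes b a P (\<lambda>m xs. if B m xs \<noteq> 0 then F m xs else G m xs) (\<lambda>m xs. CB m xs + CF m xs + CG m xs + 1)"
  proof (intro exI[of _ "Seq P (IfNZ (b + a) P2 P3)"] pushesI)
    fix zs xs :: "nat list" and m assume l: "length zs = b" "length xs = a"
    have "run P2 ((zs @ xs) @ [B m xs], m) (CF m xs + CG m xs) (zs @ xs @ [F m xs], m)"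
      "run P3 ((zs @ xs) @ [B m xs], m) (CF m xs + CG m xs) (zs @ xs @ [G m xs], m)"
      by (rule run_mono[OF run_extra[OF P2[OF l]]], simp, rule run_mono[OF run_extra[OF P3[OF l]]], simp)
    then have "run (IfNZ (b + a) P2 P3) ((zs @ xs) @ [B m xs], m) (1 + (CF m xs + CG m xs))
       (zs @ xs @ [if B m xs \<noteq> 0 then F m xs else G m xs], m)"
      using l by (intro run_IfNZ) (simp_all add: nth_append)
    from run_Seq[OF P[OF l] this[simplified]]
    show "run (Seq P (IfNZ (b + a) P2 P3)) (zs @ xs, m) (CB m xs + CF m xs + CG m xs + 1)
       (zs @ xs @ [if B m xs \<noteq> 0 then F m xs else G m xs], m)"
      by (simp add: ac_simps)
  qed
qed

text \<open>Above the arguments lie the index \<open>i\<close>, the accumulator, the number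
  \<open>n - i\<close> of remaining rounds and the constant 1. The machine can only test for 0,
  hence the separate count downwards. The step function looks past the last two registers by means
  of \<open>run_gap\<close>.\<close>

lemma computes_loop:
  assumes N: "computes a N CN" and A: "computes a A CA" and S: "computes (a + 2) S CS"
  defines "acc \<equiv> \<lambda>m xs. rec_nat (A m xs) (\<lambda>i v. S m (xs @ [i, v]))"
  shows "computes a (\<lambda>m xs. acc m xs (N m xs))
    (\<lambda>m xs. CN m xs + CA m xs + (\<Sum>i<N m xs. CS m (xs @ [i, acc m xs i]) + 2 * a + 12) + 4 * a + 20)"
  unfolding computes_def
proof
  fix b
  from run_gap[OF A, of b 1] obtain PA where PA [rule_format]: "\<forall>zs xs ys m. length zs = b \<longrightarrow> length xs = a \<longrightarrow> length ys = 1 \<longrightarrow>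
     run PA (zs @ xs @ ys, m) (CA m xs + 2 * a + 3) (zs @ xs @ ys @ [A m xs], m)" by auto
  from run_gap[OF N, of b 2] obtain PN where PN [rule_format]: "\<forall>zs xs ys m. length zs = b \<longrightarrow> length xs = a \<longrightarrow> length ys = 2 \<longrightarrow>
     run PN (zs @ xs @ ys, m) (CN m xs + 2 * a + 3) (zs @ xs @ ys @ [N m xs], m)" by auto
  from run_gap[OF S, of b 2] obtain PS where PS [rule_format]: "\<forall>zs xs ys m. length zs = b \<longrightarrow> length xs = a + 2 \<longrightarrow> length ys = 2 \<longrightarrow>
     run PS (zs @ xs @ ys, m) (CS m xs + 2 * (a + 2) + 3) (zs @ xs @ ys @ [S m xs], m)" by auto
  let ?c = "b + a"
  define body where "body = Seq PS (Seq (Const (?c + 5) 0) (Seq (Add (?c + 1) (?c + 4) (?c + 5))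
      (Seq (Add ?c ?c (?c + 3)) (Sub (?c + 2) (?c + 2) (?c + 3)))))"
  define prog where "prog = Seq (Const ?c 0) (Seq PA (Seq PN (Seq (Const (?c + 3) 1)
     (Seq (WhileNZ (?c + 2) body) (Seq (Const (?c + 4) 0) (Add ?c (?c + 1) (?c + 4)))))))"
  show "\<exists>P. pushes b a P (\<lambda>m xs. acc m xs (N m xs)) (\<lambda>m xs. CN m xs + CA m xs + (\<Sum>i<N m xs. CS m (xs @ [i, acc m xs i]) + 2 * a + 12) + 4 * a + 20)"
  proof (intro exI[of _ prog] pushesI)
    fix zs xs :: "nat list" and m assume l: "length zs = b" "length xs = a"
    define n where "n = N m xs"
    define st where "st i = zs @ xs @ [i, acc m xs i, n - i, 1]" for i
    have step: "run body (st i, m) (CS m (xs @ [i, acc m xs i]) + 2 * a + 11) (st (Suc i), m)" if "i < n" for i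
    proof -
      let ?v = "acc m xs (Suc i)"
      have v: "S m (xs @ [i, acc m xs i]) = ?v" by (simp add: acc_def)
      have 1: "run PS (st i, m) (CS m (xs @ [i, acc m xs i]) + 2 * (a + 2) + 3) (st i @ [?v], m)"
        using PS[of zs "xs @ [i, acc m xs i]" "[n - i, 1]" m] l by (simp add: st_def v)
      have 2: "run (Const (?c + 5) 0) (st i @ [?v], m) 1 ((st i @ [?v]) @ [0], m)"
        by (rule run_Const) (simp add: st_def l)
      let ?s2 = "zs @ xs @ [i, ?v, n - i, 1, ?v, 0]"
      have "run (Add (?c + 1) (?c + 4) (?c + 5)) ((st i @ [?v]) @ [0], m) 1
         (((st i @ [?v]) @ [0])[?c + 1 := ((st i @ [?v]) @ [0]) ! (?c + 4) + ((st i @ [?v]) @ [0]) ! (?c + 5)], m)"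
        by (rule run_Add_update) (simp_all add: st_def l)
      moreover have "((st i @ [?v]) @ [0])[?c + 1 := ((st i @ [?v]) @ [0]) ! (?c + 4) + ((st i @ [?v]) @ [0]) ! (?c + 5)] = ?s2"
        using l by (simp add: st_def nth_append list_update_append numeral_eq_Suc)
      ultimately have 3: "run (Add (?c + 1) (?c + 4) (?c + 5)) ((st i @ [?v]) @ [0], m) 1 (?s2, m)" by simp
      let ?s3 = "zs @ xs @ [Suc i, ?v, n - i, 1, ?v, 0]"
      have "run (Add ?c ?c (?c + 3)) (?s2, m) 1 (?s2[?c := ?s2 ! ?c + ?s2 ! (?c + 3)], m)"
        by (rule run_Add_update) (simp_all add: l)
      moreover have "?s2[?c := ?s2 ! ?c + ?s2 ! (?c + 3)] = ?s3"
        using l by (simp add: nth_append list_update_append numeral_eq_Suc)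
      ultimately have 4: "run (Add ?c ?c (?c + 3)) (?s2, m) 1 (?s3, m)" by simp
      have "run (Sub (?c + 2) (?c + 2) (?c + 3)) (?s3, m) 1 (?s3[?c + 2 := ?s3 ! (?c + 2) - ?s3 ! (?c + 3)], m)"
        by (rule run_Sub_update) (simp_all add: l)
      moreover have "?s3[?c + 2 := ?s3 ! (?c + 2) - ?s3 ! (?c + 3)] = st (Suc i) @ [?v, 0]"
        using l by (simp add: st_def nth_append list_update_append numeral_eq_Suc)
      ultimately have 5: "run (Sub (?c + 2) (?c + 2) (?c + 3)) (?s3, m) 1 (st (Suc i), m)"
        by (metis run_drop)
      show ?thesis unfolding body_def
        by (rule run_mono[OF run_Seq[OF 1 run_Seq[OF 2 run_Seq[OF 3 run_Seq[OF 4 5]]]]]) simp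
    qed
    have loop: "run (WhileNZ (?c + 2) body) (st 0, m)
        ((\<Sum>i<n. 1 + (CS m (xs @ [i, acc m xs i]) + 2 * a + 11)) + 1) (st n, m)"
      by (rule run_WhileNZ[where m = "\<lambda>_. m"])
        (use step in \<open>auto simp: st_def l nth_append\<close>)
    have 1: "run (Const ?c 0) (zs @ xs, m) 1 (zs @ xs @ [0], m)"
      using run_Const[of ?c "zs @ xs" 0 m] l by simp
    have 2: "run PA (zs @ xs @ [0], m) (CA m xs + 2 * a + 3) (zs @ xs @ [0, A m xs], m)"
      using PA[of zs xs "[0]" m] l by simp
    have 3: "run PN (zs @ xs @ [0, A m xs], m) (CN m xs + 2 * a + 3) (zs @ xs @ [0, A m xs, n], m)"
      using PN[of zs xs "[0, A m xs]" m] l by (simp add: n_def)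
    have 4: "run (Const (?c + 3) 1) (zs @ xs @ [0, A m xs, n], m) 1 (st 0, m)"
      using run_Const[of "?c + 3" "zs @ xs @ [0, A m xs, n]" 1 m] l by (simp add: st_def acc_def)
    have 5: "run (Const (?c + 4) 0) (st n, m) 1 (st n @ [0], m)"
      by (rule run_Const) (simp add: st_def l)
    have "run (Add ?c (?c + 1) (?c + 4)) (st n @ [0], m) 1
        ((st n @ [0])[?c := (st n @ [0]) ! (?c + 1) + (st n @ [0]) ! (?c + 4)], m)"
      by (rule run_Add_update) (simp_all add: st_def l)
    moreover have "(st n @ [0])[?c := (st n @ [0]) ! (?c + 1) + (st n @ [0]) ! (?c + 4)] =
        (zs @ xs @ [acc m xs n]) @ [acc m xs n, 0, 1, 0]"
      using l by (simp add: st_def nth_append list_update_append numeral_eq_Suc)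
    ultimately have 6: "run (Add ?c (?c + 1) (?c + 4)) (st n @ [0], m) 1 (zs @ xs @ [acc m xs n], m)"
      by (metis run_drop)
    have "run prog (zs @ xs, m) (CN m xs + CA m xs + (\<Sum>i<n. CS m (xs @ [i, acc m xs i]) + 2 * a + 12) + 4 * a + 20)
       (zs @ xs @ [acc m xs n], m)"
      unfolding prog_def
      by (rule run_mono[OF run_Seq[OF 1 run_Seq[OF 2 run_Seq[OF 3 run_Seq[OF 4 run_Seq[OF loop run_Seq[OF 5 6]]]]]]])
         (simp add: ac_simps)
    then show "run prog (zs @ xs, m) (CN m xs + CA m xs + (\<Sum>i<N m xs. CS m (xs @ [i, acc m xs i]) + 2 * a + 12) + 4 * a + 20)
       (zs @ xs @ [acc m xs (N m xs)], m)"
      unfolding n_def .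
  qed
qed


section \<open>Polynomial bounds on values and costs\<close>

definition args_le :: "nat \<Rightarrow> mem \<Rightarrow> nat list \<Rightarrow> nat \<Rightarrow> bool" where
  "args_le a m xs X \<longleftrightarrow> length xs = a \<and> (\<forall>x\<in>set xs. x \<le> X) \<and> (\<forall>i. m i \<le> X)"

text \<open>\<open>X\<close> bounds the numbers themselves and not their lengths: multiplication and
  division are loops whose duration is governed by the values. As the base \<open>X + 2\<close> is
  at least 2, constant factors and sums go into the exponent.\<close>

definition poly_bounded :: "nat \<Rightarrow> (mem \<Rightarrow> nat list \<Rightarrow> nat) \<Rightarrow> bool" where
  "poly_bounded a F \<longleftrightarrow> (\<exists>c. \<forall>m xs X. args_le a m xs X \<longrightarrow> F m xs \<le> (X + 2) ^ c)"

lemma poly_boundedI: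
  "(\<And>m xs X. args_le a m xs X \<Longrightarrow> F m xs \<le> (X + 2) ^ c) \<Longrightarrow> poly_bounded a F"
  unfolding poly_bounded_def by blast

lemma poly_bounded_mono:
  "poly_bounded a G \<Longrightarrow> (\<And>m xs. length xs = a \<Longrightarrow> F m xs \<le> G m xs) \<Longrightarrow> poly_bounded a F"
  unfolding poly_bounded_def args_le_def by (meson le_trans)

lemma le_power_self: "c \<le> (X + 2) ^ c" for c X :: nat
proof -
  have "c \<le> 2 ^ c" by (simp add: less_imp_le)
  also have "\<dots> \<le> (X + 2) ^ c" by (rule power_mono) auto
  finally show ?thesis .
qed

lemma poly_bounded_const: "poly_bounded a (\<lambda>m xs. c)"
  by (rule poly_boundedI[where c = c]) (rule le_power_self)

lemma poly_bounded_nth: "i < a \<Longrightarrow> poly_bounded a (\<lambda>m xs. xs ! i)"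
  by (rule poly_boundedI[where c = 1]) (auto simp: args_le_def intro!: le_SucI)

lemma power_sum_le: "(X + 2) ^ c + (X + 2) ^ d \<le> (X + 2) ^ (c + d + 1)" for X c d :: nat
proof -
  have "(X + 2) ^ c + (X + 2) ^ d \<le> (X + 2) ^ (c + d) + (X + 2) ^ (c + d)"
    by (intro add_mono power_increasing) auto
  also have "\<dots> \<le> (X + 2) ^ (c + d + 1)" by (simp add: algebra_simps)
  finally show ?thesis .
qed

lemma poly_bounded_add:
  assumes "poly_bounded a F" "poly_bounded a G"
  shows "poly_bounded a (\<lambda>m xs. F m xs + G m xs)"
proof -
  obtain c where c [rule_format]: "\<forall>m xs X. args_le a m xs X \<longrightarrow> F m xs \<le> (X + 2) ^ c"
    using assms(1) unfolding poly_bounded_def by blast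
  obtain d where d [rule_format]: "\<forall>m xs X. args_le a m xs X \<longrightarrow> G m xs \<le> (X + 2) ^ d"
    using assms(2) unfolding poly_bounded_def by blast
  show ?thesis
  proof (rule poly_boundedI)
    fix m :: mem and xs :: "nat list" and X :: nat
    assume H: "args_le a m xs X"
    have "F m xs + G m xs \<le> (X + 2) ^ c + (X + 2) ^ d" using c[OF H] d[OF H] by simp
    also have "\<dots> \<le> (X + 2) ^ (c + d + 1)" by (rule power_sum_le)
    finally show "F m xs + G m xs \<le> (X + 2) ^ (c + d + 1)" .
  qed
qed

lemma poly_bounded_mult:
  assumes "poly_bounded a F" "poly_bounded a G"
  shows "poly_bounded a (\<lambda>m xs. F m xs * G m xs)"
proof -
  obtain c where c [rule_format]: "\<forall>m xs X. args_le a m xs X \<longrightarrow> F m xs \<le> (X + 2) ^ c"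
    using assms(1) unfolding poly_bounded_def by blast
  obtain d where d [rule_format]: "\<forall>m xs X. args_le a m xs X \<longrightarrow> G m xs \<le> (X + 2) ^ d"
    using assms(2) unfolding poly_bounded_def by blast
  show ?thesis
  proof (rule poly_boundedI)
    fix m :: mem and xs :: "nat list" and X :: nat
    assume H: "args_le a m xs X"
    show "F m xs * G m xs \<le> (X + 2) ^ (c + d)" 
      unfolding power_add using c[OF H] d[OF H] by (intro mult_mono) auto
  qed
qed

lemma args_le_take: "args_le (a + g) m ys X \<Longrightarrow> args_le a m (take a ys) X"
  unfolding args_le_def by (auto dest: in_set_takeD)

lemma args_le_drop: "args_le (a + g) m ys X \<Longrightarrow> args_le g m (drop a ys) X"
  unfolding args_le_def by (auto dest: in_set_dropD)

lemma poly_bounded_take: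
  "poly_bounded a F \<Longrightarrow> poly_bounded (a + g) (\<lambda>m ys. F m (take a ys))"
  unfolding poly_bounded_def
  by (metis args_le_take)

lemma poly_bounded_drop:
  "poly_bounded g F \<Longrightarrow> poly_bounded (a + g) (\<lambda>m ys. F m (drop a ys))"
  unfolding poly_bounded_def
  by (metis args_le_drop)

text \<open>For composition: when \<open>(X + 2) ^ Suc c\<close> becomes the bound on the arguments,
  the new base, with its \<open>+ 2\<close>, is again at most a power of
  \<open>X + 2\<close>.\<close>

lemma power_Suc_add_2_le: "(X + 2) ^ Suc c + 2 \<le> (X + 2) ^ (c + 2)" for X c :: nat
proof -
  let ?Y = "(X + 2) ^ Suc c"
  have "?Y + 2 \<le> 2 * ?Y" using self_le_power[of "X + 2" "Suc c"] by simp
  also have "\<dots> \<le> (X + 2) * ?Y" by (rule mult_right_mono) auto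
  also have "\<dots> = (X + 2) ^ (c + 2)" by simp
  finally show ?thesis .
qed

lemma poly_bounded_let:
  assumes "poly_bounded a G" "poly_bounded (Suc a) F"
  shows "poly_bounded a (\<lambda>m xs. F m (xs @ [G m xs]))"
proof -
  obtain c where c [rule_format]: "\<forall>m xs X. args_le a m xs X \<longrightarrow> G m xs \<le> (X + 2) ^ c"
    using assms(1) unfolding poly_bounded_def by blast
  obtain d where d [rule_format]: "\<forall>m xs X. args_le (Suc a) m xs X \<longrightarrow> F m xs \<le> (X + 2) ^ d"
    using assms(2) unfolding poly_bounded_def by blast
  show ?thesis
  proof (rule poly_boundedI)
    fix m :: mem and xs :: "nat list" and X :: nat
    assume H: "args_le a m xs X"
    let ?Y = "(X + 2) ^ Suc c"
    have X: "X \<le> ?Y"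
      using self_le_power[of "X + 2" "Suc c"] by simp
    have G: "G m xs \<le> ?Y" using c[OF H] by (rule order_trans) (simp add: power_increasing)
    have "F m (xs @ [G m xs]) \<le> (?Y + 2) ^ d"
      using H X G by (intro d) (auto simp: args_le_def intro: le_trans)
    also have "\<dots> \<le> ((X + 2) ^ (c + 2)) ^ d"
      using power_Suc_add_2_le by (rule power_mono) simp
    finally show "F m (xs @ [G m xs]) \<le> (X + 2) ^ ((c + 2) * d)"
      by (simp only: power_mult)
  qed
qed

text \<open>The accumulator is under control only up to the last round, while \<open>xs ! a\<close>
  ranges over all numbers; the \<open>min\<close> confines the index. For the summands, where
  \<open>i < N m xs\<close>, it changes nothing.\<close>

lemma poly_bounded_sum:
  assumes "poly_bounded a N" "poly_bounded (a + 2) S"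
    and "poly_bounded (Suc a) (\<lambda>m xs. acc m (take a xs) (min (xs ! a) (N m (take a xs))))"
  shows "poly_bounded a (\<lambda>m xs. \<Sum>i<N m xs. S m (xs @ [i, acc m xs i]))"
proof -
  obtain c where c [rule_format]: "\<forall>m xs X. args_le a m xs X \<longrightarrow> N m xs \<le> (X + 2) ^ c"
    using assms(1) unfolding poly_bounded_def by blast
  have "poly_bounded (Suc a) (\<lambda>m ys. S m (ys @ [acc m (take a ys) (min (ys ! a) (N m (take a ys)))]))"
    using assms(2) by (intro poly_bounded_let[OF assms(3)]) simp
  then obtain d where d [rule_format]: "\<forall>m xs X. args_le (Suc a) m xs X \<longrightarrow> S m (xs @ [acc m (take a xs) (min (xs ! a) (N m (take a xs)))]) \<le> (X + 2) ^ d"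
    unfolding poly_bounded_def by blast
  show ?thesis
  proof (rule poly_boundedI)
    fix m :: mem and xs :: "nat list" and X :: nat
    assume H: "args_le a m xs X"
    let ?Y = "(X + 2) ^ Suc c"
    have X: "X \<le> ?Y"
      using self_le_power[of "X + 2" "Suc c"] by simp
    have G: "N m xs \<le> ?Y" using c[OF H] by (rule order_trans) (simp add: power_increasing)
    have "S m (xs @ [i, acc m xs i]) \<le> (X + 2) ^ ((c + 2) * d)" if "i < N m xs" for i
    proof -
      have "S m ((xs @ [i]) @ [acc m (take a (xs @ [i])) (min ((xs @ [i]) ! a) (N m (take a (xs @ [i]))))]) \<le> (?Y + 2) ^ d"
        using H X G that by (intro d) (auto simp: args_le_def intro: le_trans)
      also have "\<dots> \<le> ((X + 2) ^ (c + 2)) ^ d" using power_Suc_add_2_le by (rule power_mono) simp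
      finally have "S m ((xs @ [i]) @ [acc m (take a (xs @ [i])) (min ((xs @ [i]) ! a) (N m (take a (xs @ [i]))))]) \<le> (X + 2) ^ ((c + 2) * d)"
        by (simp only: power_mult)
      moreover have "(xs @ [i]) @ [acc m (take a (xs @ [i])) (min ((xs @ [i]) ! a) (N m (take a (xs @ [i]))))] = xs @ [i, acc m xs i]"
        using that H by (simp add: args_le_def min_def nth_append)
      ultimately show ?thesis by simp
    qed
    then have "(\<Sum>i<N m xs. S m (xs @ [i, acc m xs i])) \<le> (\<Sum>i<N m xs. (X + 2) ^ ((c + 2) * d))"
      by (intro sum_mono) auto
    also have "\<dots> = N m xs * (X + 2) ^ ((c + 2) * d)" by simp
    also have "\<dots> \<le> (X + 2) ^ (c + (c + 2) * d)"
      unfolding power_add using c[OF H] by (rule mult_right_mono) simp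
    finally show "(\<Sum>i<N m xs. S m (xs @ [i, acc m xs i])) \<le> (X + 2) ^ (c + (c + 2) * d)" .
  qed
qed

text \<open>The flag lets the same closure lemmas serve polynomial-time programs (\<open>True\<close>) and programs without
  resource bound (\<open>False\<close>).\<close>

definition feasible :: "bool \<Rightarrow> nat \<Rightarrow> (mem \<Rightarrow> nat list \<Rightarrow> nat) \<Rightarrow> bool" where
  "feasible p a F \<longleftrightarrow> (\<exists>C. computes a F C \<and> (p \<longrightarrow> poly_bounded a C \<and> poly_bounded a F))"

lemma feasible_cong:
  assumes "feasible p a F" "\<And>m xs. length xs = a \<Longrightarrow> F m xs = F' m xs"
  shows "feasible p a F'"
proof -
  from assms(1) obtain C where C: "computes a F C" "p \<longrightarrow> poly_bounded a C \<and> poly_bounded a F"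
    unfolding feasible_def by blast
  have "computes a F' C" by (rule computes_cong[OF C(1)]) (use assms(2) in auto)
  moreover have "poly_bounded a F \<Longrightarrow> poly_bounded a F'"
    by (erule poly_bounded_mono) (use assms(2) in auto)
  ultimately show ?thesis using C(2) unfolding feasible_def by blast
qed

lemma feasible_const: "feasible p a (\<lambda>m xs. c)"
  unfolding feasible_def using computes_const poly_bounded_const by blast

lemma feasible_nth: "i < a \<Longrightarrow> feasible p a (\<lambda>m xs. xs ! i)"
  unfolding feasible_def using computes_nth poly_bounded_nth poly_bounded_const by blast

lemma feasible_take:
  assumes "feasible p a F"
  shows "feasible p (a + g) (\<lambda>m ys. F m (take a ys))"
proof -
  from assms obtain C where C: "computes a F C" "p \<longrightarrow> poly_bounded a C \<and> poly_bounded a F"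
    unfolding feasible_def by blast
  have "poly_bounded a C \<Longrightarrow> poly_bounded (a + g) (\<lambda>m ys. C m (take a ys) + 2 * a + 3)"
    by (intro poly_bounded_add poly_bounded_const poly_bounded_take)
  with C(2) show ?thesis unfolding feasible_def
    by (intro exI[of _ "\<lambda>m ys. C m (take a ys) + 2 * a + 3"]) (auto intro: computes_take[OF C(1)] poly_bounded_take)
qed

lemma feasible_drop:
  "feasible p g F \<Longrightarrow> feasible p (a + g) (\<lambda>m ys. F m (drop a ys))"
  unfolding feasible_def using computes_drop poly_bounded_drop by blast

lemma feasible_let:
  assumes "feasible p a G" "feasible p (Suc a) F"
  shows "feasible p a (\<lambda>m xs. F m (xs @ [G m xs]))"
proof -
  from assms(1) obtain CG where G: "computes a G CG" "p \<longrightarrow> poly_bounded a CG \<and> poly_bounded a G"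
    unfolding feasible_def by blast
  from assms(2) obtain CF where F: "computes (Suc a) F CF" "p \<longrightarrow> poly_bounded (Suc a) CF \<and> poly_bounded (Suc a) F"
    unfolding feasible_def by blast
  have "p \<longrightarrow> poly_bounded a (\<lambda>m xs. CG m xs + CF m (xs @ [G m xs]) + 2)"
    using G(2) F(2) by (intro impI poly_bounded_add poly_bounded_const poly_bounded_let[of a G]) auto
  then show ?thesis unfolding feasible_def
    using computes_let[OF G(1) F(1)] poly_bounded_let[of a G] G(2) F(2) by blast
qed

lemma feasible_if:
  assumes "feasible p a B" "feasible p a F" "feasible p a G"
  shows "feasible p a (\<lambda>m xs. if B m xs \<noteq> 0 then F m xs else G m xs)"
proof -
  from assms(1) obtain CB where B: "computes a B CB" "p \<longrightarrow> poly_bounded a CB \<and> poly_bounded a B"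
    unfolding feasible_def by blast
  from assms(2) obtain CF where F: "computes a F CF" "p \<longrightarrow> poly_bounded a CF \<and> poly_bounded a F"
    unfolding feasible_def by blast
  from assms(3) obtain CG where G: "computes a G CG" "p \<longrightarrow> poly_bounded a CG \<and> poly_bounded a G"
    unfolding feasible_def by blast
  have 1: "p \<longrightarrow> poly_bounded a (\<lambda>m xs. CB m xs + CF m xs + CG m xs + 1)"
    using B(2) F(2) G(2) by (intro impI poly_bounded_add poly_bounded_const) auto
  have 2: "p \<longrightarrow> poly_bounded a (\<lambda>m xs. if B m xs \<noteq> 0 then F m xs else G m xs)"
    using B(2) F(2) G(2) by (auto intro!: poly_bounded_mono[OF poly_bounded_add[of a F G]])
  show ?thesis unfolding feasible_def
    using computes_if[OF B(1) F(1) G(1)] 1 2 by blast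
qed

text \<open>Iterating a polynomially bounded step can produce exponential growth. In the polynomial
  case a bound on all intermediate values is therefore a separate hypothesis.\<close>

lemma feasible_loop:
  assumes "feasible p a N" "feasible p a A" "feasible p (a + 2) S"
  defines "acc \<equiv> \<lambda>m xs. rec_nat (A m xs) (\<lambda>i v. S m (xs @ [i, v]))"
  assumes bd: "p \<Longrightarrow> \<exists>B. poly_bounded a B \<and> (\<forall>m xs i. length xs = a \<longrightarrow> i \<le> N m xs \<longrightarrow> acc m xs i \<le> B m xs)"
  shows "feasible p a (\<lambda>m xs. acc m xs (N m xs))"
proof -
  from assms(1) obtain CN where N: "computes a N CN" "p \<longrightarrow> poly_bounded a CN \<and> poly_bounded a N"
    unfolding feasible_def by blast
  from assms(2) obtain CA where A: "computes a A CA" "p \<longrightarrow> poly_bounded a CA \<and> poly_bounded a A"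
    unfolding feasible_def by blast
  from assms(3) obtain CS where S: "computes (a + 2) S CS" "p \<longrightarrow> poly_bounded (a + 2) CS \<and> poly_bounded (a + 2) S"
    unfolding feasible_def by blast
  let ?C = "\<lambda>m xs. CN m xs + CA m xs + (\<Sum>i<N m xs. CS m (xs @ [i, acc m xs i]) + 2 * a + 12) + 4 * a + 20"
  have "poly_bounded a ?C \<and> poly_bounded a (\<lambda>m xs. acc m xs (N m xs))" if p: p
  proof -
    obtain B where B: "poly_bounded a B" "\<And>m xs i. length xs = a \<Longrightarrow> i \<le> N m xs \<Longrightarrow> acc m xs i \<le> B m xs"
      using bd[OF p] by blast
    have 1: "poly_bounded a (\<lambda>m xs. acc m xs (N m xs))"
      by (rule poly_bounded_mono[OF B(1)]) (use B(2) in auto)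
    have "poly_bounded (Suc a) (\<lambda>m xs. B m (take a xs))"
      using poly_bounded_take[OF B(1), of 1] by simp
    then have 2: "poly_bounded (Suc a) (\<lambda>m xs. acc m (take a xs) (min (xs ! a) (N m (take a xs))))"
      by (rule poly_bounded_mono) (auto intro: B(2))
    have "poly_bounded (a + 2) (\<lambda>m xs. CS m xs + 2 * a + 12)"
      using S(2) p by (intro poly_bounded_add poly_bounded_const) auto
    from poly_bounded_sum[OF _ this 2] N(2) that
    have 3: "poly_bounded a (\<lambda>m xs. \<Sum>i<N m xs. CS m (xs @ [i, acc m xs i]) + 2 * a + 12)" by auto
    have "poly_bounded a ?C"
      using N(2) A(2) p 3 by (intro poly_bounded_add poly_bounded_const) auto
    with 1 show ?thesis by blast
  qed
  with computes_loop[OF N(1) A(1) S(1)] show ?thesis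
    unfolding feasible_def acc_def by blast
qed

lemma feasible_comp1:
  assumes "feasible p 1 (\<lambda>m xs. f m (xs ! 0))" "feasible p a F"
  shows "feasible p a (\<lambda>m xs. f m (F m xs))"
proof -
  have "feasible p (a + 1) (\<lambda>m xs. f m (drop a xs ! 0))"
    using assms(1) by (rule feasible_drop)
  from feasible_let[OF assms(2) this[simplified]] show ?thesis
    by (rule feasible_cong) (simp add: nth_append)
qed

lemma feasible_comp2:
  assumes "feasible p 2 (\<lambda>m xs. f m (xs ! 0) (xs ! 1))" "feasible p a F" "feasible p a G"
  shows "feasible p a (\<lambda>m xs. f m (F m xs) (G m xs))"
proof -
  have "feasible p (a + 2) (\<lambda>m xs. f m (drop a xs ! 0) (drop a xs ! 1))"
    using assms(1) by (rule feasible_drop)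
  then have "feasible p (Suc (Suc a)) (\<lambda>m xs. f m (drop a xs ! 0) (drop a xs ! 1))" by simp
  from feasible_let[OF feasible_take[OF assms(3), of 1, simplified] this]
  have "feasible p (Suc a) (\<lambda>m xs. f m (xs ! a) (G m (take a xs)))"
    by (rule feasible_cong) (simp add: nth_append)
  from feasible_let[OF assms(2) this] show ?thesis
    by (rule feasible_cong) (simp add: nth_append)
qed

lemma feasible_comp3:
  assumes "feasible p 3 (\<lambda>m xs. f m (xs ! 0) (xs ! 1) (xs ! 2))" "feasible p a F" "feasible p a G" "feasible p a H"
  shows "feasible p a (\<lambda>m xs. f m (F m xs) (G m xs) (H m xs))"
proof -
  have "feasible p (a + 3) (\<lambda>m xs. f m (drop a xs ! 0) (drop a xs ! 1) (drop a xs ! 2))"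
    using assms(1) by (rule feasible_drop)
  then have "feasible p (Suc (Suc (Suc a))) (\<lambda>m xs. f m (drop a xs ! 0) (drop a xs ! 1) (drop a xs ! 2))"
    by (simp add: numeral_3_eq_3)
  from feasible_let[OF feasible_take[OF assms(4), of 2, simplified] this]
  have "feasible p (Suc (Suc a)) (\<lambda>m xs. f m (xs ! a) (xs ! (a + 1)) (H m (take a xs)))"
    by (rule feasible_cong) (simp add: nth_append numeral_eq_Suc)
  from feasible_let[OF feasible_take[OF assms(3), of 1, simplified] this]
  have "feasible p (Suc a) (\<lambda>m xs. f m (xs ! a) (G m (take a xs)) (H m (take a xs)))"
    by (rule feasible_cong) (simp add: nth_append)
  from feasible_let[OF assms(2) this] show ?thesis
    by (rule feasible_cong) (simp add: nth_append)
qed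

lemma feasible_add:
  assumes "feasible p a F" "feasible p a G"
  shows "feasible p a (\<lambda>m xs. F m xs + G m xs)"
proof (rule feasible_comp2[OF _ assms])
  show "feasible p 2 (\<lambda>m xs. xs ! 0 + xs ! 1)"
    unfolding feasible_def
    by (intro exI[of _ "\<lambda>m xs. 1"] conjI impI computes_Add2 poly_bounded_add poly_bounded_nth poly_bounded_const) simp_all
qed

lemma feasible_sub:
  assumes "feasible p a F" "feasible p a G"
  shows "feasible p a (\<lambda>m xs. F m xs - G m xs)"
proof (rule feasible_comp2[OF _ assms])
  show "feasible p 2 (\<lambda>m xs. xs ! 0 - xs ! 1)"
    unfolding feasible_def
    by (intro exI[of _ "\<lambda>m xs. 1"] conjI impI computes_Sub2 poly_bounded_const
        poly_bounded_mono[OF poly_bounded_nth[of 0 2]]) simp_all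
qed

lemma feasible_mem:
  assumes "feasible p a F"
  shows "feasible p a (\<lambda>m xs. m (F m xs))"
proof (rule feasible_comp1[OF _ assms])
  have "poly_bounded 1 (\<lambda>m xs. m (xs ! 0))"
    by (rule poly_boundedI[where c = 1]) (auto simp: args_le_def intro!: le_SucI)
  then show "feasible p 1 (\<lambda>m xs. m (xs ! 0))"
    unfolding feasible_def using computes_mem1 poly_bounded_const by blast
qed

section \<open>Decidable predicates and arithmetic\<close>

abbreviation decidable :: "bool \<Rightarrow> nat \<Rightarrow> (mem \<Rightarrow> nat list \<Rightarrow> bool) \<Rightarrow> bool" where
  "decidable p a B \<equiv> feasible p a (\<lambda>m xs. of_bool (B m xs))"

lemma feasible_If:
  assumes "decidable p a B" "feasible p a F" "feasible p a G"
  shows "feasible p a (\<lambda>m xs. if B m xs then F m xs else G m xs)"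
  by (rule feasible_cong[OF feasible_if[OF assms]]) simp

lemma decidable_less:
  assumes "feasible p a F" "feasible p a G"
  shows "decidable p a (\<lambda>m xs. F m xs < G m xs)"
  by (rule feasible_cong[OF feasible_if[OF feasible_sub[OF assms(2,1)] feasible_const[of _ _ 1] feasible_const[of _ _ 0]]])
     auto

lemma decidable_not:
  assumes "decidable p a B"
  shows "decidable p a (\<lambda>m xs. \<not> B m xs)"
  by (rule feasible_cong[OF feasible_If[OF assms feasible_const[of _ _ 0] feasible_const[of _ _ 1]]]) auto

lemma decidable_conj:
  assumes "decidable p a B" "decidable p a C"
  shows "decidable p a (\<lambda>m xs. B m xs \<and> C m xs)"
  by (rule feasible_cong[OF feasible_If[OF assms feasible_const[of _ _ 0]]]) auto

lemma decidable_disj: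
  assumes "decidable p a B" "decidable p a C"
  shows "decidable p a (\<lambda>m xs. B m xs \<or> C m xs)"
  by (rule feasible_cong[OF feasible_If[OF assms(1) feasible_const[of _ _ 1] assms(2)]]) auto

lemma decidable_eq:
  assumes "feasible p a F" "feasible p a G"
  shows "decidable p a (\<lambda>m xs. F m xs = G m xs)"
  by (rule feasible_cong[OF decidable_conj[OF decidable_not[OF decidable_less[OF assms]]
        decidable_not[OF decidable_less[OF assms(2,1)]]]]) auto

lemma decidable_if:
  assumes "decidable p a B" "decidable p a C" "decidable p a D"
  shows "decidable p a (\<lambda>m xs. if B m xs then C m xs else D m xs)"
  by (rule feasible_cong[OF feasible_If[OF assms]]) auto

lemma feasible_mult:
  assumes "feasible p a F" "feasible p a G"
  shows "feasible p a (\<lambda>m xs. F m xs * G m xs)"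
proof (rule feasible_comp2[OF _ assms])
  have eq: "rec_nat (0 :: nat) (\<lambda>i v. (xs @ [i, v]) ! 3 + (xs @ [i, v]) ! 1) n = n * xs ! 1"
    if "length xs = 2" for xs n
    using that by (induction n) (auto simp: nth_append)
  have "feasible p 2 (\<lambda>m xs. rec_nat 0 (\<lambda>i v. (xs @ [i, v]) ! 3 + (xs @ [i, v]) ! 1) (xs ! 0))"
  proof (rule feasible_loop)
    show "\<exists>B. poly_bounded 2 B \<and> (\<forall>m xs i. length xs = 2 \<longrightarrow> i \<le> xs ! 0 \<longrightarrow>
        rec_nat 0 (\<lambda>i v. (xs @ [i, v]) ! 3 + (xs @ [i, v]) ! 1) i \<le> B m xs)"
      by (intro exI[of _ "\<lambda>m xs. xs ! 0 * xs ! 1"]) (auto simp: eq[simplified] intro!: poly_bounded_mult poly_bounded_nth)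
  qed (intro feasible_add feasible_nth feasible_const; simp)+
  then show "feasible p 2 (\<lambda>m xs. xs ! 0 * xs ! 1)"
    by (rule feasible_cong) (simp add: eq[simplified])
qed

text \<open>Counting is the form that all bounded search takes: bounded quantifiers, quotients and
  the parameter \<open>h\<close> are expressed as cardinalities. The count never exceeds the number
  of rounds, which settles its polynomial bound.\<close>

lemma feasible_count:
  assumes "feasible p a N" "decidable p (Suc a) (\<lambda>m ys. B m (take a ys) (ys ! a))"
  shows "feasible p a (\<lambda>m xs. card {i. i < N m xs \<and> B m xs i})"
proof -
  let ?S = "\<lambda>m ys. ys ! (a + 1) + of_bool (B m (take a ys) (ys ! a))"
  have eq: "rec_nat 0 (\<lambda>i v. ?S m (xs @ [i, v])) n = card {i. i < n \<and> B m xs i}"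
    if "length xs = a" for m xs n
  proof (induction n)
    case (Suc n)
    have "{i. i < Suc n \<and> B m xs i} = (if B m xs n then insert n {i. i < n \<and> B m xs i} else {i. i < n \<and> B m xs i})"
      by (auto simp: less_Suc_eq)
    with Suc that show ?case by (simp add: nth_append)
  qed simp
  have le: "card {i. i < n \<and> B m xs i} \<le> n" for m xs n
    using card_mono[of "{..<n}" "{i. i < n \<and> B m xs i}"] by auto
  have "feasible p (Suc a + 1) (\<lambda>m ys. of_bool (B m (take a (take (Suc a) ys)) (take (Suc a) ys ! a)))"
    by (rule feasible_take[OF assms(2)])
  then have S: "feasible p (a + 2) ?S"
    by (intro feasible_add feasible_nth) (auto simp: min_def numeral_2_eq_2)
  have "feasible p a (\<lambda>m xs. rec_nat 0 (\<lambda>i v. ?S m (xs @ [i, v])) (N m xs))"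
  proof (rule feasible_loop[OF assms(1) feasible_const S])
    assume p
    with assms(1) have "poly_bounded a N" by (auto simp: feasible_def)
    then show "\<exists>C. poly_bounded a C \<and> (\<forall>m xs i. length xs = a \<longrightarrow> i \<le> N m xs \<longrightarrow>
        rec_nat 0 (\<lambda>i v. ?S m (xs @ [i, v])) i \<le> C m xs)"
      by (intro exI[of _ N] conjI allI impI) (simp, subst eq, simp, rule le_trans[OF le])
  qed
  then show ?thesis by (rule feasible_cong) (subst eq, simp_all)
qed

lemma decidable_bex:
  assumes "feasible p a N" "decidable p (Suc a) (\<lambda>m ys. B m (take a ys) (ys ! a))"
  shows "decidable p a (\<lambda>m xs. \<exists>i<N m xs. B m xs i)"
  by (rule feasible_cong[OF feasible_if[OF feasible_count[OF assms] feasible_const[of _ _ 1] feasible_const[of _ _ 0]]])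
     auto

lemma feasible_div:
  assumes "feasible p a F" "feasible p a G"
  shows "feasible p a (\<lambda>m xs. F m xs div G m xs)"
proof (rule feasible_comp2[OF _ assms])
  \<comment> \<open>The quotient counts the positive multiples of \<open>y\<close> up to
    \<open>x\<close>; the conjunct \<open>0 < y\<close> makes it 0 for \<open>y = 0\<close>, as in
    HOL.\<close>
  have eq: "card {i. i < x \<and> \<not> x < Suc i * y \<and> 0 < y} = x div y" for x y :: nat
  proof (cases "y = 0")
    case False
    have "{i. i < x \<and> \<not> x < Suc i * y \<and> 0 < y} = {..<x div y}"
    proof (intro equalityI subsetI)
      fix i assume "i \<in> {..<x div y}"
      then have "Suc i \<le> x div y" by simp
      then have "Suc i * y \<le> x"
        using False by (simp add: less_eq_div_iff_mult_less_eq)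
      moreover have "Suc i \<le> Suc i * y" using False by (cases y) auto
      ultimately show "i \<in> {i. i < x \<and> \<not> x < Suc i * y \<and> 0 < y}" using False by auto
    next
      fix i assume "i \<in> {i. i < x \<and> \<not> x < Suc i * y \<and> 0 < y}"
      then have "Suc i * y \<le> x" by auto
      then show "i \<in> {..<x div y}"
        using False less_eq_div_iff_mult_less_eq[of y "Suc i" x] by (simp add: Suc_le_eq)
    qed
    then show ?thesis by simp
  qed simp
  have "feasible p 2 (\<lambda>m xs. card {i. i < xs ! 0 \<and> \<not> xs ! 0 < (i + 1) * xs ! 1 \<and> 0 < xs ! 1})"
    by (rule feasible_count)
       (auto intro!: feasible_nth decidable_conj decidable_not decidable_less feasible_mult feasible_add feasible_const)
  then show "feasible p 2 (\<lambda>m xs. xs ! 0 div xs ! 1)"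
    by (rule feasible_cong) (use eq in simp)
qed

lemma feasible_mod:
  assumes "feasible p a F" "feasible p a G"
  shows "feasible p a (\<lambda>m xs. F m xs mod G m xs)"
proof -
  have "feasible p a (\<lambda>m xs. F m xs - G m xs * (F m xs div G m xs))"
    by (intro feasible_sub feasible_mult feasible_div assms)
  then show ?thesis by (rule feasible_cong) (simp add: minus_mult_div_eq_mod)
qed

lemma feasible_min:
  assumes "feasible p a F" "feasible p a G"
  shows "feasible p a (\<lambda>m xs. min (F m xs) (G m xs))"
  by (rule feasible_cong[OF feasible_If[OF decidable_less[OF assms] assms]]) auto

text \<open>Capping keeps the intermediate powers polynomially bounded.\<close>

lemma feasible_capped_power:
  assumes "feasible p a F" "feasible p a G" "feasible p a H"
  shows "feasible p a (\<lambda>m xs. min (F m xs ^ G m xs) (H m xs))"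
proof (rule feasible_comp3[OF _ assms])
  \<comment> \<open>Capping in every round equals capping once at the end: a product that has
    reached the cap stays there if \<open>z > 0\<close>, and for \<open>z = 0\<close> a power can
    exceed only the cap 0.\<close>
  have 1: "min (min (z ^ i) c * z) c = min (z ^ i * z) c" for z c i :: nat
  proof (cases "z ^ i \<le> c \<or> c = 0")
    case False
    then have "z > 0" by (cases "z = 0"; cases i) auto
    then have "c \<le> c * z" "z ^ i \<le> z ^ i * z" by auto
    moreover from this False have "c < z ^ i * z" by linarith
    ultimately show ?thesis using False by (simp add: min_def)
  qed (auto simp: min_def)
  have eq: "rec_nat (min 1 (xs ! 2)) (\<lambda>i v. min ((xs @ [i, v]) ! 4 * (xs @ [i, v]) ! 0) ((xs @ [i, v]) ! 2)) n
      = min (xs ! 0 ^ n) (xs ! 2)"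
    if "length xs = 3" for xs :: "nat list" and n
    using that by (induction n) (auto simp: nth_append 1 mult.commute[of "xs ! 0"])
  have "feasible p 3 (\<lambda>m xs. rec_nat (min 1 (xs ! 2)) (\<lambda>i v. min ((xs @ [i, v]) ! 4 * (xs @ [i, v]) ! 0) ((xs @ [i, v]) ! 2)) (xs ! 1))"
  proof (rule feasible_loop)
    show "\<exists>B. poly_bounded 3 B \<and> (\<forall>m xs i. length xs = 3 \<longrightarrow> i \<le> xs ! 1 \<longrightarrow>
        rec_nat (min 1 (xs ! 2)) (\<lambda>i v. min ((xs @ [i, v]) ! 4 * (xs @ [i, v]) ! 0) ((xs @ [i, v]) ! 2)) i \<le> B m xs)"
      by (intro exI[of _ "\<lambda>m xs. xs ! 2"]) (auto simp: eq[simplified] intro!: poly_bounded_nth)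
  qed (intro feasible_min feasible_mult feasible_nth feasible_const; simp)+
  then show "feasible p 3 (\<lambda>m xs. min (xs ! 0 ^ xs ! 1) (xs ! 2))"
    by (rule feasible_cong) (simp add: eq[simplified])
qed

text \<open>Uncapped powers outgrow every polynomial, whence the flag \<open>False\<close>. They
  serve for the parameters that depend on \<open>k\<close> alone.\<close>

lemma feasible_power:
  assumes "feasible False a F" "feasible False a G"
  shows "feasible False a (\<lambda>m xs. F m xs ^ G m xs)"
proof (rule feasible_comp2[OF _ assms])
  have eq: "rec_nat 1 (\<lambda>i v. (xs @ [i, v]) ! 3 * (xs @ [i, v]) ! 0) n = xs ! 0 ^ n"
    if "length xs = 2" for xs :: "nat list" and n
    using that by (induction n) (auto simp: nth_append mult.commute)
  have "feasible False 2 (\<lambda>m xs. rec_nat 1 (\<lambda>i v. (xs @ [i, v]) ! 3 * (xs @ [i, v]) ! 0) (xs ! 1))"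
  proof (rule feasible_loop)
    show "feasible False (2 + 2) (\<lambda>m xs. xs ! 3 * xs ! 0)"
      by (intro feasible_mult feasible_nth) simp_all
  qed (auto intro: feasible_nth feasible_const)
  then show "feasible False 2 (\<lambda>m xs. xs ! 0 ^ xs ! 1)"
    by (rule feasible_cong) (simp add: eq[simplified])
qed

section \<open>Relocating a program and cleaning up after it\<close>

primrec regs_below :: "nat \<Rightarrow> prog \<Rightarrow> bool" where
  "regs_below R (Const x a) = (x < R)"
| "regs_below R (Add x y z) = (x < R \<and> y < R \<and> z < R)"
| "regs_below R (Sub x y z) = (x < R \<and> y < R \<and> z < R)"
| "regs_below R (Load x y) = (x < R \<and> y < R)"
| "regs_below R (Store x y) = (x < R \<and> y < R)"
| "regs_below R (Seq P Q) = (regs_below R P \<and> regs_below R Q)"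
| "regs_below R (IfNZ x P Q) = (x < R \<and> regs_below R P \<and> regs_below R Q)"
| "regs_below R (WhileNZ x P) = (x < R \<and> regs_below R P)"

lemma regs_below_mono: "regs_below R P \<Longrightarrow> R \<le> R' \<Longrightarrow> regs_below R' P"
  by (induction P) auto

lemma regs_below_exists: "\<exists>R>0. regs_below R P"
proof (induction P)
  case (Const x a)
  show ?case by (rule exI[of _ "Suc x"]) simp
next
  case (Add x y z)
  show ?case by (rule exI[of _ "Suc (x + y + z)"]) simp
next
  case (Sub x y z)
  show ?case by (rule exI[of _ "Suc (x + y + z)"]) simp
next
  case (Load x y)
  show ?case by (rule exI[of _ "Suc (x + y)"]) simp
next
  case (Store x y)
  show ?case by (rule exI[of _ "Suc (x + y)"]) simp
next
  case (Seq P Q)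
  then obtain R R' where "R > 0" "regs_below R P" "regs_below R' Q" by blast
  then show ?case by (intro exI[of _ "R + R'"]) (auto intro: regs_below_mono)
next
  case (IfNZ x P Q)
  then obtain R R' where "R > 0" "regs_below R P" "regs_below R' Q" by blast
  then show ?case by (intro exI[of _ "Suc x + R + R'"]) (auto intro: regs_below_mono)
next
  case (WhileNZ x P)
  then obtain R where "R > 0" "regs_below R P" by blast
  then show ?case by (intro exI[of _ "Suc x + R"]) (auto intro: regs_below_mono)
qed

abbreviation tick :: "nat \<Rightarrow> prog" where
  "tick b \<equiv> Add (b + 1) (b + 1) (b + 3)"

text \<open>
  The registers of the relocated program start at \<open>b + 4\<close>. Register \<open>b\<close> holds the offset added to
  all addresses, \<open>b + 1\<close> counts the steps, \<open>b + 2\<close> sums up the addresses written to (so that it bounds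
  all of them), \<open>b + 3\<close> holds the constant 1 and \<open>b + 4 + R\<close> is used for address computations.
\<close>

primrec relocate :: "nat \<Rightarrow> nat \<Rightarrow> prog \<Rightarrow> prog" where
  "relocate b R (Const x a) = Seq (Const (b + 4 + x) a) (tick b)"
| "relocate b R (Add x y z) = Seq (Add (b + 4 + x) (b + 4 + y) (b + 4 + z)) (tick b)"
| "relocate b R (Sub x y z) = Seq (Sub (b + 4 + x) (b + 4 + y) (b + 4 + z)) (tick b)"
| "relocate b R (Load x y) = Seq (Add (b + 4 + R) b (b + 4 + y))
     (Seq (Load (b + 4 + x) (b + 4 + R)) (tick b))"
| "relocate b R (Store x y) = Seq (Add (b + 4 + R) b (b + 4 + x))
     (Seq (Store (b + 4 + R) (b + 4 + y))
     (Seq (Add (b + 2) (b + 2) (b + 4 + x)) (tick b)))"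
| "relocate b R (Seq P Q) = Seq (relocate b R P) (relocate b R Q)"
| "relocate b R (IfNZ x P Q) = IfNZ (b + 4 + x) (Seq (tick b) (relocate b R P))
     (Seq (tick b) (relocate b R Q))"
| "relocate b R (WhileNZ x P) = Seq (WhileNZ (b + 4 + x) (Seq (tick b) (relocate b R P)))
     (tick b)"

text \<open>\<open>\<mu>\<close> is the real memory and \<open>m\<close> the memory that a program
  relocated to offset \<open>B\<close> believes it has.\<close>

definition overlay :: "nat \<Rightarrow> mem \<Rightarrow> mem \<Rightarrow> mem" where
  "overlay B m \<mu> = (\<lambda>a. if a < B then \<mu> a else m (a - B))"

lemma overlay_above [simp]: "overlay B m \<mu> (B + a) = m a"
  by (simp add: overlay_def)

lemma overlay_overlay [simp]: "overlay B m (overlay B m' \<mu>) = overlay B m \<mu>"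
  by (auto simp: overlay_def)

lemma overlay_same: "(\<And>a. \<mu> (B + a) = m a) \<Longrightarrow> overlay B m \<mu> = \<mu>"
  by (rule ext) (metis overlay_def le_add_diff_inverse not_less)

lemma overlay_update: "(\<And>a. \<mu> (B + a) = m a) \<Longrightarrow> \<mu>(B + x := v) = overlay B (m(x := v)) \<mu>"
  by (rule ext) (auto simp: overlay_def dest: le_add_diff_inverse, metis le_add_diff_inverse not_less)

definition reloc_regs :: "nat \<Rightarrow> nat \<Rightarrow> nat \<Rightarrow> nat \<Rightarrow> (nat \<Rightarrow> nat) \<Rightarrow> nat list" where
  "reloc_regs R B T u r = [B, T, u, 1] @ map r [0..<R]"

lemma length_reloc_regs [simp]: "length (reloc_regs R B T u r) = R + 4"
  by (simp add: reloc_regs_def)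

lemma reloc_regs_nth:
  "length zs = b \<Longrightarrow> x < R \<Longrightarrow> (zs @ reloc_regs R B T u r) ! (b + 4 + x) = r x"
  "length zs = b \<Longrightarrow> (zs @ reloc_regs R B T u r) ! b = B"
  by (simp_all add: nth_append reloc_regs_def)

lemma reloc_regs_update:
  "length zs = b \<Longrightarrow> x < R \<Longrightarrow> (zs @ reloc_regs R B T u r)[b + 4 + x := v] = zs @ reloc_regs R B T u (r(x := v))"
  by (rule nth_equalityI) (auto simp: nth_append nth_list_update reloc_regs_def nth_Cons split: nat.splits)

lemma run_tick:
  assumes "length zs = b"
  shows "run (tick b) (zs @ reloc_regs R B T u r, m) 1 (zs @ reloc_regs R B (Suc T) u r, m)"
proof -
  let ?s = "zs @ reloc_regs R B T u r"
  have "?s[b + 1 := ?s ! (b + 1) + ?s ! (b + 3)] = zs @ reloc_regs R B (Suc T) u r"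
    using assms by (simp add: reloc_regs_def nth_append list_update_append numeral_eq_Suc)
  with run_Add_update[of "b + 1" ?s "b + 3" "b + 1" m] assms show ?thesis by simp
qed

text \<open>A relocated loop is followed by a tick for its last, failing test. The loop has to be
  unrolled beneath this \<open>Seq\<close>, because the induction hypothesis on the remaining rounds
  includes that tick.\<close>

lemma run_Seq_WhileNZ_step:
  assumes "x < length xs" "xs ! x \<noteq> 0" "run P (xs, m) T s'" "run (Seq (WhileNZ x P) Q) s' T' s''"
  shows "run (Seq (WhileNZ x P) Q) (xs, m) (1 + T + T') s''"
  unfolding run_def
proof (intro allI impI)
  fix r assume r: "holds (fst (xs, m)) r"
  with assms(1) have rx: "r x = xs ! x" by (simp add: holds_def)
  from r assms(3) obtain t r' where 1: "exec P (r, m) t (r', snd s')" "t \<le> T" "holds (fst s') r'"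
    unfolding run_def by auto
  from 1 assms(4) obtain t' r'' where 2: "exec (Seq (WhileNZ x P) Q) (r', snd s') t' (r'', snd s'')"
    "t' \<le> T'" "holds (fst s'') r''"
    unfolding run_def by blast
  from 2(1) obtain t1 \<sigma> t2 where 3: "exec (WhileNZ x P) (r', snd s') t1 \<sigma>" "exec Q \<sigma> t2 (r'', snd s'')" "t' = t1 + t2"
    by (rule exec_elims(6)) blast
  from exec.While_step[OF _ 1(1) 3(1)] rx assms(2)
  have "exec (WhileNZ x P) (r, m) (1 + t + t1) \<sigma>" by simp
  from exec.Seq[OF this 3(2)] 1(2) 2(2,3) 3(3)
  show "\<exists>t r'. exec (Seq (WhileNZ x P) Q) (r, snd (xs, m)) t (r', snd s'') \<and> t \<le> 1 + T + T' \<and> holds (fst s'') r'"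
    by (intro exI[of _ "1 + t + t1 + t2"] exI[of _ r'']) auto
qed

text \<open>\<open>s\<close> is what the run adds to the address register, the same wherever the
  program is placed. The factor 4 is the length of the longest translation, that of
  \<open>Store\<close>.\<close>

definition relocates :: "nat \<Rightarrow> prog \<Rightarrow> state \<Rightarrow> nat \<Rightarrow> state \<Rightarrow> nat \<Rightarrow> bool" where
  "relocates R P \<sigma> t \<sigma>' s \<longleftrightarrow> (\<forall>a. snd \<sigma>' a \<noteq> snd \<sigma> a \<longrightarrow> a \<le> s) \<and>
    (\<forall>b zs B T u \<mu>. length zs = b \<longrightarrow> (\<forall>a. \<mu> (B + a) = snd \<sigma> a) \<longrightarrow>
       run (relocate b R P) (zs @ reloc_regs R B T u (fst \<sigma>), \<mu>) (4 * t)
         (zs @ reloc_regs R B (T + t) (u + s) (fst \<sigma>'), overlay B (snd \<sigma>') \<mu>))"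

lemma relocatesI:
  assumes "\<And>a. snd \<sigma>' a \<noteq> snd \<sigma> a \<Longrightarrow> a \<le> s"
    and "\<And>b zs B T u \<mu>. length zs = b \<Longrightarrow> (\<And>a. \<mu> (B + a) = snd \<sigma> a) \<Longrightarrow>
       run (relocate b R P) (zs @ reloc_regs R B T u (fst \<sigma>), \<mu>) (4 * t)
         (zs @ reloc_regs R B (T + t) (u + s) (fst \<sigma>'), overlay B (snd \<sigma>') \<mu>)"
  shows "\<exists>s. relocates R P \<sigma> t \<sigma>' s"
  using assms unfolding relocates_def by blast

lemma relocatesD:
  assumes "relocates R P \<sigma> t \<sigma>' s"
  shows "snd \<sigma>' a \<noteq> snd \<sigma> a \<Longrightarrow> a \<le> s"
    and "length zs = b \<Longrightarrow> (\<And>a. \<mu> (B + a) = snd \<sigma> a) \<Longrightarrow>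
       run (relocate b R P) (zs @ reloc_regs R B T u (fst \<sigma>), \<mu>) (4 * t)
         (zs @ reloc_regs R B (T + t) (u + s) (fst \<sigma>'), overlay B (snd \<sigma>') \<mu>)"
  using assms unfolding relocates_def by blast+

lemma relocates_assign:
  assumes "\<And>b. relocate b R P = Seq (I b) (tick b)"
    and "\<And>b zs B T u \<mu>. length zs = b \<Longrightarrow> (\<And>a. \<mu> (B + a) = m a) \<Longrightarrow>
       run (I b) (zs @ reloc_regs R B T u r, \<mu>) 2 (zs @ reloc_regs R B T u r', \<mu>)"
  shows "\<exists>s. relocates R P (r, m) 1 (r', m) s"
proof (rule relocatesI[where s = 0])
  fix b and zs :: "nat list" and B T u \<mu> assume l: "length zs = b" and m: "\<And>a. \<mu> (B + a) = snd (r, m) a"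
  show "run (relocate b R P) (zs @ reloc_regs R B T u (fst (r, m)), \<mu>) (4 * 1)
      (zs @ reloc_regs R B (T + 1) (u + 0) (fst (r', m)), overlay B (snd (r', m)) \<mu>)"
    using run_Seq[OF assms(2)[OF l] run_tick[OF l], of \<mu> B T u] m unfolding assms(1)
    by (auto simp: overlay_same elim: run_mono)
qed simp

text \<open>The real time is only bounded, but the registers show the step count \<open>t\<close>
  and the sum \<open>s\<close> exactly. Exactness is what later turns the time bound into a
  computable function.\<close>

lemma run_relocate:
  assumes "exec P \<sigma> t \<sigma>'" "regs_below R P"
  shows "\<exists>s. relocates R P \<sigma> t \<sigma>' s"
  using assms
proof (induction rule: exec.induct)
  case (Const x a r m)
  show ?case
  proof (rule relocates_assign[OF relocate.simps(1)])
    fix b and zs :: "nat list" and B T u \<mu> assume l: "length zs = b"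
    show "run (Const (b + 4 + x) a) (zs @ reloc_regs R B T u r, \<mu>) 2 (zs @ reloc_regs R B T u (r(x := a)), \<mu>)"
      using run_mono[OF run_Const_update[of "b + 4 + x" a "zs @ reloc_regs R B T u r" \<mu>], of 2]
        reloc_regs_update[of zs b x R] l Const.prems by simp
  qed
next
  case (Add x y z r m)
  show ?case
  proof (rule relocates_assign[OF relocate.simps(2)])
    fix b and zs :: "nat list" and B T u \<mu> assume l: "length zs = b"
    show "run (Add (b + 4 + x) (b + 4 + y) (b + 4 + z)) (zs @ reloc_regs R B T u r, \<mu>) 2
        (zs @ reloc_regs R B T u (r(x := r y + r z)), \<mu>)"
      using run_mono[OF run_Add_update[of "b + 4 + y" "zs @ reloc_regs R B T u r" "b + 4 + z" "b + 4 + x" \<mu>], of 2]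
        reloc_regs_update[of zs b x R] reloc_regs_nth(1)[of zs b _ R] l Add.prems by simp
  qed
next
  case (Sub x y z r m)
  show ?case
  proof (rule relocates_assign[OF relocate.simps(3)])
    fix b and zs :: "nat list" and B T u \<mu> assume l: "length zs = b"
    show "run (Sub (b + 4 + x) (b + 4 + y) (b + 4 + z)) (zs @ reloc_regs R B T u r, \<mu>) 2
        (zs @ reloc_regs R B T u (r(x := r y - r z)), \<mu>)"
      using run_mono[OF run_Sub_update[of "b + 4 + y" "zs @ reloc_regs R B T u r" "b + 4 + z" "b + 4 + x" \<mu>], of 2]
        reloc_regs_update[of zs b x R] reloc_regs_nth(1)[of zs b _ R] l Sub.prems by simp
  qed
next
  case (Load x y r m)
  show ?case
  proof (rule relocatesI[where s = 0])
    fix b and zs :: "nat list" and B T u \<mu>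
    assume l: "length zs = b" and m: "\<And>a. \<mu> (B + a) = snd (r, m) a"
    let ?s = "zs @ reloc_regs R B T u r"
    have 1: "run (Add (b + 4 + R) b (b + 4 + y)) (?s, \<mu>) 1 (?s @ [B + r y], \<mu>)"
      using run_Add[of "b + 4 + R" ?s b "b + 4 + y" \<mu>] reloc_regs_nth(1)[of zs b _ R]
        reloc_regs_nth(2)[of zs b R B] l Load.prems by simp
    have "(?s @ [B + r y])[b + 4 + x := \<mu> ((?s @ [B + r y]) ! (b + 4 + R))] =
        (zs @ reloc_regs R B T u (r(x := m (r y)))) @ [B + r y]"
      using l Load.prems m reloc_regs_update[of zs b x R]
      by (simp add: nth_append list_update_append del: append_assoc)
    then have 2: "run (Load (b + 4 + x) (b + 4 + R)) (?s @ [B + r y], \<mu>) 1 (zs @ reloc_regs R B T u (r(x := m (r y))), \<mu>)"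
      using run_Load_update[of "b + 4 + R" "?s @ [B + r y]" "b + 4 + x" \<mu>] l by (auto intro: run_drop)
    from run_Seq[OF 1 run_Seq[OF 2 run_tick[OF l]]] m
    show "run (relocate b R (Load x y)) (zs @ reloc_regs R B T u (fst (r, m)), \<mu>) (4 * 1)
         (zs @ reloc_regs R B (T + 1) (u + 0) (fst (r(x := m (r y)), m)), overlay B (snd (r(x := m (r y)), m)) \<mu>)"
      by (auto simp: overlay_same elim: run_mono)
  qed simp
next
  case (Store x y r m)
  show ?case
  proof (rule relocatesI[where s = "r x"])
    fix b and zs :: "nat list" and B T u \<mu>
    assume l: "length zs = b" and m: "\<And>a. \<mu> (B + a) = snd (r, m) a"
    let ?s = "zs @ reloc_regs R B T u r"
    let ?\<mu> = "\<mu>(B + r x := r y)"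
    have 1: "run (Add (b + 4 + R) b (b + 4 + x)) (?s, \<mu>) 1 (?s @ [B + r x], \<mu>)"
      using run_Add[of "b + 4 + R" ?s b "b + 4 + x" \<mu>] reloc_regs_nth(1)[of zs b _ R]
        reloc_regs_nth(2)[of zs b R B] l Store.prems by simp
    have "(?s @ [B + r x]) ! (b + 4 + R) = B + r x" "(?s @ [B + r x]) ! (b + 4 + y) = r y"
      using l Store.prems reloc_regs_nth(1)[of zs b y R] by (simp_all add: nth_append)
    then have 2: "run (Store (b + 4 + R) (b + 4 + y)) (?s @ [B + r x], \<mu>) 1 (?s, ?\<mu>)"
      using run_Store[of "b + 4 + R" "?s @ [B + r x]" "b + 4 + y" \<mu>] l Store.prems by (auto intro: run_drop)
    have "?s[b + 2 := ?s ! (b + 2) + ?s ! (b + 4 + x)] = zs @ reloc_regs R B T (u + r x) r"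
      using l reloc_regs_nth(1)[of zs b x R] Store.prems
      by (simp add: reloc_regs_def nth_append list_update_append numeral_eq_Suc)
    then have 3: "run (Add (b + 2) (b + 2) (b + 4 + x)) (?s, ?\<mu>) 1 (zs @ reloc_regs R B T (u + r x) r, ?\<mu>)"
      using run_Add_update[of "b + 2" ?s "b + 4 + x" "b + 2" ?\<mu>] l Store.prems by simp
    from run_Seq[OF 1 run_Seq[OF 2 run_Seq[OF 3 run_tick[OF l]]]] m overlay_update[of \<mu> B m "r x" "r y"]
    show "run (relocate b R (Store x y)) (zs @ reloc_regs R B T u (fst (r, m)), \<mu>) (4 * 1)
         (zs @ reloc_regs R B (T + 1) (u + r x) (fst (r, m(r x := r y))), overlay B (snd (r, m(r x := r y))) \<mu>)"
      by (auto elim: run_mono)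
  qed (auto split: if_splits)
next
  case (Seq P \<sigma> t \<sigma>' Q t' \<sigma>'')
  then obtain s s' where s: "relocates R P \<sigma> t \<sigma>' s" "relocates R Q \<sigma>' t' \<sigma>'' s'" by auto
  show ?case
  proof (rule relocatesI[where s = "s + s'"])
    fix b and zs :: "nat list" and B T u \<mu>
    assume l: "length zs = b" and m: "\<And>a. \<mu> (B + a) = snd \<sigma> a"
    from run_Seq[OF relocatesD(2)[OF s(1) l] relocatesD(2)[OF s(2) l]] m
    show "run (relocate b R (Seq P Q)) (zs @ reloc_regs R B T u (fst \<sigma>), \<mu>) (4 * (t + t'))
         (zs @ reloc_regs R B (T + (t + t')) (u + (s + s')) (fst \<sigma>''), overlay B (snd \<sigma>'') \<mu>)"
      by (simp add: add.assoc)
  qed (metis relocatesD(1)[OF s(1)] relocatesD(1)[OF s(2)] add.commute trans_le_add1)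
next
  case (If_nonzero \<sigma> x P t \<sigma>' Q)
  then obtain s where s: "relocates R P \<sigma> t \<sigma>' s" by auto
  show ?case
  proof (rule relocatesI[OF relocatesD(1)[OF s]])
    fix b and zs :: "nat list" and B T u \<mu>
    assume l: "length zs = b" and m: "\<And>a. \<mu> (B + a) = snd \<sigma> a"
    have 2: "run (Seq (tick b) (relocate b R P)) (zs @ reloc_regs R B T u (fst \<sigma>), \<mu>) (1 + 4 * t)
         (zs @ reloc_regs R B (T + (1 + t)) (u + s) (fst \<sigma>'), overlay B (snd \<sigma>') \<mu>)"
      using run_Seq[OF run_tick[OF l] relocatesD(2)[OF s l]] m by auto
    show "run (relocate b R (IfNZ x P Q)) (zs @ reloc_regs R B T u (fst \<sigma>), \<mu>) (4 * (1 + t))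
         (zs @ reloc_regs R B (T + (1 + t)) (u + s) (fst \<sigma>'), overlay B (snd \<sigma>') \<mu>)"
      unfolding relocate.simps
      by (rule run_mono[OF run_IfNZ[OF _ 2]])
         (use If_nonzero l reloc_regs_nth(1)[of zs b x R] in auto)
  qed
next
  case (If_zero \<sigma> x Q t \<sigma>' P)
  then obtain s where s: "relocates R Q \<sigma> t \<sigma>' s" by auto
  show ?case
  proof (rule relocatesI[OF relocatesD(1)[OF s]])
    fix b and zs :: "nat list" and B T u \<mu>
    assume l: "length zs = b" and m: "\<And>a. \<mu> (B + a) = snd \<sigma> a"
    have 2: "run (Seq (tick b) (relocate b R Q)) (zs @ reloc_regs R B T u (fst \<sigma>), \<mu>) (1 + 4 * t)
         (zs @ reloc_regs R B (T + (1 + t)) (u + s) (fst \<sigma>'), overlay B (snd \<sigma>') \<mu>)"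
      using run_Seq[OF run_tick[OF l] relocatesD(2)[OF s l]] m by auto
    show "run (relocate b R (IfNZ x P Q)) (zs @ reloc_regs R B T u (fst \<sigma>), \<mu>) (4 * (1 + t))
         (zs @ reloc_regs R B (T + (1 + t)) (u + s) (fst \<sigma>'), overlay B (snd \<sigma>') \<mu>)"
      unfolding relocate.simps
      by (rule run_mono[OF run_IfNZ[OF _ _ 2]])
         (use If_zero l reloc_regs_nth(1)[of zs b x R] in auto)
  qed
next
  case (While_stop \<sigma> x P)
  obtain r m where \<sigma>: "\<sigma> = (r, m)" by (cases \<sigma>)
  show ?case unfolding \<sigma>
  proof (rule relocates_assign[OF relocate.simps(8)])
    fix b and zs :: "nat list" and B T u \<mu> assume l: "length zs = b"
    show "run (WhileNZ (b + 4 + x) (Seq (tick b) (relocate b R P)))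
        (zs @ reloc_regs R B T u r, \<mu>) 2 (zs @ reloc_regs R B T u r, \<mu>)"
      by (rule run_mono[OF run_WhileNZ_stop]) (use While_stop l reloc_regs_nth(1)[of zs b x R] \<sigma> in auto)
  qed
next
  case (While_step \<sigma> x P t \<sigma>' t' \<sigma>'')
  then obtain s s' where s: "relocates R P \<sigma> t \<sigma>' s" "relocates R (WhileNZ x P) \<sigma>' t' \<sigma>'' s'" by auto
  show ?case
  proof (rule relocatesI[where s = "s + s'"])
    fix b and zs :: "nat list" and B T u \<mu>
    assume l: "length zs = b" and m: "\<And>a. \<mu> (B + a) = snd \<sigma> a"
    have 3: "run (Seq (tick b) (relocate b R P)) (zs @ reloc_regs R B T u (fst \<sigma>), \<mu>) (1 + 4 * t)
         (zs @ reloc_regs R B (T + (1 + t)) (u + s) (fst \<sigma>'), overlay B (snd \<sigma>') \<mu>)"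
      using run_Seq[OF run_tick[OF l] relocatesD(2)[OF s(1) l]] m by auto
    have 4: "run (relocate b R (WhileNZ x P)) (zs @ reloc_regs R B (T + (1 + t)) (u + s) (fst \<sigma>'), overlay B (snd \<sigma>') \<mu>) (4 * t')
         (zs @ reloc_regs R B (T + (1 + t + t')) (u + (s + s')) (fst \<sigma>''), overlay B (snd \<sigma>'') \<mu>)"
      using relocatesD(2)[OF s(2) l, of "overlay B (snd \<sigma>') \<mu>" B "T + (1 + t)" "u + s"] by (simp add: add.assoc)
    show "run (relocate b R (WhileNZ x P)) (zs @ reloc_regs R B T u (fst \<sigma>), \<mu>) (4 * (1 + t + t'))
         (zs @ reloc_regs R B (T + (1 + t + t')) (u + (s + s')) (fst \<sigma>''), overlay B (snd \<sigma>'') \<mu>)"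
      unfolding relocate.simps
      by (rule run_mono[OF run_Seq_WhileNZ_step[OF _ _ 3 4[unfolded relocate.simps]]])
         (use While_step l reloc_regs_nth(1)[of zs b x R] in auto)
  qed (metis relocatesD(1)[OF s(1)] relocatesD(1)[OF s(2)] add.commute trans_le_add1)
qed

lemma run_zeros:
  "\<exists>P. \<forall>ws m. length ws = l \<longrightarrow> run P (ws, m) (R + 1) (ws @ replicate R 0, m)"
proof (induction R)
  case 0
  show ?case
    by (intro exI[of _ "Const l 0"] allI impI) (auto intro: run_drop[OF run_Const, simplified])
next
  case (Suc R)
  then obtain P where P [rule_format]: "\<forall>ws m. length ws = l \<longrightarrow> run P (ws, m) (R + 1) (ws @ replicate R 0, m)"
    by blast
  show ?case
  proof (intro exI[of _ "Seq P (Const (l + R) 0)"] allI impI)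
    fix ws :: "nat list" and m assume l: "length ws = l"
    from run_Seq[OF P[OF l] run_Const[of "l + R" _ 0]] l
    show "run (Seq P (Const (l + R) 0)) (ws, m) (Suc R + 1) (ws @ replicate (Suc R) 0, m)"
      by (simp add: replicate_append_same)
  qed
qed

lemma init_fst [simp]: "fst (init xs) = (\<lambda>_. 0)"
  by (simp add: init_def)

lemma run_reloc_setup:
  "\<exists>S. \<forall>zs B \<mu>. length zs = b \<longrightarrow>
     run S (zs @ [B], \<mu>) (R + 4) (zs @ reloc_regs R B 0 0 (\<lambda>_. 0), \<mu>)"
proof -
  from run_zeros[of "b + 4" R] obtain Z where Z [rule_format]:
    "\<forall>ws m. length ws = b + 4 \<longrightarrow> run Z (ws, m) (R + 1) (ws @ replicate R 0, m)" by blast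
  show ?thesis
  proof (rule exI[of _ "Seq (Const (b + 1) 0) (Seq (Const (b + 2) 0) (Seq (Const (b + 3) 1) Z))"],
    intro allI impI)
    fix zs :: "nat list" and B \<mu> assume l: "length zs = b"
    have 1: "run (Const (b + 1) 0) (zs @ [B], \<mu>) 1 (zs @ [B, 0], \<mu>)"
      using run_Const[of "b + 1" "zs @ [B]" 0 \<mu>] l by simp
    have 2: "run (Const (b + 2) 0) (zs @ [B, 0], \<mu>) 1 (zs @ [B, 0, 0], \<mu>)"
      using run_Const[of "b + 2" "zs @ [B, 0]" 0 \<mu>] l by simp
    have 3: "run (Const (b + 3) 1) (zs @ [B, 0, 0], \<mu>) 1 (zs @ [B, 0, 0, 1], \<mu>)"
      using run_Const[of "b + 3" "zs @ [B, 0, 0]" 1 \<mu>] l by simp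
    have eq: "map (\<lambda>_. 0) [0..<R] = replicate R (0 :: nat)"
      by (rule nth_equalityI) auto
    have 4: "run Z (zs @ [B, 0, 0, 1], \<mu>) (R + 1) (zs @ reloc_regs R B 0 0 (\<lambda>_. 0), \<mu>)"
      using Z[of "zs @ [B, 0, 0, 1]" \<mu>] l by (simp add: reloc_regs_def eq)
    show "run (Seq (Const (b + 1) 0) (Seq (Const (b + 2) 0) (Seq (Const (b + 3) 1) Z)))
       (zs @ [B], \<mu>) (R + 4) (zs @ reloc_regs R B 0 0 (\<lambda>_. 0), \<mu>)"
      by (rule run_mono[OF run_Seq[OF 1 run_Seq[OF 2 run_Seq[OF 3 4]]]]) simp
  qed
qed

section \<open>Computable functions as subroutines\<close>

text \<open>The memory from address \<open>B\<close> on serves as scratch space and is left empty.\<close>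

definition clean :: "(nat \<Rightarrow> nat) \<Rightarrow> (nat \<Rightarrow> nat) \<Rightarrow> bool" where
  "clean f T \<longleftrightarrow> (\<forall>b. \<exists>P. \<forall>zs B n m. length zs = b \<longrightarrow> (\<forall>a\<ge>B. m a = 0) \<longrightarrow>
     run P (zs @ [B, n], m) (T n) (zs @ [B, f n], m))"

lemma outputs_run:
  assumes "run P ([], snd (init xs)) T (v # ys, m)"
  shows "\<exists>t\<le>T. outputs P xs t v"
proof -
  have "init xs = (\<lambda>_. 0, snd (init xs))" by (simp add: init_def)
  moreover from assms obtain t r where "exec P (\<lambda>_. 0, snd (init xs)) t (r, m)" "t \<le> T" "holds (v # ys) r"
    unfolding run_def holds_def by fastforce
  ultimately show ?thesis unfolding outputs_def holds_def
    by (intro exI[of _ t]) (auto intro!: exI[of _ "(r, m)"])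
qed

text \<open>Register 0 offers the address 1, the first one behind the single input cell, as the
  scratch space that \<open>clean\<close> subroutines ask for.\<close>

lemma computableI:
  assumes "\<And>n. \<exists>T. run P ([1, n], snd (init [n])) T ([1, f n], snd (init [n]))"
  shows "computable f"
proof -
  show ?thesis unfolding computable_def
  proof (rule exI, rule allI)
    fix n
    let ?m = "snd (init [n])"
    have 1: "run (Const 0 0) ([], ?m) 1 ([0], ?m)"
      using run_Const[of 0 "[]" 0 ?m] by simp
    have 2: "run (Const 1 0) ([0], ?m) 1 ([0, 0], ?m)"
      using run_Const[of 1 "[0]" 0 ?m] by simp
    have 3: "run (Load 1 0) ([0, 0], ?m) 1 ([0, n], ?m)"
      using run_Load_update[of 0 "[0, 0]" 1 ?m] by (simp add: init_def)
    have 4: "run (Const 0 1) ([0, n], ?m) 1 ([1, n], ?m)"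
      using run_Const_update[of 0 1 "[0, n]" ?m] by simp
    from assms obtain T where 5: "run P ([1, n], ?m) T ([1, f n], ?m)" by blast
    have 6: "run (Const 2 0) ([1, f n], ?m) 1 ([1, f n, 0], ?m)"
      using run_Const[of 2 "[1, f n]" 0 ?m] by simp
    have 7: "run (Add 0 1 2) ([1, f n, 0], ?m) 1 ([f n, f n, 0], ?m)"
      using run_Add_update[of 1 "[1, f n, 0]" 2 0 ?m] by simp
    from outputs_run[OF run_Seq[OF 1 run_Seq[OF 2 run_Seq[OF 3 run_Seq[OF 4 run_Seq[OF 5 run_Seq[OF 6 7]]]]]]]
    show "\<exists>t. outputs (Seq (Const 0 0) (Seq (Const 1 0) (Seq (Load 1 0) (Seq (Const 0 1)
        (Seq P (Seq (Const 2 0) (Add 0 1 2))))))) [n] t (f n)"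
      by blast
  qed
qed

text \<open>Clears the cells from \<open>B + s\<close> down to \<open>B + 1\<close>, with the
  address sum as the countdown. The loop ends when this reaches 0, so cell \<open>B\<close> takes a
  \<open>Store\<close> of its own. Register \<open>b + 5\<close> supplies the 0.\<close>

definition wipe :: "nat \<Rightarrow> prog" where
  "wipe b = Seq (Add (b + 1) b (b + 2)) (Seq (WhileNZ (b + 2) (Seq (Store (b + 1) (b + 5))
        (Seq (Sub (b + 2) (b + 2) (b + 3)) (Add (b + 1) b (b + 2))))) (Store b (b + 5)))"

lemma run_wipe:
  assumes l: "length zs = b"
    and m1: "\<And>a. a < B \<Longrightarrow> \<mu> a = m a" "\<And>a. a > B + s \<Longrightarrow> \<mu> a = 0" and m: "\<forall>a\<ge>B. m a = 0"
  shows "run (wipe b)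
      (zs @ [B, t, s, 1, v, 0], \<mu>) (4 * s + 3) (zs @ [B, B, 0, 1, v, 0], m)"
proof -
  define mm where "mm i = (\<lambda>a. if a > B + (s - i) then 0 else \<mu> a)" for i
  define st where "st i = zs @ [B, B + (s - i), s - i, 1, v, 0]" for i
  have 1: "run (Add (b + 1) b (b + 2)) (zs @ [B, t, s, 1, v, 0], \<mu>) 1 (st 0, mm 0)"
  proof -
    have "mm 0 = \<mu>" using m1(2) by (auto simp: mm_def)
    with run_Add_update[of b "zs @ [B, t, s, 1, v, 0]" "b + 2" "b + 1" \<mu>] l
    show ?thesis by (simp add: st_def nth_append list_update_append numeral_eq_Suc)
  qed
  have body: "run (Seq (Store (b + 1) (b + 5)) (Seq (Sub (b + 2) (b + 2) (b + 3)) (Add (b + 1) b (b + 2))))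
      (st i, mm i) 3 (st (Suc i), mm (Suc i))" if "i < s" for i
  proof -
    have "(mm i)(B + (s - i) := 0) = mm (Suc i)"
      using that by (auto simp: mm_def fun_eq_iff)
    then have 1: "run (Store (b + 1) (b + 5)) (st i, mm i) 1 (st i, mm (Suc i))"
      using run_Store[of "b + 1" "st i" "b + 5" "mm i"] l
      by (simp add: st_def nth_append numeral_eq_Suc)
    have 2: "run (Sub (b + 2) (b + 2) (b + 3)) (st i, mm (Suc i)) 1 (zs @ [B, B + (s - i), s - Suc i, 1, v, 0], mm (Suc i))"
      using run_Sub_update[of "b + 2" "st i" "b + 3" "b + 2" "mm (Suc i)"] l
      by (simp add: st_def nth_append list_update_append numeral_eq_Suc)
    have 3: "run (Add (b + 1) b (b + 2)) (zs @ [B, B + (s - i), s - Suc i, 1, v, 0], mm (Suc i)) 1 (st (Suc i), mm (Suc i))"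
      using run_Add_update[of b "zs @ [B, B + (s - i), s - Suc i, 1, v, 0]" "b + 2" "b + 1" "mm (Suc i)"] l
      by (simp add: st_def nth_append list_update_append numeral_eq_Suc)
    show ?thesis by (rule run_mono[OF run_Seq[OF 1 run_Seq[OF 2 3]]]) simp
  qed
  have 2: "run (WhileNZ (b + 2) (Seq (Store (b + 1) (b + 5)) (Seq (Sub (b + 2) (b + 2) (b + 3)) (Add (b + 1) b (b + 2)))))
      (st 0, mm 0) ((\<Sum>i<s. 1 + 3) + 1) (st s, mm s)"
    by (rule run_WhileNZ) (use body in \<open>auto simp: st_def l nth_append\<close>)
  have "(mm s)(B := 0) = m"
    using m m1(1) by (auto simp: mm_def fun_eq_iff not_less_iff_gr_or_eq)
  then have 3: "run (Store b (b + 5)) (st s, mm s) 1 (st s, m)"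
    using run_Store[of b "st s" "b + 5" "mm s"] l
    by (simp add: st_def nth_append numeral_eq_Suc)
  have "run (wipe b)
      (zs @ [B, t, s, 1, v, 0], \<mu>) (4 * s + 3) (st s, m)"
    unfolding wipe_def by (rule run_mono[OF run_Seq[OF 1 run_Seq[OF 2 3]]]) simp
  then show ?thesis by (simp add: st_def)
qed

text \<open>The time consists of a multiple of the step count, plus the wiping, which takes time
  proportional to the address sum and may be exponential in the number of steps. This is acceptable
  in a function of the parameter, provided that it is computable; and it is, since the instrumented
  program leaves both numbers in its registers.\<close>

lemma computable_clean:
  assumes "computable f"
  shows "\<exists>T. computable T \<and> clean f T"
proof -
  from assms obtain P where "\<forall>n. \<exists>t. outputs P [n] t (f n)"
    unfolding computable_def by blast
  then have "\<forall>n. \<exists>t \<sigma>. exec P (init [n]) t \<sigma> \<and> fst \<sigma> 0 = f n"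
    unfolding outputs_def by blast
  then obtain t \<sigma> where ex: "\<And>n. exec P (init [n]) (t n) (\<sigma> n)" and f: "\<And>n. fst (\<sigma> n) 0 = f n"
    by metis
  obtain R where R: "R > 0" "regs_below R P" using regs_below_exists by blast
  from run_relocate[OF ex R(2)] obtain s where rel: "\<And>n. relocates R P (init [n]) (t n) (\<sigma> n) (s n)"
    by metis
  note s = relocatesD(1)[OF rel] and run = relocatesD(2)[OF rel, unfolded init_fst]
  note prep = run_reloc_setup[of _ R]
  have drop: "reloc_regs R B T u r = [B, T, u, 1, r 0] @ map r [1..<R]" for B T u r
    using R(1) by (simp add: reloc_regs_def upt_rec)
  let ?T = "\<lambda>n. 4 * t n + 4 * s n + (R + 20)"
  have "clean f ?T"
    unfolding clean_def
  proof
    fix b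
    from prep obtain S where S [rule_format]:
      "\<forall>zs B \<mu>. length zs = b \<longrightarrow> run S (zs @ [B], \<mu>) (R + 4) (zs @ reloc_regs R B 0 0 (\<lambda>_. 0), \<mu>)"
      by blast
    let ?W = "wipe b"
    let ?P = "Seq (Store b (b + 1)) (Seq S (Seq (relocate b R P) (Seq (Const (b + 5) 0)
        (Seq ?W (Add (b + 1) (b + 4) (b + 5))))))"
    show "\<exists>P. \<forall>zs B n m. length zs = b \<longrightarrow> (\<forall>a\<ge>B. m a = 0) \<longrightarrow>
       run P (zs @ [B, n], m) (?T n) (zs @ [B, f n], m)"
    proof (intro exI[of _ ?P] allI impI)
      fix zs :: "nat list" and B n :: nat and m :: mem assume l: "length zs = b" and m: "\<forall>a\<ge>B. m a = 0"
      let ?m = "m(B := n)"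
      let ?\<mu> = "overlay B (snd (\<sigma> n)) ?m"
      have 1: "run (Store b (b + 1)) (zs @ [B, n], m) 1 (zs @ [B], ?m)"
        using run_Store[of b "zs @ [B, n]" "b + 1" m] run_drop[where ys = "zs @ [B]" and zs = "[n]"] l
        by (simp add: nth_append)
      have 2: "run (relocate b R P) (zs @ reloc_regs R B 0 0 (\<lambda>_. 0), ?m) (4 * t n)
         (zs @ [B, t n, s n, 1, f n], ?\<mu>)"
      proof (rule run_drop[where zs = "map (fst (\<sigma> n)) [1..<R]"])
        have "?m (B + a) = snd (init [n]) a" for a using m by (simp add: init_def)
        from run[OF l, where \<mu> = ?m, OF this, of 0 0]
        show "run (relocate b R P) (zs @ reloc_regs R B 0 0 (\<lambda>_. 0), ?m) (4 * t n)
         ((zs @ [B, t n, s n, 1, f n]) @ map (fst (\<sigma> n)) [1..<R], ?\<mu>)"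
          by (simp add: drop[of B "t n" "s n" "fst (\<sigma> n)"] f)
      qed
      have 3: "run (Const (b + 5) 0) (zs @ [B, t n, s n, 1, f n], ?\<mu>) 1 (zs @ [B, t n, s n, 1, f n, 0], ?\<mu>)"
        using run_Const[of "b + 5" "zs @ [B, t n, s n, 1, f n]" 0 ?\<mu>] l by simp
      have 4: "run ?W (zs @ [B, t n, s n, 1, f n, 0], ?\<mu>) (4 * s n + 3) (zs @ [B, B, 0, 1, f n, 0], m)"
      proof (rule run_wipe[OF l _ _ m])
        show "?\<mu> a = m a" if "a < B" for a using that by (simp add: overlay_def)
        \<comment> \<open>Such a cell was never changed, and of the program's memory only cell 0, at
          address \<open>B\<close>, was occupied at the start.\<close>
        show "?\<mu> a = 0" if "a > B + s n" for a
        proof -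
          from that have a: "\<not> a < B" "\<not> a - B \<le> s n" "a - B \<noteq> 0" by auto
          with s[of n "a - B"] have "snd (\<sigma> n) (a - B) = snd (init [n]) (a - B)" by blast
          with a show ?thesis by (simp add: overlay_def init_def)
        qed
      qed
      have 5: "run (Add (b + 1) (b + 4) (b + 5)) (zs @ [B, B, 0, 1, f n, 0], m) 1 (zs @ [B, f n], m)"
        using run_Add_update[of "b + 4" "zs @ [B, B, 0, 1, f n, 0]" "b + 5" "b + 1" m] l
          run_drop[where ys = "zs @ [B, f n]" and zs = "[0, 1, f n, 0]"]
        by (simp add: nth_append list_update_append numeral_eq_Suc)
      show "run ?P (zs @ [B, n], m) (?T n) (zs @ [B, f n], m)"
        by (rule run_mono[OF run_Seq[OF 1 run_Seq[OF S[OF l] run_Seq[OF 2 run_Seq[OF 3 run_Seq[OF 4 5]]]]]]) simp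
    qed
  qed
  \<comment> \<open>Now the offset is 0: the relocated program works directly on the input, and
    \<open>?T\<close> is evaluated from the counters it leaves behind.\<close>
  moreover have "computable ?T"
  proof -
    from prep obtain S where S [rule_format]:
      "\<forall>zs B \<mu>. length zs = 1 \<longrightarrow> run S (zs @ [B], \<mu>) (R + 4) (zs @ reloc_regs R B 0 0 (\<lambda>_. 0), \<mu>)"
      by blast
    have "feasible False 5 (\<lambda>m xs. 4 * xs ! 2 + 4 * xs ! 3 + (R + 20))"
      by (intro feasible_add feasible_mult feasible_nth feasible_const) simp_all
    then obtain C where "computes 5 (\<lambda>m xs. 4 * xs ! 2 + 4 * xs ! 3 + (R + 20)) C"
      unfolding feasible_def by blast
    from computesD[OF this, of 0] obtain Q where Q [unfolded pushes_def]: "pushes 0 5 Q (\<lambda>m xs. 4 * xs ! 2 + 4 * xs ! 3 + (R + 20)) C" by blast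
    let ?P = "Seq (Const 0 0) (Seq (Const 1 0) (Seq S (Seq (relocate 1 R P) (Seq Q (Seq (Const 6 0) (Add 0 5 6))))))"
    have "\<exists>t. outputs ?P [n] t (?T n)" for n
    proof -
      let ?m = "snd (init [n])" and ?\<mu> = "overlay 0 (snd (\<sigma> n)) (snd (init [n]))"
      have 1: "run (Const 0 0) ([], ?m) 1 ([0], ?m)"
        using run_Const[of 0 "[]" 0 ?m] by simp
      have 2: "run (Const 1 0) ([0], ?m) 1 ([0, 0], ?m)"
        using run_Const[of 1 "[0]" 0 ?m] by simp
      have 3: "run S ([0, 0], ?m) (R + 4) ([0] @ reloc_regs R 0 0 0 (\<lambda>_. 0), ?m)"
        using S[of "[0]" 0 ?m] by simp
      have 4: "run (relocate 1 R P) ([0] @ reloc_regs R 0 0 0 (\<lambda>_. 0), ?m) (4 * t n) ([0, 0, t n, s n, 1], ?\<mu>)"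
      proof (rule run_drop[where zs = "fst (\<sigma> n) 0 # map (fst (\<sigma> n)) [1..<R]"])
        from run[of "[0]" 1 ?m 0 n 0 0]
        show "run (relocate 1 R P) ([0] @ reloc_regs R 0 0 0 (\<lambda>_. 0), ?m) (4 * t n)
          ([0, 0, t n, s n, 1] @ fst (\<sigma> n) 0 # map (fst (\<sigma> n)) [1..<R], ?\<mu>)"
          by (simp add: drop[of 0 "t n" "s n" "fst (\<sigma> n)"])
      qed
      let ?L = "[0, 0, t n, s n, 1, ?T n]"
      have 5: "run Q ([0, 0, t n, s n, 1], ?\<mu>) (C ?\<mu> [0, 0, t n, s n, 1]) (?L, ?\<mu>)"
        using Q[rule_format, of "[]" "[0, 0, t n, s n, 1]" ?\<mu>] by (simp add: numeral_eq_Suc)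
      have 6: "run (Const 6 0) (?L, ?\<mu>) 1 (?L @ [0], ?\<mu>)"
        using run_Const[of 6 ?L 0 ?\<mu>] by simp
      have 7: "run (Add 0 5 6) (?L @ [0], ?\<mu>) 1 (?T n # tl ?L @ [0], ?\<mu>)"
        using run_Add_update[of 5 "?L @ [0]" 6 0 ?\<mu>] by (simp add: numeral_eq_Suc)
      from outputs_run[OF run_Seq[OF 1 run_Seq[OF 2 run_Seq[OF 3 run_Seq[OF 4 run_Seq[OF 5 run_Seq[OF 6 7]]]]]]]
      show ?thesis by blast
    qed
    then show ?thesis unfolding computable_def by blast
  qed
  ultimately show ?thesis by blast
qed

lemma clean_run_append:
  assumes "clean f T" "i < a" "j < a"
  shows "\<exists>P. \<forall>xs m. length xs = a \<longrightarrow> (\<forall>x\<ge>xs ! i. m x = 0) \<longrightarrow>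
    run P (xs, m) (T (xs ! j) + 7) (xs @ [f (xs ! j)], m)"
proof -
  from run_copy[of "[i, j]" a] assms obtain P1 where P1 [rule_format]:
    "\<forall>ws m. length ws = a \<longrightarrow> run P1 (ws, m) 5 (ws @ [ws ! i, ws ! j], m)" by auto
  from assms(1) obtain P2 where P2 [rule_format]: "\<forall>zs B n m. length zs = a \<longrightarrow> (\<forall>a\<ge>B. m a = 0) \<longrightarrow>
     run P2 (zs @ [B, n], m) (T n) (zs @ [B, f n], m)"
    unfolding clean_def by blast
  from run_move[of a 1] obtain P3 where P3 [rule_format]:
    "\<forall>ws us v m. length ws = a \<longrightarrow> length us = 1 \<longrightarrow> run P3 (ws @ us @ [v], m) 2 (ws @ [v], m)"
    by blast
  show ?thesis
  proof (intro exI[of _ "Seq P1 (Seq P2 P3)"] allI impI)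
    fix xs :: "nat list" and m :: mem assume l: "length xs = a" and m: "\<forall>x\<ge>xs ! i. m x = 0"
    from P3[OF l, of "[xs ! i]" "f (xs ! j)" m]
    have 3: "run P3 (xs @ [xs ! i, f (xs ! j)], m) 2 (xs @ [f (xs ! j)], m)" by simp
    have 2: "run P2 (xs @ [xs ! i, xs ! j], m) (T (xs ! j)) (xs @ [xs ! i, f (xs ! j)], m)"
      by (rule P2[OF l]) (use m in blast)
    show "run (Seq P1 (Seq P2 P3)) (xs, m) (T (xs ! j) + 7) (xs @ [f (xs ! j)], m)"
      by (rule run_mono[OF run_Seq[OF P1[OF l] run_Seq[OF 2 3]]]) simp
  qed
qed

section \<open>Closure properties of the computable functions\<close>

lemma computable_feasible2:
  assumes "computable f" "computable g" "feasible False 2 (\<lambda>m xs. h (xs ! 0) (xs ! 1))"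
  shows "computable (\<lambda>n. h (f n) (g n))"
proof -
  from computable_clean[OF assms(1)] obtain Tf where Tf: "clean f Tf" by blast
  from computable_clean[OF assms(2)] obtain Tg where Tg: "clean g Tg" by blast
  from assms(3) obtain C where C: "computes 2 (\<lambda>m xs. h (xs ! 0) (xs ! 1)) C"
    unfolding feasible_def by blast
  from clean_run_append[OF Tf, where i = 0 and a = 2 and j = 1] obtain P1 where P1: "\<forall>xs m. length xs = 2 \<longrightarrow> (\<forall>x\<ge>xs ! 0. m x = 0) \<longrightarrow>
    run P1 (xs, m) (Tf (xs ! 1) + 7) (xs @ [f (xs ! 1)], m)" by auto
  from clean_run_append[OF Tg, where i = 0 and a = 3 and j = 1] obtain P2 where P2: "\<forall>xs m. length xs = 3 \<longrightarrow> (\<forall>x\<ge>xs ! 0. m x = 0) \<longrightarrow>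
    run P2 (xs, m) (Tg (xs ! 1) + 7) (xs @ [g (xs ! 1)], m)" by auto
  from computesD[OF C, of 2] obtain P3 where P3 [unfolded pushes_def]: "pushes 2 2 P3 (\<lambda>m xs. h (xs ! 0) (xs ! 1)) C" by blast
  from run_move[of 1 3] obtain P4 where P4: "\<forall>ws us v m. length ws = 1 \<longrightarrow> length us = 3 \<longrightarrow>
     run P4 (ws @ us @ [v], m) 2 (ws @ [v], m)" by blast
  show ?thesis
  proof (rule computableI[where P = "Seq P1 (Seq P2 (Seq P3 P4))"])
    fix n
    let ?m = "snd (init [n])"
    have m: "\<forall>x\<ge>1. ?m x = 0" by (simp add: init_def)
    have 1: "run P1 ([1, n], ?m) (Tf n + 7) ([1, n, f n], ?m)"
      using P1[rule_format, of "[1, n]" ?m] m by simp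
    have 2: "run P2 ([1, n, f n], ?m) (Tg n + 7) ([1, n, f n, g n], ?m)"
      using P2[rule_format, of "[1, n, f n]" ?m] m by simp
    have 3: "run P3 ([1, n, f n, g n], ?m) (C ?m [f n, g n]) ([1, n, f n, g n, h (f n) (g n)], ?m)"
      using P3[rule_format, of "[1, n]" "[f n, g n]" ?m] by simp
    have 4: "run P4 ([1, n, f n, g n, h (f n) (g n)], ?m) 2 ([1, h (f n) (g n)], ?m)"
      using P4[rule_format, of "[1]" "[n, f n, g n]" "h (f n) (g n)" ?m] by simp
    from run_Seq[OF 1 run_Seq[OF 2 run_Seq[OF 3 4]]]
    show "\<exists>T. run (Seq P1 (Seq P2 (Seq P3 P4))) ([1, n], ?m) T ([1, h (f n) (g n)], ?m)" by blast
  qed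
qed

lemma computable_id: "computable (\<lambda>n. n)"
  by (rule computableI[where P = "Const 2 0"])
     (use run_drop[where ys = "[1, _]" and zs = "[0]"] run_Const[of 2 "[1, _]" 0] in fastforce)

lemma computable_const: "computable (\<lambda>n. c)"
  using computable_feasible2[OF computable_id computable_id, of "\<lambda>_ _. c"] feasible_const by simp

lemma computable_add: "computable f \<Longrightarrow> computable g \<Longrightarrow> computable (\<lambda>n. f n + g n)"
  by (rule computable_feasible2[where h = "(+)"]) (assumption+, intro feasible_add feasible_nth, simp_all)

lemma computable_mult: "computable f \<Longrightarrow> computable g \<Longrightarrow> computable (\<lambda>n. f n * g n)"
  by (rule computable_feasible2[where h = "(*)"]) (assumption+, intro feasible_mult feasible_nth, simp_all)

lemma computable_power: "computable f \<Longrightarrow> computable g \<Longrightarrow> computable (\<lambda>n. f n ^ g n)"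
  by (rule computable_feasible2[where h = "(^)"]) (assumption+, intro feasible_power feasible_nth, simp_all)

lemma computable_comp:
  assumes "computable f" "computable g"
  shows "computable (\<lambda>n. f (g n))"
proof -
  from computable_clean[OF assms(1)] obtain Tf where "clean f Tf" by blast
  then obtain P where P: "\<forall>zs B n m. length zs = 0 \<longrightarrow> (\<forall>a\<ge>B. m a = 0) \<longrightarrow>
    run P (zs @ [B, n], m) (Tf n) (zs @ [B, f n], m)" unfolding clean_def by blast
  from computable_clean[OF assms(2)] obtain Tg where "clean g Tg" by blast
  then obtain Q where Q: "\<forall>zs B n m. length zs = 0 \<longrightarrow> (\<forall>a\<ge>B. m a = 0) \<longrightarrow>
    run Q (zs @ [B, n], m) (Tg n) (zs @ [B, g n], m)" unfolding clean_def by blast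
  show ?thesis
  proof (rule computableI[where P = "Seq Q P"])
    fix n
    let ?m = "snd (init [n])"
    have "\<forall>x\<ge>1. ?m x = 0" by (simp add: init_def)
    with run_Seq[of Q "([1, n], ?m)" "Tg n" "([1, g n], ?m)" P "Tf (g n)" "([1, f (g n)], ?m)"]
      P[rule_format, of "[]" 1 ?m "g n"] Q[rule_format, of "[]" 1 ?m n]
    show "\<exists>T. run (Seq Q P) ([1, n], ?m) T ([1, f (g n)], ?m)" by auto
  qed
qed

text \<open>\<open>\<epsilon>\<close> need not be monotone, so unboundedness has to be turned into a
  large value at an index that is at least \<open>d\<close>. From there a linear search
  succeeds.\<close>

lemma computable_search:
  assumes "computable \<epsilon>" and unb: "\<forall>b. \<exists>k. \<epsilon> k > b"
  shows "\<exists>\<kappa>. computable \<kappa> \<and> (\<forall>d. \<kappa> d \<ge> d \<and> \<epsilon> (\<kappa> d) > d)"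
proof -
  have ex: "\<exists>i. \<epsilon> (d + i) > d" for d
  proof -
    \<comment> \<open>A value above the sum of all values before \<open>d\<close> cannot be attained
      before \<open>d\<close>.\<close>
    obtain k where k: "\<epsilon> k > d + (\<Sum>j<d. \<epsilon> j)" using unb by blast
    have "d \<le> k"
    proof (rule ccontr)
      assume "\<not> d \<le> k"
      then have "\<epsilon> k \<le> (\<Sum>j<d. \<epsilon> j)" by (intro member_le_sum) auto
      with k show False by simp
    qed
    with k show ?thesis by (intro exI[of _ "k - d"]) auto
  qed
  define N where "N d = (LEAST i. \<epsilon> (d + i) > d)" for d
  have N: "\<epsilon> (d + N d) > d" for d unfolding N_def by (rule LeastI_ex[OF ex])
  have N_min: "\<epsilon> (d + i) \<le> d" if "i < N d" for d i
    using not_less_Least[OF that[unfolded N_def]] by simp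
  from computable_clean[OF assms(1)] obtain T where T: "clean \<epsilon> T" by blast
  from clean_run_append[OF T, where i = 0 and a = 5 and j = 2] obtain P where P: "\<forall>xs m. length xs = 5 \<longrightarrow> (\<forall>x\<ge>xs ! 0. m x = 0) \<longrightarrow>
    run P (xs, m) (T (xs ! 2) + 7) (xs @ [\<epsilon> (xs ! 2)], m)" by auto
  let ?B = "Seq P (Seq (Add 3 1 4) (Seq (Sub 3 3 5) (Add 2 2 4)))"
  let ?P = "Seq (Const 2 0) (Seq (Add 2 1 2) (Seq (Const 3 1) (Seq (Const 4 1) (Seq (WhileNZ 3 ?B) (Sub 1 2 4)))))"
  have "computable (\<lambda>d. d + N d)"
  proof (rule computableI[where P = ?P])
    fix d
    let ?m = "snd (init [d])"
    have m: "\<forall>x\<ge>1. ?m x = 0" by (simp add: init_def)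
    \<comment> \<open>The loop flag: by truncated subtraction it is nonzero exactly if the candidate
      just tested has a value at most \<open>d\<close>. The initial 1 forces the first
      round.\<close>
    define fl where "fl i = (if i = 0 then 1 else Suc d - \<epsilon> (d + i - 1))" for i
    define st where "st i = [1, d, d + i, fl i, 1]" for i
    have 1: "run (Const 2 0) ([1, d], ?m) 1 ([1, d, 0], ?m)"
      using run_Const[of 2 "[1, d]" 0 ?m] by simp
    have 2: "run (Add 2 1 2) ([1, d, 0], ?m) 1 ([1, d, d], ?m)"
      using run_Add_update[of 1 "[1, d, 0]" 2 2 ?m] by simp
    have 3: "run (Const 3 1) ([1, d, d], ?m) 1 ([1, d, d, 1], ?m)"
      using run_Const[of 3 "[1, d, d]" 1 ?m] by simp
    have 4: "run (Const 4 1) ([1, d, d, 1], ?m) 1 (st 0, ?m)"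
      using run_Const[of 4 "[1, d, d, 1]" 1 ?m] by (simp add: st_def fl_def)
    have body: "run ?B (st i, ?m) (T (d + i) + 10) (st (Suc i), ?m)" for i
    proof -
      let ?x = "\<epsilon> (d + i)"
      have 1: "run P (st i, ?m) (T (d + i) + 7) ([1, d, d + i, fl i, 1, ?x], ?m)"
        using P[rule_format, of "st i" ?m] m by (simp add: st_def)
      have 2: "run (Add 3 1 4) ([1, d, d + i, fl i, 1, ?x], ?m) 1 ([1, d, d + i, Suc d, 1, ?x], ?m)"
        using run_Add_update[of 1 "[1, d, d + i, fl i, 1, ?x]" 4 3 ?m] by (simp add: numeral_eq_Suc)
      have 3: "run (Sub 3 3 5) ([1, d, d + i, Suc d, 1, ?x], ?m) 1 ([1, d, d + i, fl (Suc i), 1, ?x], ?m)"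
        using run_Sub_update[of 3 "[1, d, d + i, Suc d, 1, ?x]" 5 3 ?m] by (simp add: numeral_eq_Suc fl_def)
      have 4: "run (Add 2 2 4) ([1, d, d + i, fl (Suc i), 1, ?x], ?m) 1 (st (Suc i), ?m)"
        using run_Add_update[of 2 "[1, d, d + i, fl (Suc i), 1, ?x]" 4 2 ?m]
          run_drop[where ys = "st (Suc i)" and zs = "[?x]"] by (simp add: numeral_eq_Suc st_def)
      show ?thesis by (rule run_mono[OF run_Seq[OF 1 run_Seq[OF 2 run_Seq[OF 3 4]]]]) simp
    qed
    have 5: "run (WhileNZ 3 ?B) (st 0, ?m) ((\<Sum>i<Suc (N d). 1 + (T (d + i) + 10)) + 1) (st (Suc (N d)), ?m)"
    proof (rule run_WhileNZ[where m = "\<lambda>_. ?m"])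
      show "st i ! 3 \<noteq> 0" if "i < Suc (N d)" for i
        using that N_min[of "i - 1" d] by (cases i) (simp_all add: st_def fl_def)
      show "st (Suc (N d)) ! 3 = 0"
        using N[of d] by (simp add: st_def fl_def)
    qed (use body in \<open>simp_all add: st_def\<close>)
    \<comment> \<open>The candidate is advanced also in the successful round, so 1 is
      subtracted.\<close>
    have 6: "run (Sub 1 2 4) (st (Suc (N d)), ?m) 1 ([1, d + N d], ?m)"
      using run_Sub_update[of 2 "st (Suc (N d))" 4 1 ?m]
        run_drop[where ys = "[1, d + N d]" and zs = "[Suc (d + N d), fl (Suc (N d)), 1]"]
      by (simp add: numeral_eq_Suc st_def)
    from run_Seq[OF 1 run_Seq[OF 2 run_Seq[OF 3 run_Seq[OF 4 run_Seq[OF 5 6]]]]]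
    show "\<exists>T. run ?P ([1, d], ?m) T ([1, d + N d], ?m)" by blast
  qed
  then show ?thesis using N by (intro exI[of _ "\<lambda>d. d + N d"]) auto
qed

section \<open>Encodings\<close>

lemma length_concat_rows:
  "length (concat (map (\<lambda>i. map (f i) js) [0..<p])) = p * length js"
  by (induction p) auto

lemma nth_concat_rows:
  "i < p \<Longrightarrow> j < length js \<Longrightarrow> concat (map (\<lambda>i. map (f i) js) [0..<p]) ! (i * length js + j) = f i (js ! j)"
proof (induction p)
  case (Suc p)
  show ?case
  proof (cases "i < p")
    case True
    have "i * length js + j < Suc i * length js" using Suc.prems by simp
    also have "\<dots> \<le> p * length js" using True by (intro mult_right_mono) auto
    finally show ?thesis using Suc.IH[OF True Suc.prems(2)]
      by (simp add: nth_append length_concat_rows)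
  next
    case False
    with Suc.prems have "i = p" by simp
    with Suc.prems show ?thesis by (simp add: nth_append length_concat_rows)
  qed
qed simp

lemma init_encode_clique:
  fixes k n :: nat and E :: "(nat \<times> nat) set"
  defines "m \<equiv> snd (init (encode_clique k n E))"
  shows "m 0 = k" "m 1 = n" "a < n \<Longrightarrow> b < n \<Longrightarrow> m (2 + a * n + b) = of_bool ((a, b) \<in> E)"
    "x \<ge> 2 + n * n \<Longrightarrow> m x = 0" "m x \<le> k + n + 1"
proof -
  let ?L = "concat (map (\<lambda>i. map (\<lambda>j. of_bool ((i, j) \<in> E)) [0..<n]) [0..<n]) :: nat list"
  have enc: "encode_clique k n E = k # n # ?L" by (simp add: encode_clique_def)
  have len: "length ?L = n * n"
    using length_concat_rows[of "\<lambda>i j. of_bool ((i, j) \<in> E)" "[0..<n]" n] by simp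
  show "m 0 = k" "m 1 = n" by (simp_all add: m_def init_def enc)
  show "x \<ge> 2 + n * n \<Longrightarrow> m x = 0" by (simp add: m_def init_def enc len)
  show "a < n \<Longrightarrow> b < n \<Longrightarrow> m (2 + a * n + b) = of_bool ((a, b) \<in> E)"
  proof -
    assume ab: "a < n" "b < n"
    have "a * n + b < Suc a * n" using ab by simp
    also have "\<dots> \<le> n * n" using ab by (intro mult_right_mono) auto
    finally show ?thesis
      using nth_concat_rows[of a n b "[0..<n]" "\<lambda>i j. of_bool ((i, j) \<in> E) :: nat"] ab
      by (simp add: m_def init_def enc len)
  qed
  have "y \<le> k + n + 1" if "y \<in> set (k # n # ?L)" for y
    using that by (auto simp: of_bool_def)
  then have "(k # n # ?L) ! x \<le> k + n + 1" if "x < length (k # n # ?L)" using that nth_mem by blast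
  then show "m x \<le> k + n + 1" unfolding m_def init_def enc by (simp only: snd_conv split: if_splits) simp
qed

text \<open>Written with a single index, split by \<open>div\<close> and \<open>mod\<close>, the
  matrix can be produced by one loop instead of two nested ones.\<close>

lemma encode_set_cover_gap_edges:
  "encode_set_cover kk p q (gap_edges p q B) =
     [kk, p, q] @ map (\<lambda>i. of_bool (B (i div q) (i mod q))) [0..<p * q]"
proof -
  let ?E = "gap_edges p q B"
  let ?f = "\<lambda>i j. of_bool ((i, j) \<in> ?E) :: nat"
  let ?L = "concat (map (\<lambda>i. map (?f i) [p..<p + q]) [0..<p])"
  have len: "length ?L = p * q"
    using length_concat_rows[of ?f "[p..<p + q]" p] by simp
  have "?L = map (\<lambda>i. of_bool (B (i div q) (i mod q))) [0..<p * q]"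
  proof (rule nth_equalityI)
    show "length ?L = length (map (\<lambda>i. of_bool (B (i div q) (i mod q))) [0..<p * q])"
      using len by simp
    fix i assume "i < length ?L"
    then have i: "i < p * q" using len by simp
    then have q: "q > 0" by (cases q) auto
    have ij: "i div q < p" "i mod q < q" using i q by (auto simp: less_mult_imp_div_less)
    have "?L ! i = ?f (i div q) (p + i mod q)"
      using nth_concat_rows[of "i div q" p "i mod q" "[p..<p + q]" ?f] ij by simp
    also have "\<dots> = of_bool (B (i div q) (i mod q))" using ij by (simp add: gap_edges_def)
    finally show "?L ! i = map (\<lambda>i. of_bool (B (i div q) (i mod q))) [0..<p * q] ! i" using i by simp
  qed
  then show ?thesis by (simp add: encode_set_cover_def)
qed

section \<open>The reduction as a program\<close>

text \<open>The range checks keep all reads inside the input matrix, so that the graph does not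
  change while the instance is written behind it.\<close>

definition graph_mem :: "mem \<Rightarrow> nat \<Rightarrow> nat \<Rightarrow> nat \<Rightarrow> bool" where
  "graph_mem m n a b \<longleftrightarrow> a < n \<and> b < n \<and> m (2 + a * n + b) \<noteq> 0"

lemma feasible_digit:
  assumes "feasible p a F" "feasible p a G" "feasible p a H"
  shows "feasible p a (\<lambda>m xs. digit (F m xs) (G m xs) (H m xs))"
proof -
  \<comment> \<open>Divisors above \<open>x\<close> all give 0, so the power may be capped at
    \<open>x + 1\<close> and stays polynomially bounded.\<close>
  have "x div min (b ^ i) (x + 1) = x div b ^ i" for x b i :: nat
    by (auto simp: min_def)
  moreover have "feasible p a (\<lambda>m xs. H m xs div min (F m xs ^ G m xs) (H m xs + 1) mod F m xs)"
    by (intro feasible_mod feasible_div feasible_capped_power feasible_add feasible_const assms)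
  ultimately show ?thesis by (simp add: digit_def)
qed

lemma decidable_base_cover:
  assumes "feasible p a K" "feasible p a N" "feasible p a M" "feasible p a Q" "feasible p a T" "feasible p a V" "feasible p a U"
  shows "decidable p a (\<lambda>m xs. base_cover (K m xs) (N m xs) (graph_mem m (N m xs)) (M m xs) (Q m xs) (T m xs) (V m xs) (U m xs))"
  unfolding base_cover_def graph_mem_def Suc_eq_plus1
  by (intro decidable_conj decidable_disj decidable_if decidable_not decidable_eq decidable_less feasible_If
      feasible_mod feasible_div feasible_add feasible_mult feasible_mem feasible_const assms)

lemma decidable_cell:
  assumes "list_all (\<lambda>i. i < a) [ik, inn, iM, iQ, ir, il, iw, iW, is, ie]"
  shows "decidable p a (\<lambda>m xs. cell (xs ! ik) (xs ! inn) (graph_mem m (xs ! inn)) (xs ! iM) (xs ! iQ) (xs ! ir)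
      (xs ! il) (xs ! iw) (xs ! iW) (xs ! is) (xs ! ie))"
  unfolding cell_def
proof (rule decidable_bex)
  show "feasible p a (\<lambda>m xs. xs ! il)" using assms by (simp add: feasible_nth)
  have *: "i < Suc a" if "i < a" for i using that by simp
  from assms show "decidable p (Suc a) (\<lambda>m ys. 
       digit (take a ys ! ir) (take a ys ! is div (take a ys ! iM * take a ys ! iM)) (ys ! a) =
       take a ys ! is mod (take a ys ! iM * take a ys ! iM) mod Suc (take a ys ! ie div take a ys ! iW div take a ys ! ir)
         mod Suc (take a ys ! ie div take a ys ! iW mod take a ys ! ir) \<and>
       base_cover (take a ys ! ik) (take a ys ! inn) (graph_mem m (take a ys ! inn)) (take a ys ! iM) (take a ys ! iQ)
         (take a ys ! is div (take a ys ! iM * take a ys ! iM)) (take a ys ! is mod (take a ys ! iM * take a ys ! iM))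
         (digit (take a ys ! iw) (ys ! a) (take a ys ! ie mod take a ys ! iW)))"
    unfolding Suc_eq_plus1[of "_ div _"] Suc_eq_plus1[of "_ mod _"]
    by (intro decidable_conj decidable_eq decidable_base_cover feasible_digit feasible_mod feasible_div feasible_mult
        feasible_add feasible_const; simp add: feasible_nth)
qed

section \<open>Straight-line programs and writing to memory\<close>

fun chain :: "nat \<Rightarrow> (mem \<Rightarrow> nat list \<Rightarrow> nat) list \<Rightarrow> bool" where
  "chain a [] = True"
| "chain a (F # Fs) = (feasible True a F \<and> chain (Suc a) Fs)"

fun extend :: "(mem \<Rightarrow> nat list \<Rightarrow> nat) list \<Rightarrow> mem \<Rightarrow> nat list \<Rightarrow> nat list" where
  "extend [] m xs = xs"
| "extend (F # Fs) m xs = extend Fs m (xs @ [F m xs])"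

lemma extend_prefix: "\<exists>ys. extend Fs m xs = xs @ ys"
  by (induction Fs arbitrary: xs) (auto, metis append.assoc)

lemma feasible_run:
  assumes "feasible True a F"
  shows "\<exists>P c. \<forall>xs m X. args_le a m xs X \<longrightarrow> run P (xs, m) ((X + 2) ^ c) (xs @ [F m xs], m)"
proof -
  from assms obtain C where C: "computes a F C" "poly_bounded a C" unfolding feasible_def by auto
  from C(2) obtain c where c: "\<forall>m xs X. args_le a m xs X \<longrightarrow> C m xs \<le> (X + 2) ^ c"
    unfolding poly_bounded_def by blast
  from computesD[OF C(1), of 0] obtain P where "pushes 0 a P F C" by blast
  then have "run P (xs, m) (C m xs) (xs @ [F m xs], m)" if "length xs = a" for xs m
    using that unfolding pushes_def by (metis append_Nil length_0_conv)
  with c have "\<forall>xs m X. args_le a m xs X \<longrightarrow> run P (xs, m) ((X + 2) ^ c) (xs @ [F m xs], m)"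
    by (metis args_le_def run_mono)
  then show ?thesis by blast
qed

text \<open>\<open>X\<close> bounds the final list, of which every intermediate list is a prefix.
  Thus each step is polynomial in the same \<open>X\<close>, and the exponents merely add
  up.\<close>

lemma chain_run:
  assumes "chain a Fs"
  shows "\<exists>P c. \<forall>xs m X. length xs = a \<longrightarrow> (\<forall>x\<in>set (extend Fs m xs). x \<le> X) \<longrightarrow> (\<forall>i. m i \<le> X) \<longrightarrow>
    run P (xs, m) ((X + 2) ^ c) (extend Fs m xs, m)"
  using assms
proof (induction Fs arbitrary: a)
  case Nil
  show ?case
  proof (intro exI[of _ "Const a 0"] exI[of _ 0] allI impI)
    fix xs :: "nat list" and m :: mem and X assume "length xs = a"
    then show "run (Const a 0) (xs, m) ((X + 2) ^ 0) (extend [] m xs, m)"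
      using run_drop[OF run_Const[of a xs 0 m]] by simp
  qed
next
  case (Cons F Fs)
  from Cons.prems feasible_run[of a F] obtain P c where P [rule_format]:
    "\<forall>xs m X. args_le a m xs X \<longrightarrow> run P (xs, m) ((X + 2) ^ c) (xs @ [F m xs], m)" by auto
  from Cons obtain P' c' where P' [rule_format]: "\<forall>xs m X. length xs = Suc a \<longrightarrow> (\<forall>x\<in>set (extend Fs m xs). x \<le> X) \<longrightarrow>
     (\<forall>i. m i \<le> X) \<longrightarrow> run P' (xs, m) ((X + 2) ^ c') (extend Fs m xs, m)" by force
  show ?case
  proof (intro exI[of _ "Seq P P'"] exI[of _ "c + c' + 1"] allI impI)
    fix xs :: "nat list" and m :: mem and X
    assume a: "length xs = a" and X: "\<forall>x\<in>set (extend (F # Fs) m xs). x \<le> X" and m: "\<forall>i. m i \<le> X"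
    obtain ys where ys: "extend Fs m (xs @ [F m xs]) = (xs @ [F m xs]) @ ys" using extend_prefix by blast
    have 1: "run P (xs, m) ((X + 2) ^ c) (xs @ [F m xs], m)"
      by (rule P) (use a X m ys in \<open>auto simp: args_le_def\<close>)
    have 2: "run P' (xs @ [F m xs], m) ((X + 2) ^ c') (extend (F # Fs) m xs, m)"
      using P'[of "xs @ [F m xs]" m X] a X m by simp
    show "run (Seq P P') (xs, m) ((X + 2) ^ (c + c' + 1)) (extend (F # Fs) m xs, m)"
      by (rule run_mono[OF run_Seq[OF 1 2] power_sum_le])
  qed
qed

lemma overlay_init_Nil: "(\<And>a. a \<ge> B \<Longrightarrow> m a = 0) \<Longrightarrow> overlay B (snd (init [])) m = m"
  by (rule ext) (simp add: overlay_def init_def)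

lemma overlay_init_snoc:
  "(overlay B (snd (init xs)) m)(B + length xs := v) = overlay B (snd (init (xs @ [v]))) m"
  by (rule ext) (auto simp: overlay_def init_def nth_append)

text \<open>\<open>F\<close> is evaluated on memory that already contains the cells written so far,
  hence the hypothesis about each partial state. It sees four loop registers on top: 1, the current
  address, the remaining count and the index.\<close>

lemma run_write_cells:
  assumes "feasible True (a + 4) F" "iB < a" "iN < a"
  shows "\<exists>P c. \<forall>xs m B hd f N X. length xs = a \<longrightarrow> xs ! iN = N \<longrightarrow> xs ! iB = B + length hd \<longrightarrow>
    (\<forall>i<N. F (overlay B (snd (init (hd @ map f [0..<i]))) m) (xs @ [1, B + length hd + i, N - i, i]) = f i) \<longrightarrow>
    (\<forall>x\<in>set xs. x \<le> X) \<longrightarrow> (\<forall>x\<in>set hd. x \<le> X) \<longrightarrow> (\<forall>i. m i \<le> X) \<longrightarrow> (\<forall>i<N. f i \<le> X) \<longrightarrow>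
    B + length hd + N + 1 \<le> X \<longrightarrow>
    run P (xs, overlay B (snd (init hd)) m) ((X + 2) ^ c) (xs, overlay B (snd (init (hd @ map f [0..<N]))) m)"
proof -
  from feasible_run[OF assms(1)] obtain P c where P [rule_format]:
    "\<forall>xs m X. args_le (a + 4) m xs X \<longrightarrow> run P (xs, m) ((X + 2) ^ c) (xs @ [F m xs], m)" by blast
  let ?B = "Seq P (Seq (Store (a + 1) (a + 4)) (Seq (Add (a + 1) (a + 1) a)
     (Seq (Sub (a + 2) (a + 2) a) (Add (a + 3) (a + 3) a))))"
  let ?I = "Seq (Const a 1) (Seq (Const (a + 1) 0) (Seq (Const (a + 2) 0) (Seq (Const (a + 3) 0)
     (Seq (Add (a + 1) iB (a + 3)) (Add (a + 2) iN (a + 3))))))"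
  show ?thesis
  proof (intro exI[of _ "Seq ?I (WhileNZ (a + 2) ?B)"] exI[of _ "c + 9"] allI impI)
    fix xs :: "nat list" and m :: mem and B :: nat and hd :: "nat list" and f :: "nat \<Rightarrow> nat" and N X :: nat
    assume a: "length xs = a" and N: "xs ! iN = N" and B: "xs ! iB = B + length hd"
      and F: "\<forall>i<N. F (overlay B (snd (init (hd @ map f [0..<i]))) m) (xs @ [1, B + length hd + i, N - i, i]) = f i"
      and X: "\<forall>x\<in>set xs. x \<le> X" "\<forall>x\<in>set hd. x \<le> X" "\<forall>i. m i \<le> X" "\<forall>i<N. f i \<le> X" "B + length hd + N + 1 \<le> X"
    define mm where "mm i = overlay B (snd (init (hd @ map f [0..<i]))) m" for i
    define st where "st i = xs @ [1, B + length hd + i, N - i, i]" for i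
    have mmX: "mm i x \<le> X" if "i \<le> N" for i x
      using that X nth_mem[of "x - B" "hd @ map f [0..<i]"] by (auto simp: mm_def overlay_def init_def)
    have body: "run ?B (st i, mm i) ((X + 2) ^ c + 4) (st (Suc i), mm (Suc i))" if i: "i < N" for i
    proof -
      have "F (mm i) (st i) = f i" using F i by (simp add: mm_def st_def)
      moreover have "args_le (a + 4) (mm i) (st i) X"
        using a X i mmX[of i] by (auto simp: args_le_def st_def)
      ultimately have 1: "run P (st i, mm i) ((X + 2) ^ c) (st i @ [f i], mm i)" using P by metis
      have "(mm i)(B + length hd + i := f i) = mm (Suc i)"
        using overlay_init_snoc[of B "hd @ map f [0..<i]" m "f i"] by (simp add: mm_def add.assoc)
      then have 2: "run (Store (a + 1) (a + 4)) (st i @ [f i], mm i) 1 (st i @ [f i], mm (Suc i))"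
        using run_Store[of "a + 1" "st i @ [f i]" "a + 4" "mm i"] a
        by (simp add: st_def nth_append numeral_eq_Suc)
      let ?l = "B + length hd"
      have 3: "run (Add (a + 1) (a + 1) a) (st i @ [f i], mm (Suc i)) 1 (xs @ [1, ?l + Suc i, N - i, i, f i], mm (Suc i))"
        using run_Add_update[of "a + 1" "st i @ [f i]" a "a + 1" "mm (Suc i)"] a
        by (simp add: st_def nth_append list_update_append numeral_eq_Suc)
      have 4: "run (Sub (a + 2) (a + 2) a) (xs @ [1, ?l + Suc i, N - i, i, f i], mm (Suc i)) 1
          (xs @ [1, ?l + Suc i, N - Suc i, i, f i], mm (Suc i))"
        using run_Sub_update[of "a + 2" "xs @ [1, ?l + Suc i, N - i, i, f i]" a "a + 2" "mm (Suc i)"] a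
        by (simp add: nth_append list_update_append numeral_eq_Suc)
      have 5: "run (Add (a + 3) (a + 3) a) (xs @ [1, ?l + Suc i, N - Suc i, i, f i], mm (Suc i)) 1
          (st (Suc i) @ [f i], mm (Suc i))"
        using run_Add_update[of "a + 3" "xs @ [1, ?l + Suc i, N - Suc i, i, f i]" a "a + 3" "mm (Suc i)"] a
        by (simp add: st_def nth_append list_update_append numeral_eq_Suc)
      show ?thesis
        by (rule run_mono[OF run_Seq[OF 1 run_Seq[OF 2 run_Seq[OF 3 run_Seq[OF 4 run_drop[OF 5]]]]]]) simp
    qed
    have loop: "run (WhileNZ (a + 2) ?B) (st 0, mm 0) ((\<Sum>i<N. 1 + ((X + 2) ^ c + 4)) + 1) (st N, mm N)"
      by (rule run_WhileNZ) (use body in \<open>auto simp: st_def a nth_append\<close>)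
    have 1: "run (Const a 1) (xs, mm 0) 1 (xs @ [1], mm 0)"
      using run_Const[of a xs 1 "mm 0"] a by simp
    have 2: "run (Const (a + 1) 0) (xs @ [1], mm 0) 1 (xs @ [1, 0], mm 0)"
      using run_Const[of "a + 1" "xs @ [1]" 0 "mm 0"] a by simp
    have 3: "run (Const (a + 2) 0) (xs @ [1, 0], mm 0) 1 (xs @ [1, 0, 0], mm 0)"
      using run_Const[of "a + 2" "xs @ [1, 0]" 0 "mm 0"] a by simp
    have 4: "run (Const (a + 3) 0) (xs @ [1, 0, 0], mm 0) 1 (xs @ [1, 0, 0, 0], mm 0)"
      using run_Const[of "a + 3" "xs @ [1, 0, 0]" 0 "mm 0"] a by simp
    have 5: "run (Add (a + 1) iB (a + 3)) (xs @ [1, 0, 0, 0], mm 0) 1 (xs @ [1, B + length hd, 0, 0], mm 0)"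
      using run_Add_update[of iB "xs @ [1, 0, 0, 0]" "a + 3" "a + 1" "mm 0"] a B assms(2)
      by (simp add: nth_append list_update_append numeral_eq_Suc)
    have 6: "run (Add (a + 2) iN (a + 3)) (xs @ [1, B + length hd, 0, 0], mm 0) 1 (st 0, mm 0)"
      using run_Add_update[of iN "xs @ [1, B + length hd, 0, 0]" "a + 3" "a + 2" "mm 0"] a N assms(3)
      by (simp add: nth_append list_update_append numeral_eq_Suc st_def)
    have I: "run ?I (xs, mm 0) 6 (st 0, mm 0)"
      by (rule run_mono[OF run_Seq[OF 1 run_Seq[OF 2 run_Seq[OF 3 run_Seq[OF 4 run_Seq[OF 5 6]]]]]]) simp
    have "run (Seq ?I (WhileNZ (a + 2) ?B)) (xs, mm 0) (6 + ((\<Sum>i<N. 1 + ((X + 2) ^ c + 4)) + 1)) (st N, mm N)"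
      by (rule run_Seq[OF I loop])
    then have "run (Seq ?I (WhileNZ (a + 2) ?B)) (xs, mm 0) (6 + ((\<Sum>i<N. 1 + ((X + 2) ^ c + 4)) + 1)) (xs, mm N)"
      unfolding st_def by (rule run_drop)
    moreover have "6 + ((\<Sum>i<N. 1 + ((X + 2) ^ c + 4)) + 1) \<le> (X + 2) ^ (c + 9)"
    proof -
      let ?Y = "(X + 2) ^ c"
      have Y: "1 \<le> ?Y" by simp
      have "6 + ((\<Sum>i<N. 1 + (?Y + 4)) + 1) = 7 + N * (?Y + 5)" by simp
      also have "\<dots> \<le> 7 * ?Y + N * (6 * ?Y)" using Y by (intro add_mono mult_left_mono) auto
      also have "\<dots> = (7 + 6 * N) * ?Y" by (simp add: algebra_simps)
      also have "\<dots> \<le> (8 * (X + 2)) * ?Y" using X(5) by (intro mult_right_mono) auto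
      also have "\<dots> \<le> ((X + 2) ^ 3 * (X + 2)) * ?Y"
        using power_mono[of 2 "X + 2" 3] by (intro mult_right_mono) auto
      also have "\<dots> = (X + 2) ^ (c + 4)" by (simp add: power_add algebra_simps eval_nat_numeral)
      also have "\<dots> \<le> (X + 2) ^ (c + 9)" by (rule power_increasing) auto
      finally show ?thesis .
    qed
    ultimately show "run (Seq ?I (WhileNZ (a + 2) ?B)) (xs, overlay B (snd (init hd)) m) ((X + 2) ^ (c + 9))
        (xs, overlay B (snd (init (hd @ map f [0..<N]))) m)"
      by (auto simp: mm_def elim: run_mono)
  qed
qed

text \<open>Registers 0 to 5 hold \<open>k\<close>, \<open>n\<close>, the address \<open>B\<close> of the new instance, its parameter \<open>\<kappa>\<close>, a lower bound
  \<open>H\<close> for \<open>h\<close>, and \<open>2^(H^D)\<close>. The powers are capped by bounds that they do not exceed.\<close>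

definition gap_params :: "(mem \<Rightarrow> nat list \<Rightarrow> nat) list" where
  "gap_params =
    [\<lambda>m xs. 6 * (xs ! 0 * xs ! 0) + 8,
     \<lambda>m xs. xs ! 4 + card {i. i < xs ! 1 \<and> \<not> xs ! 1 < min (2 ^ min ((xs ! 4 + i) ^ xs ! 6) (xs ! 1)) (xs ! 1 + 1)},
     \<lambda>m xs. min (2 ^ min (xs ! 7 ^ xs ! 6) ((xs ! 1 + 1) * (xs ! 1 + 1) * (xs ! 1 + 1) * xs ! 5))
       ((xs ! 1 + 1) * (xs ! 1 + 1) * (xs ! 1 + 1) * xs ! 5),
     \<lambda>m xs. min (xs ! 7 ^ (2 * xs ! 6)) (xs ! 8),
     \<lambda>m xs. min (xs ! 7 ^ 6) (xs ! 8),
     \<lambda>m xs. min (xs ! 10 ^ (xs ! 0 * xs ! 0)) (xs ! 8),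
     \<lambda>m xs. 2 * (xs ! 0 * xs ! 0) * xs ! 9 * xs ! 9,
     \<lambda>m xs. min (xs ! 12 ^ xs ! 11) (xs ! 8),
     \<lambda>m xs. xs ! 0 * xs ! 0 * (xs ! 8 * xs ! 8),
     \<lambda>m xs. xs ! 9 * xs ! 10 * xs ! 13,
     \<lambda>m xs. xs ! 2 + 3,
     \<lambda>m xs. xs ! 14 * xs ! 15,
     \<lambda>m xs. xs ! 2 + 1,
     \<lambda>m xs. xs ! 2 + 2]"

lemma chain_gap_params: "chain 6 gap_params"
proof -
  have "feasible True 7 (\<lambda>m xs. card {i. i < xs ! 1 \<and>
      \<not> xs ! 1 < min (2 ^ min ((xs ! 4 + i) ^ xs ! 6) (xs ! 1)) (xs ! 1 + 1)})"
  proof (rule feasible_count)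
    show "decidable True (Suc 7) (\<lambda>m ys. \<not> take 7 ys ! 1 <
        min (2 ^ min ((take 7 ys ! 4 + ys ! 7) ^ take 7 ys ! 6) (take 7 ys ! 1)) (take 7 ys ! 1 + 1))"
      by (intro decidable_not decidable_less feasible_capped_power feasible_add feasible_const; simp add: feasible_nth)
  qed (simp add: feasible_nth)
  then show ?thesis unfolding gap_params_def
    by (simp only: chain.simps, intro conjI TrueI)
       (intro feasible_capped_power feasible_add feasible_mult feasible_const; simp add: feasible_nth)+
qed

text \<open>Raising the base by one at most triples the exponent \<open>h ^ D\<close> and so at most
  cubes \<open>2 ^ h ^ D\<close>. The reason is
  \<open>(1 + 1 / a) ^ D \<le> exp (D / a) \<le> exp 1\<close>, which uses
  \<open>D \<le> a\<close>.\<close>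

lemma Suc_power_le:
  fixes a D :: nat
  assumes "a \<ge> D" "D > 0"
  shows "Suc a ^ D \<le> 3 * a ^ D"
proof -
  have a: "real a > 0" using assms by simp
  have "(1 + 1 / real a) ^ D \<le> exp (1 / real a) ^ D"
    using exp_ge_add_one_self[of "1 / real a"] a by (intro power_mono) (auto simp: add_nonneg_nonneg)
  also have "\<dots> = exp (real D / real a)" by (simp flip: exp_of_nat_mult)
  also have "\<dots> \<le> exp 1" using assms a by simp
  also have "\<dots> \<le> 3" by (rule exp_le)
  finally have "(1 + 1 / real a) ^ D * real a ^ D \<le> 3 * real a ^ D"
    by (rule mult_right_mono) simp
  moreover have "(1 + 1 / real a) ^ D * real a ^ D = real (Suc a ^ D)"
    using a by (simp add: power_mult_distrib[symmetric] algebra_simps)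
  ultimately have "real (Suc a ^ D) \<le> real (3 * a ^ D)" by simp
  then show ?thesis by (simp only: of_nat_le_iff)
qed

text \<open>As \<open>h\<close> exceeds \<open>H\<close> only if the predecessor of \<open>h\<close> is too small, \<open>2^(h^D)\<close> overshoots \<open>n\<close> at
  most polynomially.\<close>

lemma blowup:
  fixes n H D :: nat
  defines "h \<equiv> H + card {i. i < n \<and> 2 ^ (H + i) ^ D \<le> n}"
  assumes "H \<ge> D" "D > 0"
  shows "n < 2 ^ h ^ D" "2 ^ h ^ D \<le> (n + 1) * (n + 1) * (n + 1) * 2 ^ H ^ D"
proof -
  let ?S = "{i. i < n \<and> 2 ^ (H + i) ^ D \<le> n}"
  define c where "c = card ?S"
  have fin: "finite ?S" by simp
  have down: "j \<in> ?S" if "i \<in> ?S" "j \<le> i" for i j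
  proof -
    have "(H + j) ^ D \<le> (H + i) ^ D" using that by (intro power_mono) auto
    then have "2 ^ (H + j) ^ D \<le> (2 :: nat) ^ (H + i) ^ D" by (intro power_increasing) auto
    also have "\<dots> \<le> n" using that by simp
    finally show ?thesis using that by simp
  qed
  \<comment> \<open>The condition is inherited by smaller indices, so the cardinality is the first
    index, up to \<open>n\<close>, at which it fails.\<close>
  have S: "?S = {..<c}"
  proof -
    have "i < c" if "i \<in> ?S" for i
    proof -
      have "card {..i} \<le> c" unfolding c_def using down[OF that] by (intro card_mono[OF fin]) auto
      then show ?thesis by simp
    qed
    then have sub: "?S \<subseteq> {..<c}" by auto
    then show ?thesis by (intro card_subset_eq) (auto simp: c_def)
  qed
  have h: "h = H + c" by (simp add: h_def c_def)
  show "n < 2 ^ h ^ D"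
  proof (cases "c < n")
    case True
    have "c \<notin> ?S" unfolding S by simp
    with True show ?thesis unfolding h by auto
  next
    case False
    \<comment> \<open>If no index below \<open>n\<close> fails, then \<open>h\<close> itself is
      already at least \<open>n\<close>; the search range loses nothing.\<close>
    have "n \<le> h ^ 1" using False by (simp add: h)
    also have "\<dots> \<le> h ^ D" using assms by (intro power_increasing) (auto simp: h)
    finally show ?thesis by (rule le_less_trans) simp
  qed
  show "2 ^ h ^ D \<le> (n + 1) * (n + 1) * (n + 1) * 2 ^ H ^ D"
  proof (cases c)
    case 0
    then show ?thesis by (simp add: h)
  next
    case (Suc d)
    then have "d \<in> ?S" unfolding S by simp
    then have d: "2 ^ (H + d) ^ D \<le> n" by simp
    have "h ^ D \<le> 3 * (H + d) ^ D" using Suc_power_le[of D "H + d"] assms by (simp add: h Suc)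
    then have "2 ^ h ^ D \<le> (2 :: nat) ^ (3 * (H + d) ^ D)" by (intro power_increasing) auto
    also have "\<dots> = (2 ^ (H + d) ^ D) ^ 3" by (simp flip: power_mult add: mult.commute)
    also have "\<dots> \<le> (n + 1) ^ 3" using d by (intro power_mono) auto
    also have "\<dots> = (n + 1) * (n + 1) * (n + 1) * 1" by (simp only: power3_eq_cube mult_1_right)
    also have "\<dots> \<le> (n + 1) * (n + 1) * (n + 1) * 2 ^ H ^ D" by (intro mult_left_mono) auto
    finally show ?thesis .
  qed
qed

abbreviation instance_regs :: "nat \<Rightarrow> nat \<Rightarrow> nat \<Rightarrow> nat \<Rightarrow> nat \<Rightarrow> nat \<Rightarrow> nat \<Rightarrow> nat \<Rightarrow> nat \<Rightarrow> nat \<Rightarrow> nat \<Rightarrow> nat \<Rightarrow> nat \<Rightarrow> nat \<Rightarrow> nat \<Rightarrow> nat \<Rightarrow> nat list" where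
  "instance_regs k n B kk H G D h M Q r l w W p q \<equiv>
     [k, n, B, kk, H, G, D, h, M, Q, r, l, w, W, p, q, B + 3, p * q, B + 1, B + 2]"

lemma extend_Cons: "F m xs = v \<Longrightarrow> extend Fs m (xs @ [v]) = ys \<Longrightarrow> extend (F # Fs) m xs = ys"
  by simp

lemma gap_params_value:
  fixes k n B kk H G D :: nat
  assumes D: "D = 6 * (k * k) + 8" and H: "H \<ge> D" and G: "G = 2 ^ H ^ D"
  obtains h M Q r l w W p q where
    "\<And>m. extend gap_params m [k, n, B, kk, H, G] =
       instance_regs k n B kk H G D h M Q r l w W p q"
    "h \<ge> H" "M = 2 ^ h ^ D" "Q = h ^ (2 * D)" "r = h ^ 6" "l = r ^ (k * k)" "w = 2 * (k * k) * Q * Q"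
    "W = w ^ l" "p = k * k * (M * M)" "q = Q * r * W"
    "n < M" "M \<le> (n + 1) * (n + 1) * (n + 1) * G" "G \<le> M" "Q \<le> M" "r \<le> M" "l \<le> M" "W \<le> M" "h \<le> M" "q \<le> M * M"
proof -
  let ?c = "(n + 1) * (n + 1) * (n + 1) * G"
  define h where "h = H + card {i. i < n \<and> 2 ^ (H + i) ^ D \<le> n}"
  define M where "M = (2 :: nat) ^ h ^ D"
  define Q where "Q = h ^ (2 * D)"
  define r where "r = h ^ 6"
  define l where "l = r ^ (k * k)"
  define w where "w = 2 * (k * k) * Q * Q"
  define W where "W = w ^ l"
  define p where "p = k * k * (M * M)"
  define q where "q = Q * r * W"
  have D8: "D \<ge> 8" by (simp add: D)
  have nM: "n < M" "M \<le> ?c"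
    unfolding M_def G h_def using blowup[OF H, of n] D8 by auto
  have hH: "h \<ge> H" by (simp add: h_def)
  with H D8 have h8: "h \<ge> D" "h \<ge> 8" by auto
  note par = gap_parameters[of k h, folded D, OF h8(1)]
  have "Q * r \<le> M" using par(4) by (simp add: Q_def r_def M_def)
  moreover have "Q > 0" "r > 0" using h8(2) by (simp_all add: Q_def r_def)
  ultimately have QM: "Q \<le> M" and rM: "r \<le> M" by (meson le_trans mult_le_mono nat_mult_le_cancel_disj le_refl Suc_leI One_nat_def
    mult.right_neutral mult_1 dvd_imp_le dvd_triv_left dvd_triv_right mult_pos_pos)+
  have WM: "W \<le> M" using par(1) by (simp add: W_def w_def l_def Q_def r_def M_def)
  \<comment> \<open>For \<open>k > 0\<close> the base \<open>w\<close> is at least 2, so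
    \<open>l < 2 ^ l \<le> W\<close>.\<close>
  have lM: "l \<le> M"
  proof (cases "k = 0")
    case False
    then have "2 \<le> w" using \<open>Q > 0\<close> by (simp add: w_def)
    then have "2 ^ l \<le> W" unfolding W_def by (rule power_mono) simp
    moreover have "l < 2 ^ l" by simp
    ultimately show ?thesis using WM by linarith
  qed (simp add: l_def M_def)
  have GM: "G \<le> M" unfolding G M_def using hH by (intro power_increasing power_mono) auto
  have hM: "h \<le> M"
  proof -
    have "h \<le> h ^ D" using h8 D8 by (intro self_le_power) auto
    also have "\<dots> \<le> M" unfolding M_def by (simp add: less_imp_le)
    finally show ?thesis .
  qed
  have qM: "q \<le> M * M" unfolding q_def using \<open>Q * r \<le> M\<close> WM by (rule mult_mono) auto
  \<comment> \<open>In this test the caps may really cut off the power, but not change the outcome: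
    an exponent cut down to \<open>n\<close> still gives a power above \<open>n\<close>.\<close>
  have cap: "n < min (2 ^ min e n) (n + 1) \<longleftrightarrow> n < 2 ^ e" for e :: nat
  proof (cases "e \<le> n")
    case False
    then have "n < 2 ^ n" "(2 :: nat) ^ n \<le> 2 ^ e" by (auto intro: power_increasing)
    then have "n < 2 ^ e" by (rule less_le_trans)
    with False show ?thesis by (simp add: min_def)
  qed (auto simp: min_def)
  have h1: "H + card {i. i < n \<and> \<not> n < min (2 ^ min ((H + i) ^ D) n) (n + 1)} = h"
    unfolding cap h_def by (simp add: not_less)
  have M1: "min (2 ^ min (h ^ D) ?c) ?c = M"
  proof -
    have "h ^ D < M" by (simp add: M_def)
    with nM(2) have "min (h ^ D) ?c = h ^ D" by (intro min_absorb1) linarith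
    then show ?thesis using nM(2) by (simp only: M_def[symmetric] min_absorb1)
  qed
  have Q1: "min (h ^ (2 * D)) M = Q" "min (h ^ 6) M = r" "min (r ^ (k * k)) M = l" "min (w ^ l) M = W"
    using QM rM lM WM by (simp_all add: Q_def r_def l_def W_def)
  have "extend gap_params m [k, n, B, kk, H, G] =
       instance_regs k n B kk H G D h M Q r l w W p q" for m
    unfolding gap_params_def
    by (rule extend_Cons[where v = "D"], (simp add: D),
        rule extend_Cons[where v = "h"], (use h1 in \<open>simp\<close>),
        rule extend_Cons[where v = "M"], (use M1 in \<open>simp\<close>),
        rule extend_Cons[where v = "Q"], (use Q1 in \<open>simp\<close>),
        rule extend_Cons[where v = "r"], (use Q1 in \<open>simp\<close>),
        rule extend_Cons[where v = "l"], (use Q1 in \<open>simp\<close>),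
        rule extend_Cons[where v = "w"], (simp add: w_def),
        rule extend_Cons[where v = "W"], (use Q1 in \<open>simp\<close>),
        rule extend_Cons[where v = "p"], (simp add: p_def),
        rule extend_Cons[where v = "q"], (simp add: q_def),
        rule extend_Cons[where v = "B + 3"], simp,
        rule extend_Cons[where v = "p * q"], simp,
        rule extend_Cons[where v = "B + 1"], simp,
        rule extend_Cons[where v = "B + 2"], simp, simp)
  with that hH nM GM QM rM lM WM hM qM show thesis
    unfolding M_def Q_def r_def l_def w_def W_def p_def q_def by blast
qed

section \<open>The stages of the clique program\<close>

lemma set_up_run:
  assumes "clean f1 T1" "clean f2 T2" "clean f3 T3"
  shows "\<exists>P c. \<forall>k n E. run P ([], snd (init (encode_clique k n E)))
    ((k + n + 3) ^ c + T1 k + T2 k + T3 k + 25)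
    ([k, n, 2 + n * n, f1 k, f2 k, f3 k], snd (init (encode_clique k n E)))"
proof -
  have "feasible True 2 (\<lambda>m xs. 2 + xs ! 1 * xs ! 1)"
    by (intro feasible_add feasible_mult feasible_const feasible_nth) simp_all
  from feasible_run[OF this] obtain P c where P [rule_format]:
    "\<forall>xs m X. args_le 2 m xs X \<longrightarrow> run P (xs, m) ((X + 2) ^ c) (xs @ [2 + xs ! 1 * xs ! 1], m)" by blast
  from clean_run_append[OF assms(1), where i = 2 and a = 3 and j = 0] obtain P1 where P1 [rule_format]:
    "\<forall>xs m. length xs = 3 \<longrightarrow> (\<forall>x\<ge>xs ! 2. m x = 0) \<longrightarrow> run P1 (xs, m) (T1 (xs ! 0) + 7) (xs @ [f1 (xs ! 0)], m)" by auto
  from clean_run_append[OF assms(2), where i = 2 and a = 4 and j = 0] obtain P2 where P2 [rule_format]: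
    "\<forall>xs m. length xs = 4 \<longrightarrow> (\<forall>x\<ge>xs ! 2. m x = 0) \<longrightarrow> run P2 (xs, m) (T2 (xs ! 0) + 7) (xs @ [f2 (xs ! 0)], m)" by auto
  from clean_run_append[OF assms(3), where i = 2 and a = 5 and j = 0] obtain P3 where P3 [rule_format]:
    "\<forall>xs m. length xs = 5 \<longrightarrow> (\<forall>x\<ge>xs ! 2. m x = 0) \<longrightarrow> run P3 (xs, m) (T3 (xs ! 0) + 7) (xs @ [f3 (xs ! 0)], m)" by auto
  show ?thesis
  proof (intro exI allI)
    fix k n E
    let ?m = "snd (init (encode_clique k n E))" and ?B = "2 + n * n"
    note m = init_encode_clique[where k = k and n = n and E = E]
    \<comment> \<open>The memory behind the input is empty and serves as scratch space; the
      subroutines return it empty, ready for the instance.\<close>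
    have m0: "\<forall>x\<ge>?B. ?m x = 0" using m(4) by blast
    have 1: "run (Const 0 0) ([], ?m) 1 ([0], ?m)"
      using run_Const[of 0 "[]" 0 ?m] by simp
    have 2: "run (Load 0 0) ([0], ?m) 1 ([k], ?m)"
      using run_Load_update[of 0 "[0]" 0 ?m] m(1) by simp
    have 3: "run (Const 1 1) ([k], ?m) 1 ([k, 1], ?m)"
      using run_Const[of 1 "[k]" 1 ?m] by simp
    have 4: "run (Load 1 1) ([k, 1], ?m) 1 ([k, n], ?m)"
      using run_Load_update[of 1 "[k, 1]" 1 ?m] m(2) by simp
    have "args_le 2 ?m [k, n] (k + n + 1)" using m(5) by (simp add: args_le_def)
    then have 5: "run P ([k, n], ?m) ((k + n + 3) ^ c) ([k, n, ?B], ?m)"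
      using P[of ?m "[k, n]" "k + n + 1"] by (simp add: eval_nat_numeral)
    have 6: "run P1 ([k, n, ?B], ?m) (T1 k + 7) ([k, n, ?B, f1 k], ?m)"
      using P1[of "[k, n, ?B]" ?m] m0 by simp
    have 7: "run P2 ([k, n, ?B, f1 k], ?m) (T2 k + 7) ([k, n, ?B, f1 k, f2 k], ?m)"
      using P2[of "[k, n, ?B, f1 k]" ?m] m0 by simp
    have 8: "run P3 ([k, n, ?B, f1 k, f2 k], ?m) (T3 k + 7) ([k, n, ?B, f1 k, f2 k, f3 k], ?m)"
      using P3[of "[k, n, ?B, f1 k, f2 k]" ?m] m0 by simp
    show "run (Seq (Const 0 0) (Seq (Load 0 0) (Seq (Const 1 1) (Seq (Load 1 1) (Seq P (Seq P1 (Seq P2 P3)))))))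
        ([], ?m) ((k + n + 3) ^ c + T1 k + T2 k + T3 k + 25) ([k, n, ?B, f1 k, f2 k, f3 k], ?m)"
      by (rule run_mono[OF run_Seq[OF 1 run_Seq[OF 2 run_Seq[OF 3 run_Seq[OF 4 run_Seq[OF 5 run_Seq[OF 6 run_Seq[OF 7 8]]]]]]]]) simp
  qed
qed

definition writes_instance :: "prog \<Rightarrow> nat \<Rightarrow> bool" where
  "writes_instance P c \<longleftrightarrow> (\<forall>m k n B kk H G D h M Q r l w W p q X. B = 2 + n * n \<longrightarrow> (\<forall>x\<ge>B. m x = 0) \<longrightarrow>
    (\<forall>x\<in>set (instance_regs k n B kk H G D h M Q r l w W p q). x \<le> X) \<longrightarrow> B + p * q + 4 \<le> X \<longrightarrow>
    (\<forall>x. m x \<le> X) \<longrightarrow>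
    run P (instance_regs k n B kk H G D h M Q r l w W p q, m) ((X + 2) ^ c + 3)
      (instance_regs k n B kk H G D h M Q r l w W p q,
       overlay B (snd (init (encode_set_cover kk p q (gap_edges p q (cell k n (graph_mem m n) M Q r l w W))))) m))"

lemma write_instance_run: "\<exists>P c. writes_instance P c"
proof -
  \<comment> \<open>The 20 instance registers are followed by the four of the writing loop, so
    register 23 is the index of the matrix entry. Its quotient and remainder by \<open>q\<close>, in
    registers 24 and 25, are the row and the column.\<close>
  let ?F = "\<lambda>m xs. of_bool (cell (xs ! 0) (xs ! 1) (graph_mem m (xs ! 1)) (xs ! 8) (xs ! 9) (xs ! 10)
      (xs ! 11) (xs ! 12) (xs ! 13) (xs ! 24) (xs ! 25)) :: nat"
  let ?G = "\<lambda>m xs. ?F m (xs @ [xs ! 23 mod xs ! 15])"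
  let ?H = "\<lambda>m xs. ?G m (xs @ [xs ! 23 div xs ! 15])"
  have F: "feasible True (Suc (Suc 24)) ?F" by (rule decidable_cell) simp
  have M: "feasible True (Suc 24) (\<lambda>m xs. xs ! 23 mod xs ! 15)"
    by (intro feasible_mod feasible_nth) simp_all
  have G: "feasible True (Suc 24) ?G" by (rule feasible_let[OF M F])
  have D: "feasible True 24 (\<lambda>m xs. xs ! 23 div xs ! 15)"
    by (intro feasible_div feasible_nth) simp_all
  have "feasible True 24 ?H" by (rule feasible_let[OF D G])
  moreover define F' where "F' = ?H"
  ultimately have "feasible True (20 + 4) F'" by simp
  from run_write_cells[OF this, of 16 17] obtain P c where P [rule_format]:
   "\<forall>xs m B hd f N X. length xs = 20 \<longrightarrow> xs ! 17 = N \<longrightarrow> xs ! 16 = B + length hd \<longrightarrow>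
    (\<forall>i<N. F' (overlay B (snd (init (hd @ map f [0..<i]))) m) (xs @ [1, B + length hd + i, N - i, i]) = f i) \<longrightarrow>
    (\<forall>x\<in>set xs. x \<le> X) \<longrightarrow> (\<forall>x\<in>set hd. x \<le> X) \<longrightarrow> (\<forall>i. m i \<le> X) \<longrightarrow> (\<forall>i<N. f i \<le> X) \<longrightarrow>
    B + length hd + N + 1 \<le> X \<longrightarrow>
    run P (xs, overlay B (snd (init hd)) m) ((X + 2) ^ c) (xs, overlay B (snd (init (hd @ map f [0..<N]))) m)"
    by auto
  show ?thesis unfolding writes_instance_def
  proof (intro exI allI impI)
    fix m :: mem and k n B kk H G D h M Q r l w W p q X
    let ?xs = "instance_regs k n B kk H G D h M Q r l w W p q"
    let ?cell = "cell k n (graph_mem m n) M Q r l w W"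
    let ?f = "\<lambda>i. of_bool (?cell (i div q) (i mod q)) :: nat"
    let ?E = "gap_edges p q ?cell"
    assume B: "B = 2 + n * n" and m: "\<forall>x\<ge>B. m x = 0"
      and X1: "\<forall>x\<in>set ?xs. x \<le> X" and X3: "B + p * q + 4 \<le> X" and mX: "\<forall>x. m x \<le> X"
    have o0: "overlay B (snd (init [])) m = m" by (rule overlay_init_Nil) (use m in blast)
    have o1: "m(B := kk) = overlay B (snd (init [kk])) m"
      using overlay_init_snoc[of B "[]" m kk] o0 by simp
    have o2: "(overlay B (snd (init [kk])) m)(B + 1 := p) = overlay B (snd (init [kk, p])) m"
      using overlay_init_snoc[of B "[kk]" m p] by simp
    have o3: "(overlay B (snd (init [kk, p])) m)(B + 2 := q) = overlay B (snd (init [kk, p, q])) m"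
      using overlay_init_snoc[of B "[kk, p]" m q] by simp
    have 1: "run (Store 2 3) (?xs, m) 1 (?xs, overlay B (snd (init [kk])) m)"
      using run_Store[of 2 ?xs 3 m] o1 by simp
    have 2: "run (Store 18 14) (?xs, overlay B (snd (init [kk])) m) 1 (?xs, overlay B (snd (init [kk, p])) m)"
      using run_Store[of 18 ?xs 14 "overlay B (snd (init [kk])) m"] o2 by simp
    have 3: "run (Store 19 15) (?xs, overlay B (snd (init [kk, p])) m) 1 (?xs, overlay B (snd (init [kk, p, q])) m)"
      using run_Store[of 19 ?xs 15 "overlay B (snd (init [kk, p])) m"] o3 by simp
    have graph: "graph_mem (overlay B \<mu> m) n = graph_mem m n" for \<mu>
    proof (intro ext)
      fix a b
      show "graph_mem (overlay B \<mu> m) n a b = graph_mem m n a b"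
      proof (cases "a < n \<and> b < n")
        case True
        have "a * n + b < Suc a * n" using True by simp
        also have "\<dots> \<le> n * n" using True by (intro mult_right_mono) auto
        finally show ?thesis using B by (simp add: graph_mem_def overlay_def)
      qed (auto simp: graph_mem_def)
    qed
    have X2: "\<forall>x\<in>set [kk, p, q]. x \<le> X" using X1 by simp
    have 4: "run P (?xs, overlay B (snd (init [kk, p, q])) m) ((X + 2) ^ c)
        (?xs, overlay B (snd (init ([kk, p, q] @ map ?f [0..<p * q]))) m)"
    proof (rule P)
      fix i
      show "F' (overlay B (snd (init ([kk, p, q] @ map ?f [0..<i]))) m)
         (?xs @ [1, B + length [kk, p, q] + i, p * q - i, i]) = ?f i"
        by (simp add: F'_def graph)
      show "?f i \<le> X" using X3 by (simp add: of_bool_def)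
      show "B + length [kk, p, q] + p * q + 1 \<le> X" using X3 by simp
      show "m i \<le> X" using mX by blast
      show "i \<le> X" if "i \<in> set ?xs" using X1 that by blast
      show "i \<le> X" if "i \<in> set [kk, p, q]" using X2 that by blast
    qed simp_all
    show "run (Seq (Store 2 3) (Seq (Store 18 14) (Seq (Store 19 15) P))) (?xs, m) ((X + 2) ^ c + 3)
      (?xs, overlay B (snd (init (encode_set_cover kk p q ?E))) m)"
      unfolding encode_set_cover_gap_edges
      by (rule run_mono[OF run_Seq[OF 1 run_Seq[OF 2 run_Seq[OF 3 4]]]]) simp
  qed
qed

text \<open>This is the final call, so the memory may be left in any state \<open>m'\<close>. Only
  the answer is brought to register 0, where the output is read.\<close>

lemma call_run:
  assumes "regs_below R P" "R > 0"
  shows "\<exists>Q. \<forall>xs B ys t v m. length xs = a \<longrightarrow> a > 2 \<longrightarrow> xs ! 2 = B \<longrightarrow> outputs P ys t v \<longrightarrow>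
    (\<exists>m'. run Q (xs, overlay B (snd (init ys)) m) (4 * t + R + 9) (v # tl xs, m'))"
proof -
  from run_reloc_setup[of a R] obtain S where S [rule_format]: "\<forall>zs B \<mu>. length zs = a \<longrightarrow>
     run S (zs @ [B], \<mu>) (R + 4) (zs @ reloc_regs R B 0 0 (\<lambda>_. 0), \<mu>)" by blast
  show ?thesis
  proof (cases "a > 2")
    case True
    then obtain C where C [rule_format]:
      "\<forall>ws m. length ws = a \<longrightarrow> run C (ws, m) 3 (ws @ [ws ! 2], m)" using run_copy[of "[2]" a] by auto
    show ?thesis
    proof (intro exI[of _ "Seq C (Seq S (Seq (relocate a R P) (Seq (Const 0 0) (Add 0 0 (a + 4)))))"] allI impI)
      fix xs ys :: "nat list" and B t v :: nat and m :: mem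
      assume a: "length xs = a" and B: "xs ! 2 = B" and out: "outputs P ys t v"
      let ?m = "overlay B (snd (init ys)) m"
      from out obtain \<sigma> where \<sigma>: "exec P (init ys) t \<sigma>" "fst \<sigma> 0 = v" unfolding outputs_def by blast
      have 1: "run C (xs, ?m) 3 (xs @ [B], ?m)" using C[OF a, of ?m] B by simp
      have 2: "run S (xs @ [B], ?m) (R + 4) (xs @ reloc_regs R B 0 0 (\<lambda>_. 0), ?m)" by (rule S[OF a])
      from run_relocate[OF \<sigma>(1) assms(1)] obtain s where "relocates R P (init ys) t \<sigma> s" by blast
      from relocatesD(2)[OF this a, of ?m B 0 0]
      have 3: "run (relocate a R P) (xs @ reloc_regs R B 0 0 (\<lambda>_. 0), ?m) (4 * t)
         (xs @ reloc_regs R B t s (fst \<sigma>), overlay B (snd \<sigma>) m)" by simp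
      let ?m' = "overlay B (snd \<sigma>) m"
      let ?x = "xs @ reloc_regs R B t s (fst \<sigma>)"
      obtain x0 xs' where xs: "xs = x0 # xs'" using a True by (cases xs) auto
      have v: "?x ! (a + 4) = v" using reloc_regs_nth(1)[OF a, of 0 R] assms(2) \<sigma>(2) by simp
      have 4: "run (Const 0 0) (?x, ?m') 1 (?x[0 := 0], ?m')" by (rule run_Const_update)
      have "run (Add 0 0 (a + 4)) (?x[0 := 0], ?m') 1 (?x[0 := 0, 0 := ?x[0 := 0] ! 0 + ?x[0 := 0] ! (a + 4)], ?m')"
        using a assms(2) by (intro run_Add_update) auto
      moreover have "?x[0 := 0, 0 := ?x[0 := 0] ! 0 + ?x[0 := 0] ! (a + 4)] = (v # tl xs) @ reloc_regs R B t s (fst \<sigma>)"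
        using v by (simp add: xs)
      ultimately have 5: "run (Add 0 0 (a + 4)) (?x[0 := 0], ?m') 1 (v # tl xs, ?m')"
        by (metis run_drop)
      show "\<exists>m'. run (Seq C (Seq S (Seq (relocate a R P) (Seq (Const 0 0) (Add 0 0 (a + 4))))))
         (xs, ?m) (4 * t + R + 9) (v # tl xs, m')"
        by (rule exI, rule run_mono[OF run_Seq[OF 1 run_Seq[OF 2 run_Seq[OF 3 run_Seq[OF 4 5]]]]]) simp
    qed
  qed simp
qed

lemma has_clique_graph_mem:
  fixes k n :: nat and E :: "(nat \<times> nat) set"
  assumes "simple_graph n E"
  defines "A \<equiv> graph_mem (snd (init (encode_clique k n E))) n"
  shows "\<not> A a a" "has_clique n E k \<longleftrightarrow> (\<exists>C\<subseteq>{..<n}. card C = k \<and> (\<forall>a\<in>C. \<forall>b\<in>C. a \<noteq> b \<longrightarrow> A a b))"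
proof -
  have A: "A a b \<longleftrightarrow> (a, b) \<in> E" if "a < n" "b < n" for a b
    using init_encode_clique(3)[OF that, of k E] that by (simp add: A_def graph_mem_def)
  show "\<not> A a a"
  proof
    assume "A a a"
    then have "a < n" by (simp add: A_def graph_mem_def)
    with A \<open>A a a\<close> have "(a, a) \<in> E" by simp
    with assms(1) show False by (auto simp: simple_graph_def irrefl_def)
  qed
  show "has_clique n E k \<longleftrightarrow> (\<exists>C\<subseteq>{..<n}. card C = k \<and> (\<forall>a\<in>C. \<forall>b\<in>C. a \<noteq> b \<longrightarrow> A a b))"
    unfolding has_clique_def using A by (intro ex_cong1 conj_cong refl) (auto simp: subset_iff)
qed

section \<open>From a distinguisher to a clique algorithm\<close>

theorem theorem4:
  fixes f \<epsilon> :: "nat \<Rightarrow> nat"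
  assumes "W1_neq_FPT"
    and "computable f"
    and "computable \<epsilon>"
    and "\<forall>b. \<exists>k. \<epsilon> k > b"
  shows "\<not> (\<exists>P. distinguishes_set_cover f \<epsilon> P)"
proof
  assume "\<exists>P. distinguishes_set_cover f \<epsilon> P"
  then obtain P c where P: "\<And>k p q E. set_cover_instance p q E \<Longrightarrow>
        \<exists>t v. outputs P (encode_set_cover k p q E) t v \<and>
               t \<le> f k * (c * (p + q + 1) ^ c) \<and>
               (small_opt k p q E \<or> large_opt \<epsilon> k p q E \<longrightarrow>
                  (if v \<noteq> 0 then small_opt k p q E else large_opt \<epsilon> k p q E))"
    unfolding distinguishes_set_cover_def by blast
  obtain \<kappa>0 where \<kappa>0: "computable \<kappa>0" "\<And>d. \<kappa>0 d \<ge> d" "\<And>d. \<epsilon> (\<kappa>0 d) > d"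
    using computable_search[OF assms(3,4)] by blast
  define D where "D k = 6 * (k * k) + 8" for k :: nat
  \<comment> \<open>A single search at \<open>D k\<close> yields both
    \<open>\<kappa> k \<ge> D k \<ge> k * k\<close> and
    \<open>\<epsilon> (\<kappa> k) > D k\<close>.\<close>
  define \<kappa> where "\<kappa> k = \<kappa>0 (D k)" for k
  \<comment> \<open>The sum meets the three demands of \<open>gap_reduction\<close> on
    \<open>h\<close> at once; \<open>D k\<close> is below it because it is at most
    \<open>\<kappa> k\<close>.\<close>
  define H where "H k = \<kappa> k + 1 + (k * k) ^ \<epsilon> (\<kappa> k)" for k
  define G :: "nat \<Rightarrow> nat" where "G k = 2 ^ H k ^ D k" for k
  note cl = computable_add computable_mult computable_power computable_const computable_id
  have comp_D: "computable D" unfolding D_def by (intro cl)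
  have comp_\<kappa>: "computable \<kappa>" unfolding \<kappa>_def by (rule computable_comp[OF \<kappa>0(1) comp_D])
  have comp_H: "computable H" unfolding H_def
    by (intro cl comp_\<kappa> computable_comp[OF assms(3) comp_\<kappa>])
  have comp_G: "computable G" unfolding G_def by (intro cl comp_H comp_D)
  obtain T1 where T1: "computable T1" "clean \<kappa> T1" using computable_clean[OF comp_\<kappa>] by blast
  obtain T2 where T2: "computable T2" "clean H T2" using computable_clean[OF comp_H] by blast
  obtain T3 where T3: "computable T3" "clean G T3" using computable_clean[OF comp_G] by blast
  obtain R where R: "R > 0" "regs_below R P" using regs_below_exists by blast
  obtain Q1 c1 where Q1 [rule_format]: "\<forall>k n E. run Q1 ([], snd (init (encode_clique k n E)))
    ((k + n + 3) ^ c1 + T1 k + T2 k + T3 k + 25)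
    ([k, n, 2 + n * n, \<kappa> k, H k, G k], snd (init (encode_clique k n E)))"
    using set_up_run[OF T1(2) T2(2) T3(2)] by blast
  obtain Q2 c2 where Q2 [rule_format]: "\<forall>xs m X. length xs = 6 \<longrightarrow> (\<forall>x\<in>set (extend gap_params m xs). x \<le> X) \<longrightarrow>
    (\<forall>i. m i \<le> X) \<longrightarrow> run Q2 (xs, m) ((X + 2) ^ c2) (extend gap_params m xs, m)"
    using chain_run[OF chain_gap_params] by blast
  obtain Q3 c3 where Q3: "writes_instance Q3 c3" using write_instance_run by blast
  from call_run[OF R(2,1), of 20] obtain Q4 where Q4: "\<forall>xs B ys t v m. length xs = 20 \<longrightarrow> 20 > (2 :: nat) \<longrightarrow>
    xs ! 2 = B \<longrightarrow> outputs P ys t v \<longrightarrow>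
    (\<exists>m'. run Q4 (xs, overlay B (snd (init ys)) m) (4 * t + R + 9) (v # tl xs, m'))"
    by (elim exE) (rule that)
  define d where "d = c1 + c2 + c3 + c"
  define S where "S k = T1 k + T2 k + T3 k + f (\<kappa> k) + 1" for k
  \<comment> \<open>All costs are bounded by \<open>S k\<close>, constants and powers of
    \<open>M ^ 7\<close> with exponent at most \<open>d\<close>. The bound
    \<open>M \<le> (n + 1) ^ 3 * G k\<close> separates these into \<open>G k ^ (7 * d)\<close> and
    \<open>(n + 1) ^ (21 * d)\<close>.\<close>
  define g where "g k = S k * G k ^ (7 * d)" for k
  define C where "C = 4 * c + R + 50"
  have "computable g"
    unfolding g_def S_def by (intro cl T1(1) T2(1) T3(1) computable_comp[OF assms(2) comp_\<kappa>] comp_G)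
  moreover have "decides_clique g (Seq Q1 (Seq Q2 (Seq Q3 Q4)))"
    unfolding decides_clique_def
  \<comment> \<open>The same constant has to serve as factor and as exponent, hence the sum of
    both.\<close>
  proof (rule exI[of _ "C + 21 * d"], intro allI impI)
    fix k n E assume graph: "simple_graph n E"
    let ?m = "snd (init (encode_clique k n E))" and ?B = "2 + n * n"
    have D: "D k = 6 * (k * k) + 8" by (simp add: D_def)
    have \<kappa>: "\<kappa> k \<ge> D k" "\<epsilon> (\<kappa> k) > D k" using \<kappa>0(2,3) by (simp_all add: \<kappa>_def)
    have HD: "H k \<ge> D k" using \<kappa>(1) by (simp add: H_def)
    obtain h M Q r l w W p q where ext: "\<And>m. extend gap_params m [k, n, ?B, \<kappa> k, H k, G k] =
       instance_regs k n ?B (\<kappa> k) (H k) (G k) (D k) h M Q r l w W p q"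
      and h: "h \<ge> H k" and M: "M = 2 ^ h ^ D k" and Q: "Q = h ^ (2 * D k)" and r: "r = h ^ 6" and l: "l = r ^ (k * k)"
      and w: "w = 2 * (k * k) * Q * Q" and W: "W = w ^ l" and p: "p = k * k * (M * M)" and q: "q = Q * r * W"
      and le: "n < M" "M \<le> (n + 1) * (n + 1) * (n + 1) * G k" "G k \<le> M" "Q \<le> M" "r \<le> M" "l \<le> M" "W \<le> M" "h \<le> M" "q \<le> M * M"
      using gap_params_value[OF D HD G_def] by blast
    let ?A = "graph_mem ?m n"
    let ?E = "gap_edges p q (cell k n ?A M Q r l w W)"
    have hyps: "h \<ge> D k" "h > \<kappa> k" "h \<ge> (k * k) ^ \<epsilon> (\<kappa> k)" "\<kappa> k \<ge> k * k" "\<epsilon> (\<kappa> k) > D k"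
      using h HD \<kappa> D by (simp_all add: H_def)
    note red = gap_reduction[where A = ?A and \<epsilon> = \<epsilon> and kk = "\<kappa> k", OF D M Q r l w W p q hyps less_imp_le[OF le(1)] has_clique_graph_mem(1)[OF graph, of k]]
    obtain t v where out: "outputs P (encode_set_cover (\<kappa> k) p q ?E) t v"
      and t: "t \<le> f (\<kappa> k) * (c * (p + q + 1) ^ c)"
      and v: "small_opt (\<kappa> k) p q ?E \<or> large_opt \<epsilon> (\<kappa> k) p q ?E \<longrightarrow>
                  (if v \<noteq> 0 then small_opt (\<kappa> k) p q ?E else large_opt \<epsilon> (\<kappa> k) p q ?E)"
      using P[OF set_cover_instance_gap_edges] by blast
    \<comment> \<open>Exactly one of the two cases holds, so the promise of the distinguisher
      determines whether its output is 0.\<close>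
    have correct: "v \<noteq> 0 \<longleftrightarrow> has_clique n E k"
    proof (cases "has_clique n E k")
      case True
      then have "small_opt (\<kappa> k) p q ?E \<and> \<not> large_opt \<epsilon> (\<kappa> k) p q ?E"
        unfolding has_clique_graph_mem(2)[OF graph] by (rule red(1))
      with v True show ?thesis by (cases "v = 0") auto
    next
      case False
      then have "\<not> small_opt (\<kappa> k) p q ?E \<and> large_opt \<epsilon> (\<kappa> k) p q ?E"
        unfolding has_clique_graph_mem(2)[OF graph] by (rule red(2))
      with v False show ?thesis by (cases "v = 0") auto
    qed
    have M8: "M \<ge> 8" using le(8) hyps(1) unfolding D by linarith
    have M_step: "8 * M ^ i \<le> M ^ Suc i" for i using M8 by simp
    have M_mono: "M ^ i \<le> M ^ j" if "i \<le> j" for i j using that M8 by (intro power_increasing) auto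
    \<comment> \<open>Bounds every register, every memory cell and the last address written:
      \<open>p \<le> M ^ 3\<close> and \<open>q \<le> M ^ 2\<close> leave one factor
      \<open>M \<ge> 8\<close> for the smaller terms.\<close>
    define X where "X = M ^ 6"
    have MX: "M ^ i \<le> X" if "i \<le> 6" for i unfolding X_def using that by (rule M_mono)
    have MX1: "M \<le> X" using MX[of 1] by simp
    have kD: "k \<le> D k" unfolding D by (cases k) auto
    have Dh: "D k \<le> h" "\<kappa> k \<le> h" using h HD hyps by auto
    have pM: "p \<le> M ^ 3"
    proof -
      have "p \<le> M * (M * M)" unfolding p using hyps(1) le(8) unfolding D by (intro mult_right_mono) auto
      then show ?thesis by (simp add: power3_eq_cube)
    qed
    have qM: "q \<le> M ^ 2" using le(9) by (simp add: power2_eq_square)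
    have pq: "p * q \<le> M ^ 5"
      using mult_mono[OF pM qM] by (simp flip: power_add)
    have wM: "w \<le> M ^ 3"
    proof -
      have "w \<le> M * M * M" unfolding w using hyps(1) le(4,8) unfolding D by (intro mult_mono) auto
      then show ?thesis by (simp add: power3_eq_cube)
    qed
    have B: "?B \<le> 2 + M ^ 2" using mult_mono[of n M n M] le(1) by (simp add: power2_eq_square)
    have M5: "8 * M ^ 5 \<le> X" "M ^ 2 \<le> M ^ 5" "8 \<le> M ^ 5"
      using M_step[of 5] M_mono[of 2 5] M_mono[of 1 5] M8 by (auto simp: X_def)
    have big: "?B + p * q + 4 \<le> X" using B pq M5 by linarith
    let ?xs = "instance_regs k n ?B (\<kappa> k) (H k) (G k) (D k) h M Q r l w W p q"
    have bounds: "\<forall>x\<in>set ?xs. x \<le> X"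
      using kD Dh h le MX1 MX[of 3] MX[of 2] wM pM qM big by simp
    have mX: "\<forall>x. ?m x \<le> X"
    proof
      fix x
      have "?m x \<le> k + n + 1" by (rule init_encode_clique(5))
      also have "k + n + 1 \<le> 8 * M" using kD Dh le(1,8) by linarith
      also have "8 * M \<le> X" using MX[of 2] unfolding power2_eq_square
        by (intro le_trans[OF mult_right_mono[OF M8]]) simp_all
      finally show "?m x \<le> X" .
    qed
    have "run Q2 ([k, n, ?B, \<kappa> k, H k, G k], ?m) ((X + 2) ^ c2)
        (extend gap_params ?m [k, n, ?B, \<kappa> k, H k, G k], ?m)"
    proof (rule Q2)
      show "x \<le> X" if "x \<in> set (extend gap_params ?m [k, n, ?B, \<kappa> k, H k, G k])" for x
        using that bounds unfolding ext by blast
      show "?m i \<le> X" for i using mX by blast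
    qed simp
    then have run2: "run Q2 ([k, n, ?B, \<kappa> k, H k, G k], ?m) ((X + 2) ^ c2) (?xs, ?m)"
      unfolding ext .
    have "\<forall>x\<ge>?B. ?m x = 0" by (simp add: init_encode_clique(4))
    from Q3[unfolded writes_instance_def, rule_format, OF refl this[rule_format] bounds[rule_format] big mX[rule_format]]
    have run3: "run Q3 (?xs, ?m) ((X + 2) ^ c3 + 3) (?xs, overlay ?B (snd (init (encode_set_cover (\<kappa> k) p q ?E))) ?m)" .
    from Q4[rule_format, of ?xs ?B, OF _ _ _ out] obtain m'
      where run4: "run Q4 (?xs, overlay ?B (snd (init (encode_set_cover (\<kappa> k) p q ?E))) ?m) (4 * t + R + 9) (v # tl ?xs, m')"
      by auto
    let ?T = "(k + n + 3) ^ c1 + T1 k + T2 k + T3 k + 25 + ((X + 2) ^ c2 + ((X + 2) ^ c3 + 3 + (4 * t + R + 9)))"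
    from outputs_run[OF run_Seq[OF Q1 run_Seq[OF run2 run_Seq[OF run3 run4]]]]
    obtain t' where t': "t' \<le> ?T" "outputs (Seq Q1 (Seq Q2 (Seq Q3 Q4))) (encode_clique k n E) t' v" by blast
    let ?Y = "M ^ 7"
    let ?Z = "?Y ^ d"
    have Y: "k + n + 3 \<le> ?Y" "X + 2 \<le> ?Y" "p + q + 1 \<le> ?Y"
    proof -
      have X8: "8 * X \<le> ?Y" using M_step[of 6] by (simp add: X_def)
      have "1 \<le> X" "k \<le> X" "n \<le> X" "p \<le> X" "q \<le> X" using bounds big by simp_all
      with X8 show "k + n + 3 \<le> ?Y" "X + 2 \<le> ?Y" "p + q + 1 \<le> ?Y" by linarith+
    qed
    have Y1: "?Y \<ge> 1" using M8 by simp
    have Z: "x ^ i \<le> ?Z" if "x \<le> ?Y" "i \<le> d" for x i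
    proof -
      have "x ^ i \<le> ?Y ^ i" using that(1) by (rule power_mono) simp
      also have "\<dots> \<le> ?Z" using that(2) Y1 by (rule power_increasing)
      finally show ?thesis .
    qed
    have S: "S k \<ge> 1" by (simp add: S_def)
    have Z1: "?Z \<ge> 1" using Y1 by simp
    have "t \<le> f (\<kappa> k) * (c * ?Z)"
      by (rule le_trans[OF t]) (intro mult_left_mono Z Y; simp add: d_def)
    then have "?T \<le> ?Z + S k + 25 + (?Z + (?Z + 3 + (4 * (S k * (c * ?Z)) + R + 9)))"
      using Z[OF Y(1), of c1] Z[OF Y(2), of c2] Z[OF Y(2), of c3] mult_right_mono[of "f (\<kappa> k)" "S k" "c * ?Z"]
      by (simp add: d_def S_def)
    also have "\<dots> \<le> S k * ?Z * C"
    proof -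
      have SZ: "?Z \<le> S k * ?Z" "S k \<le> S k * ?Z" "1 \<le> S k * ?Z" using S Z1 by (auto simp: Suc_le_eq)
      have "R * 1 \<le> R * (S k * ?Z)" using SZ(3) by (rule mult_left_mono) simp
      then have "?Z + S k + 25 + (?Z + (?Z + 3 + (4 * (S k * (c * ?Z)) + R + 9))) \<le>
          4 * (S k * ?Z) + 37 * (S k * ?Z) + 4 * (S k * (c * ?Z)) + R * (S k * ?Z)"
        using SZ by linarith
      also have "\<dots> \<le> S k * ?Z * C" by (simp add: C_def algebra_simps)
      finally show ?thesis .
    qed
    also have "\<dots> \<le> S k * (((n + 1) ^ 3 * G k) ^ (7 * d)) * C"
    proof -
      have "M \<le> (n + 1) ^ 3 * G k" using le(2) by (simp only: power3_eq_cube)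
      then have "M ^ (7 * d) \<le> ((n + 1) ^ 3 * G k) ^ (7 * d)" by (rule power_mono) simp
      then show ?thesis by (intro mult_right_mono mult_left_mono) (simp_all add: power_mult)
    qed
    also have "\<dots> = g k * (C * (n + 1) ^ (21 * d))"
      by (simp add: g_def power_mult_distrib flip: power_mult)
    also have "\<dots> \<le> g k * ((C + 21 * d) * (n + 1) ^ (C + 21 * d))"
      by (intro mult_left_mono mult_mono power_increasing) auto
    finally have "?T \<le> g k * ((C + 21 * d) * (n + 1) ^ (C + 21 * d))" .
    with t' correct show "\<exists>t v. outputs (Seq Q1 (Seq Q2 (Seq Q3 Q4))) (encode_clique k n E) t v \<and>
        t \<le> g k * ((C + 21 * d) * (n + 1) ^ (C + 21 * d)) \<and> (v \<noteq> 0 \<longleftrightarrow> has_clique n E k)"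
      by (intro exI[of _ t'] exI[of _ v]) auto
  qed
  ultimately show False using assms(1) unfolding W1_neq_FPT_def by blast
qed

end
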